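(* Let $r_i=-\Gamma(1/4)^4/(8\sqrt3\,\pi^2)$ and define the numbers $q_n$ ($n\ge0$) by the expansion $$\frac{(\Delta|_{12}\sigma_i)(z)}{-64\,\Delta(i)}=\sum_{n\ge0}q_n\frac{(r_i z)^n}{n!}\qquad(|z|<1).$$ Then the $q_n$ are integers, and for every prime $l$ with $2<l<100$: $q_n\equiv0\bmod l$ for all sufficiently large $n$ if and only if $l\equiv3\bmod4$.
   Context: $\Delta(z)=q\prod_{n\ge1}(1-q^n)^{24}$, $q=e^{2\pi i z}$. $\sigma_i=\frac{1}{2i}\begin{pmatrix}i&i\\-1&1\end{pmatrix}$, and $(f|_{12}\gamma)(z)=\det(\gamma)^6f(\gamma z)(cz+d)^{-12}$ for $\gamma=\begin{pmatrix}a&b\\c&d\end{pmatrix}$. Equivalently, $q_n=p_n(0)$ where $p_n(t)\in\mathbb Z[t]$ are given by $p_0=1$, $p_1=0$, $p_{n+1}=-2nt\,p_n+6(t^2-1)p_n'-n(n+11)p_{n-1}$ for $n\ge1$. *)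

theory Defs
  imports "HOL-Analysis.Analysis" "HOL-Number_Theory.Number_Theory"
begin

definition Delta :: "complex \<Rightarrow> complex" where
  "Delta z = (let q = exp (2 * of_real pi * \<i> * z) in q * (\<Prod>n. (1 - q ^ Suc n) ^ 24))"

definition slash12 :: "(complex \<Rightarrow> complex) \<Rightarrow> complex ^ 2 ^ 2 \<Rightarrow> complex \<Rightarrow> complex" where
  "slash12 f \<gamma> z =
     det \<gamma> ^ 6 * f (moebius (\<gamma> $ 1 $ 1) (\<gamma> $ 1 $ 2) (\<gamma> $ 2 $ 1) (\<gamma> $ 2 $ 2) z)
       * (\<gamma> $ 2 $ 1 * z + \<gamma> $ 2 $ 2) powi (- 12)"

text \<open>\<^term>\<open>mat k\<close> is the scalar matrix, so multiplying by it scales all entries. The action of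
  \<open>sigma_i\<close> is \<open>z \<mapsto> \<i> * (1 + z) / (1 - z)\<close>, which maps the unit disc onto the upper half-plane.\<close>

definition sigma_i :: "complex ^ 2 ^ 2" where
  "sigma_i = mat (1 / (2 * \<i>)) ** vector [vector [\<i>, \<i>], vector [- 1, 1]]"

definition r_i :: real where
  "r_i = - (Gamma (1 / 4) ^ 4) / (8 * sqrt 3 * pi\<^sup>2)"

definition is_Delta_expansion_at_i :: "(nat \<Rightarrow> complex) \<Rightarrow> bool" where
  "is_Delta_expansion_at_i q \<longleftrightarrow>
     (\<forall>z. norm z < 1 \<longrightarrow>
       (\<lambda>n. q n * (of_real r_i * z) ^ n / fact n) sums (slash12 Delta sigma_i z / (- 64 * Delta \<i>)))"

end

(*
Put D = q d/dq in the nome q = exp(-pi y), so that Delta(iy) = q^2 prod (1 - q^(2n))^24.  All facts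
about theta functions come from the two duplication formulas
  theta(q)^2 + theta(-q)^2 = 2 theta(q^2)^2   and   theta(q) theta(-q) = theta(-q^2)^2
and the principle that a function on (0,1) with f(q^2) = f(q) and a limit at 0 is constant.  They give
in turn the product for Delta, the differential equations equivalent to Ramanujan's, and, because the
formulas are one step of the arithmetic-geometric mean, Gauss's evaluation of the elliptic integrals
of theta(q)^2 and theta(-q)^2.  The latter contains the inversion y -> 1/y and the lemniscatic value at
y = 1.  In the disc coordinate the quasimodular term then vanishes at the centre, and the Taylor
coefficients are p_n(0) times powers of r_i.

For the congruences, the passage from p_(ml) to p_((m+1)l) modulo l is f -> X f' + Y f, by a Leibniz rule
for the recursion.  If l divides X(0), then each passage raises the order of vanishing at t = 0 and
t^l is a constant modulo l.  If not, eventual vanishing of the coefficients makes this operator nilpotent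
on 1 in F_l[t]/(t^l), hence X u' = 1 solvable, which fails if 1/X has a nonzero coefficient at t^(l-1).
*)
theory Submission
  imports Defs "HOL-Complex_Analysis.Complex_Analysis" "HOL-Real_Asymp.Real_Asymp"
    "HOL-Computational_Algebra.Polynomial"
begin

text \<open>The operator f -> X f' + Y f has one source: modulo a prime l the inner binomials of the
  Leibniz rule vanish, so in weight 0 the l-th iterate is a derivation that kills constants. X is
  its value on t, and Y is the l-th iterate of 1 in weight 12. The equation X u' = 1 comes from a
  Wronskian: if g is the last nonzero element of the chain 1, p_l, p_(2l), ... and h the one before,
  then X g' + Y g = 0 and X h' + Y h = g give X (h/g)' = 1. A derivative has no t^(l-1) coefficient
  modulo l, which is the obstruction. Which case holds is settled by a finite computation for each
  prime. Most identities between theta functions scale under q -> q^2 instead of being invariant.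
  Since ln(q^2) = 2 ln q, a suitable power of ln q, or a logarithm divided by ln q, restores
  invariance; crude growth at 0 then fixes the constant. The number r_i is (-pi/3) V(0): V^2 is E_4
  transported to the disc, and V(0) = sqrt 3 times theta(-exp(-pi))^4. The factor -pi/3 comes from
  differentiating the nome in the disc coordinate.\<close>

hide_const (open) Module.module.smult UnivPoly.up_ring.coeff UnivPoly.up_ring.monom

section \<open>Congruences for the polynomial recursion\<close>

text \<open>\<open>serre_seq 12 0 1\<close> is the sequence \<open>p\<^sub>n\<close>. In modular terms \<open>serre_seq k w f n\<close> is the coefficient
  polynomial (in \<open>t = E\<^sub>6 / E\<^sub>4\<^bsup>3/2\<^esup>\<close>) of the \<open>n\<close>-th Serre derivative of \<open>\<Delta>\<^bsup>k'/12\<^esup> E\<^sub>4\<^bsup>w/2\<^esup> f(t)\<close>, where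
  \<open>k = k' + 2 w\<close> is the total weight.\<close>
fun serre_seq :: "int \<Rightarrow> int \<Rightarrow> int poly \<Rightarrow> nat \<Rightarrow> int poly" where
  "serre_seq k w f 0 = f"
| "serre_seq k w f (Suc n) = [:-6, 0, 6:] * pderiv (serre_seq k w f n)
     - [:0, 2 * (int n + w):] * serre_seq k w f n
     - smult (int n * (int n + k - 1)) (serre_seq k w f (n - 1))"

declare serre_seq.simps(2) [simp del]

lemma smult_sum_right: "smult c (\<Sum>x\<in>A. f x) = (\<Sum>x\<in>A. smult c (f x))"
  by (induction A rule: infinite_finite_induct) (auto simp: smult_add_right)

text \<open>The back reference with factor \<open>n * (n + k - 1)\<close> is the correction that
  makes the exponential generating functions of the iterates multiply when the weights add, as for
  Cohen-Kuznetsov series. A plain product rule for one step would not iterate to this.\<close>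

lemma serre_seq_mult:
  "serre_seq (k + k') (w + w') (f * g) n =
    (\<Sum>j\<le>n. of_nat (n choose j) * (serre_seq k w f j * serre_seq k' w' g (n - j)))"
proof (induction n rule: less_induct)
  case (less n)
  show ?case
  proof (cases n)
    case 0
    then show ?thesis by simp
  next
    case (Suc m)
    let ?a = "serre_seq k w f" and ?b = "serre_seq k' w' g"
    let ?T = "\<lambda>n. \<Sum>j\<le>n. of_nat (n choose j) * (?a j * ?b (n - j)) :: int poly"
    let ?D = "\<lambda>p. [:-6, 0, 6:] * pderiv p :: int poly"
    let ?c = "\<lambda>j. smult (int j * (int j + k - 1)) (?a (j - 1)) :: int poly"
    let ?d = "\<lambda>j. smult (int j * (int j + k' - 1)) (?b (j - 1)) :: int poly"
    have IH: "serre_seq (k + k') (w + w') (f * g) m = ?T m"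
      using less Suc by simp
    have IH': "serre_seq (k + k') (w + w') (f * g) (m - 1) = ?T (m - 1)"
      using less[of "m - 1"] Suc by simp
    \<comment> \<open>Pascal's rule: in each summand exactly one of the two factors is advanced by
      one step, so that its own recursion applies.\<close>
    have "?T (Suc m) = (\<Sum>j\<le>m. of_nat (m choose j) * (?a (Suc j) * ?b (m - j)))
        + (\<Sum>j\<le>m. of_nat (m choose j) * (?a j * ?b (Suc m - j)))"
    proof -
      have "?T (Suc m) = ?b (Suc m) * ?a 0 + (\<Sum>j\<le>m. of_nat (Suc m choose Suc j) * (?a (Suc j) * ?b (m - j)))"
        by (subst sum.atMost_Suc_shift) (simp add: mult.commute)
      also have "(\<Sum>j\<le>m. of_nat (Suc m choose Suc j) * (?a (Suc j) * ?b (m - j))) =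
          (\<Sum>j\<le>m. of_nat (m choose j) * (?a (Suc j) * ?b (m - j)))
          + (\<Sum>j\<le>m. of_nat (m choose Suc j) * (?a (Suc j) * ?b (m - j)))"
        by (simp add: sum.distrib distrib_right)
      also have "?b (Suc m) * ?a 0 + \<dots> = (\<Sum>j\<le>m. of_nat (m choose j) * (?a (Suc j) * ?b (m - j)))
          + (\<Sum>j\<le>Suc m. of_nat (m choose j) * (?a j * ?b (Suc m - j)))"
        unfolding sum.atMost_Suc_shift[of "\<lambda>j. of_nat (m choose j) * (?a j * ?b (Suc m - j))"]
        by (simp add: mult.commute add_ac)
      finally show ?thesis by simp
    qed
    also have "\<dots> = (\<Sum>j\<le>m. of_nat (m choose j) * (?D (?a j * ?b (m - j))
          - [:0, 2 * (int m + (w + w')):] * (?a j * ?b (m - j))))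
          - ((\<Sum>j\<le>m. of_nat (m choose j) * (?c j * ?b (m - j))) +
             (\<Sum>j\<le>m. of_nat (m choose j) * (?a j * ?d (m - j))))"
    proof -
      have *: "of_nat (m choose j) * (?a (Suc j) * ?b (m - j)) + of_nat (m choose j) * (?a j * ?b (Suc m - j))
        = of_nat (m choose j) * (?D (?a j * ?b (m - j))
          - [:0, 2 * (int m + (w + w')):] * (?a j * ?b (m - j)))
          - (of_nat (m choose j) * (?c j * ?b (m - j)) + of_nat (m choose j) * (?a j * ?d (m - j)))"
        if "j \<le> m" for j
      proof -
        have e: "Suc m - j = Suc (m - j)" using that by simp
        have e2: "[:0, 2 * (int m + (w + w')):] = [:0, 2 * (int j + w):] + [:0, 2 * (int (m - j) + w'):]"
          using that by (simp add: of_nat_diff)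
        show ?thesis
          unfolding e serre_seq.simps(2) e2 by (simp add: pderiv_mult algebra_simps del: mult_pCons_left mult_pCons_right add_pCons)
      qed
      show ?thesis unfolding sum.distrib[symmetric] sum_subtractf[symmetric]
        by (rule sum.cong[OF refl], rule *) simp
    qed
    also have "(\<Sum>j\<le>m. of_nat (m choose j) * (?D (?a j * ?b (m - j))
          - [:0, 2 * (int m + (w + w')):] * (?a j * ?b (m - j)))) =
        ?D (?T m) - [:0, 2 * (int m + (w + w')):] * ?T m"
    proof -
      have pd: "pderiv (of_nat c * p) = of_nat c * pderiv p" for c and p :: "int poly"
        by (simp add: of_nat_poly pderiv_smult)
      show ?thesis
        using higher_pderiv_sum[of 1 "\<lambda>j. of_nat (m choose j) * (?a j * ?b (m - j))" "{..m}"]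
        by (simp add: sum_distrib_left sum_distrib_right sum_subtractf pd algebra_simps del: mult_pCons_left mult_pCons_right add_pCons)
    qed
    \<comment> \<open>Absorbing \<open>j\<close> and \<open>m - j\<close> into the binomial
      coefficients turns both sums into sums over the pairs \<open>(j, r - j)\<close> with
      \<open>r = m - 1\<close>. The remaining factors \<open>j + k\<close> and
      \<open>r - j + k'\<close> add up to \<open>m + (k + k') - 1\<close>, independently of
      \<open>j\<close>.\<close>
    also have "(\<Sum>j\<le>m. of_nat (m choose j) * (?c j * ?b (m - j))) +
             (\<Sum>j\<le>m. of_nat (m choose j) * (?a j * ?d (m - j)))
       = smult (int m * (int m + (k + k') - 1)) (?T (m - 1))"
    proof (cases m)
      case 0
      then show ?thesis by simp
    next
      case (Suc r)
      have "(\<Sum>j\<le>m. of_nat (m choose j) * (?c j * ?b (m - j))) =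
          (\<Sum>j\<le>r. smult (int (m choose Suc j) * int (Suc j) * (int j + k)) (?a j * ?b (r - j)))"
        unfolding Suc by (subst sum.atMost_Suc_shift)
         (auto simp: of_nat_poly algebra_simps intro!: sum.cong)
      also have "\<dots> = (\<Sum>j\<le>r. smult (int m * int (r choose j) * (int j + k)) (?a j * ?b (r - j)))"
        by (intro sum.cong refl, unfold of_nat_mult[symmetric] Suc)
           (metis Suc_times_binomial_eq mult.commute)
      finally have 1: "(\<Sum>j\<le>m. of_nat (m choose j) * (?c j * ?b (m - j))) = \<dots>" .
      have "(\<Sum>j\<le>m. of_nat (m choose j) * (?a j * ?d (m - j))) =
          (\<Sum>j\<le>r. smult (int (m choose j) * int (m - j) * (int (r - j) + k')) (?a j * ?b (r - j)))"
        unfolding Suc by (auto simp: of_nat_poly Suc_diff_le algebra_simps intro!: sum.cong)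
      also have "\<dots> = (\<Sum>j\<le>r. smult (int m * int (r choose j) * (int (r - j) + k')) (?a j * ?b (r - j)))"
      proof (intro sum.cong refl)
        fix j assume "j \<in> {..r}"
        hence "(m choose j) * (m - j) = m * (r choose j)"
          unfolding Suc using binomial_absorb_comp[of "Suc r" j] by (simp add: mult.commute)
        thus "smult (int (m choose j) * int (m - j) * (int (r - j) + k')) (?a j * ?b (r - j)) =
          smult (int m * int (r choose j) * (int (r - j) + k')) (?a j * ?b (r - j))"
          unfolding of_nat_mult[symmetric] by simp
      qed
      finally have 2: "(\<Sum>j\<le>m. of_nat (m choose j) * (?a j * ?d (m - j))) = \<dots>" .
      show ?thesis unfolding 1 2 sum.distrib[symmetric]
        unfolding Suc diff_Suc_1 smult_sum_right
        by (intro sum.cong refl) (simp add: of_nat_poly of_nat_diff algebra_simps smult_add_left[symmetric])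
    qed
    finally show ?thesis
      unfolding Suc serre_seq.simps(2) IH IH' by simp
  qed
qed

text \<open>The polynomials that vanish in \<open>(\<int>/l)[t] / (t\<^sup>s)\<close>.\<close>
definition pmod :: "nat \<Rightarrow> nat \<Rightarrow> int poly set" where
  "pmod l s = {f. \<forall>j<s. int l dvd coeff f j}"

lemma pmod_0 [simp]: "0 \<in> pmod l s"
  by (simp add: pmod_def)

lemma pmod_add: "f \<in> pmod l s \<Longrightarrow> g \<in> pmod l s \<Longrightarrow> f + g \<in> pmod l s"
  by (simp add: pmod_def)

lemma pmod_diff: "f \<in> pmod l s \<Longrightarrow> g \<in> pmod l s \<Longrightarrow> f - g \<in> pmod l s"
  by (simp add: pmod_def)

lemma pmod_sum: "(\<And>x. x \<in> A \<Longrightarrow> f x \<in> pmod l s) \<Longrightarrow> sum f A \<in> pmod l s"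
  by (simp add: pmod_def coeff_sum dvd_sum)

lemma pmod_mono: "f \<in> pmod l s \<Longrightarrow> s' \<le> s \<Longrightarrow> f \<in> pmod l s'"
  by (auto simp: pmod_def)

lemma pmod_mult: "f \<in> pmod l s \<Longrightarrow> g \<in> pmod l s' \<Longrightarrow> f * g \<in> pmod l (s + s')"
  unfolding pmod_def mem_Collect_eq coeff_mult
proof (intro allI impI dvd_sum)
  fix j i assume *: "\<forall>j<s. int l dvd coeff f j" "\<forall>j<s'. int l dvd coeff g j" "j < s + s'" "i \<in> {..j}"
  show "int l dvd coeff f i * coeff g (j - i)"
    using * by (cases "i < s") (auto intro: dvd_mult dvd_mult2)
qed

lemma pmod_mult_left: "g \<in> pmod l s \<Longrightarrow> f * g \<in> pmod l s"
  using pmod_mult[of f l 0 g s] by (simp add: pmod_def)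

lemma pmod_smult: "g \<in> pmod l s \<Longrightarrow> smult c g \<in> pmod l s"
  by (simp add: pmod_def)

lemma pmod_smult_dvd: "int l dvd c \<Longrightarrow> smult c g \<in> pmod l s"
  by (simp add: pmod_def)

lemma pmod_pderiv: "f \<in> pmod l (Suc s) \<Longrightarrow> pderiv f \<in> pmod l s"
  by (simp add: pmod_def coeff_pderiv)

text \<open>Modulo \<open>l\<close> the derivative of \<open>t ^ l\<close> vanishes, so no precision is lost here.\<close>
lemma pmod_pderiv_self: "f \<in> pmod l l \<Longrightarrow> pderiv f \<in> pmod l l"
  unfolding pmod_def mem_Collect_eq coeff_pderiv
proof (intro allI impI)
  fix j assume "\<forall>j<l. int l dvd coeff f j" "j < l"
  thus "int l dvd of_nat (Suc j) * coeff f (Suc j)"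
    by (cases "Suc j = l") auto
qed

lemma serre_seq_diff:
  "serre_seq k w (f - g) n = serre_seq k w f n - serre_seq k w g n"
proof (induction n rule: less_induct)
  case (less n)
  show ?case
  proof (cases n)
    case (Suc m)
    have *: "serre_seq k w (f - g) m = serre_seq k w f m - serre_seq k w g m"
      "serre_seq k w (f - g) (m - 1) = serre_seq k w f (m - 1) - serre_seq k w g (m - 1)"
      using less Suc by auto
    show ?thesis unfolding Suc serre_seq.simps(2) *
      by (simp add: pderiv_diff algebra_simps smult_diff_right del: mult_pCons_left mult_pCons_right)
  qed simp
qed

text \<open>Every operation of the recursion, differentiation included, preserves the ideal
  generated by \<open>l\<close> and \<open>t ^ l\<close>. This makes \<open>t ^ l\<close> the
  natural precision: once an iterate is 0 there, a restart keeps it 0.\<close>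

lemma serre_seq_pmod:
  assumes "f \<in> pmod l l" shows "serre_seq k w f n \<in> pmod l l"
proof (induction n rule: less_induct)
  case (less n)
  show ?case
  proof (cases n)
    case (Suc m)
    have *: "serre_seq k w f m \<in> pmod l l" "serre_seq k w f (m - 1) \<in> pmod l l"
      using less Suc by auto
    show ?thesis unfolding Suc serre_seq.simps(2)
      by (intro pmod_diff pmod_mult_left pmod_smult pmod_pderiv_self *)
  qed (use assms in simp)
qed

text \<open>Modulo \<open>l\<close> the recursion is periodic in \<open>n\<close> and restarts at every multiple of \<open>l\<close>.\<close>
lemma serre_seq_restart:
  "serre_seq k w f (m * l + n) - serre_seq k w (serre_seq k w f (m * l)) n \<in> pmod l s"
proof -
  have "\<forall>s. serre_seq k w f (m * l + n) - serre_seq k w (serre_seq k w f (m * l)) n \<in> pmod l s"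
  proof (induction n rule: less_induct)
    case (less n)
    show ?case
    proof (cases n)
      case (Suc i)
      let ?p = "\<lambda>j. serre_seq k w f (m * l + j)" and ?q = "serre_seq k w (serre_seq k w f (m * l))"
      let ?e = "\<lambda>n. n * (n + k - 1)"
      show ?thesis
      proof
        fix s
        have 1: "?p i - ?q i \<in> pmod l r" for r using less Suc by simp
        \<comment> \<open>The factor \<open>?e\<close> depends on its argument only modulo
          \<open>l\<close>. At \<open>i = 0\<close> it is divisible by \<open>l\<close> on the left
          and 0 on the right, so the iterate before the restart is forgotten.\<close>
        have 2: "smult (?e (int (m * l + i))) (serre_seq k w f (m * l + i - 1)) - smult (?e (int i)) (?q (i - 1)) \<in> pmod l s"
        proof (cases i)
          case 0
          show ?thesis unfolding 0 by (auto intro!: pmod_diff pmod_smult_dvd)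
        next
          case (Suc i')
          have "?p i' - ?q i' \<in> pmod l s" using less Suc \<open>n = Suc i\<close> by simp
          moreover have "smult (?e (int (m * l + i))) (?p i') - smult (?e (int i)) (?q i')
             = smult (?e (int (m * l + i)) - ?e (int i)) (?p i') + smult (?e (int i)) (?p i' - ?q i')"
            by (simp add: smult_diff_left smult_diff_right)
          moreover have "int l dvd ?e (int (m * l + i)) - ?e (int i)"
          proof -
            have "?e (int (m * l + i)) - ?e (int i) = int l * (int m * (int (m * l + i) + int i + k - 1))"
              by (simp add: algebra_simps)
            thus ?thesis by simp
          qed
          ultimately have "smult (?e (int (m * l + i))) (?p i') - smult (?e (int i)) (?q i') \<in> pmod l s"
            by (metis pmod_add pmod_smult_dvd pmod_smult)
          thus ?thesis using Suc by simp
        qed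
        have "?p n - ?q n = [:-6, 0, 6:] * pderiv (?p i - ?q i) - [:0, 2 * (int i + w):] * (?p i - ?q i)
           - smult (int l) (smult (2 * int m) ([:0, 1:] * ?p i))
           - (smult (?e (int (m * l + i))) (serre_seq k w f (m * l + i - 1)) - smult (?e (int i)) (?q (i - 1)))"
        proof -
          have e: "[:0, 2 * (int (m * l + i) + w):] * g = [:0, 2 * (int i + w):] * g + smult (int l) (smult (2 * int m) ([:0, 1:] * g))" for g
            by (simp add: algebra_simps smult_add_left[symmetric])
          show ?thesis
            unfolding Suc add_Suc_right serre_seq.simps(2) e pderiv_diff right_diff_distrib by simp
        qed
        moreover have "pderiv (?p i - ?q i) \<in> pmod l s" using 1 by (rule pmod_pderiv)
        ultimately show "?p n - ?q n \<in> pmod l s"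
          using pmod_diff[OF pmod_diff[OF pmod_diff[OF pmod_mult_left[of "pderiv (?p i - ?q i)" l s "[:-6, 0, 6:]"]
            pmod_mult_left[where f = "[:0, 2 * (int i + w):]", OF 1]] pmod_smult_dvd[OF dvd_refl]] 2] by metis
      qed
    qed simp
  qed
  thus ?thesis by blast
qed

text \<open>Only the two extreme terms of the Leibniz rule survive, because
  \<open>l choose j\<close> is divisible by \<open>l\<close> for \<open>0 < j < l\<close>.\<close>

lemma serre_seq_prime_mult:
  assumes "prime l"
  shows "serre_seq (k + k') (w + w') (f * g) l
     - (f * serre_seq k' w' g l + g * serre_seq k w f l) \<in> pmod l s"
proof -
  obtain m where l: "l = Suc m" "m > 0" using prime_gt_1_nat[OF assms] by (cases l) auto
  let ?t = "\<lambda>j. of_nat (l choose j) * (serre_seq k w f j * serre_seq k' w' g (l - j)) :: int poly"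
  have "serre_seq (k + k') (w + w') (f * g) l = (\<Sum>j\<le>l. ?t j)" by (rule serre_seq_mult)
  also have "{..l} = insert 0 (insert l {0<..<l})" using l by auto
  also have "(\<Sum>j\<in>\<dots>. ?t j) = f * serre_seq k' w' g l + g * serre_seq k w f l + (\<Sum>j\<in>{0<..<l}. ?t j)"
    using l by (simp add: mult.commute add_ac)
  finally have "serre_seq (k + k') (w + w') (f * g) l - (f * serre_seq k' w' g l + g * serre_seq k w f l) = (\<Sum>j\<in>{0<..<l}. ?t j)"
    by simp
  also have "\<dots> \<in> pmod l s"
  proof -
    have "?t j \<in> pmod l s" if "j \<in> {0<..<l}" for j
    proof -
      have "l dvd l choose j" using that by (intro dvd_choose_prime assms) auto
      thus ?thesis by (simp add: of_nat_poly pmod_smult_dvd)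
    qed
    thus ?thesis by (rule pmod_sum)
  qed
  finally show ?thesis .
qed

text \<open>In weight 0 the \<open>l\<close>-th iterate obeys the product rule modulo
  \<open>l\<close> and kills constants, so it is determined by its value on the variable.\<close>

lemma serre_seq_prime_derivation:
  assumes "prime l"
  shows "serre_seq 0 0 f l - pderiv f * serre_seq 0 0 [:0, 1:] l \<in> pmod l s"
proof (induction f rule: pCons_induct)
  case 0
  then show ?case using serre_seq_diff[of 0 0 0 0 l] by simp
next
  case (pCons a f)
  let ?D = "\<lambda>f. serre_seq 0 0 f l"
  \<comment> \<open>With \<open>k = 0\<close> the back reference at \<open>n = 1\<close> has the
    factor \<open>1 * (1 + 0 - 1) = 0\<close>, so the constant is not picked up again at the second
    step.\<close>
  have c: "?D [:c:] = 0" for c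
  proof -
    have "serre_seq 0 0 [:c:] (Suc n) = 0" for n
    proof (induction n rule: less_induct)
      case (less n)
      have a: "serre_seq 0 0 [:c:] n = 0" if "n > 0"
        using less[of "n - 1"] that by simp
      have b: "serre_seq 0 0 [:c:] (n - 1) = 0" if "n > 1"
        using less[of "n - 2"] that by (simp add: numeral_2_eq_2 Suc_diff_Suc)
      show ?case
      proof (cases "n = 0")
        case True
        show ?thesis unfolding True serre_seq.simps by (simp add: pderiv_pCons)
      next
        case False
        thus ?thesis using a b unfolding serre_seq.simps(2) by (cases "n = 1") simp_all
      qed
    qed
    from this[of "l - 1"] show ?thesis using prime_gt_0_nat[OF assms] by simp
  qed
  have e: "pCons a f = [:0,1:] * f - [:-a:]" by simp
  have "?D (pCons a f) = ?D ([:0, 1:] * f)"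
    unfolding e serre_seq_diff c by simp
  hence "?D (pCons a f) - pderiv (pCons a f) * ?D [:0, 1:] =
     (?D ([:0,1:] * f) - ([:0,1:] * ?D f + f * ?D [:0,1:])) + [:0,1:] * (?D f - pderiv f * ?D [:0, 1:])"
  proof -
    have "pderiv (pCons a f) = f + [:0, 1:] * pderiv f" by (simp add: pderiv_pCons)
    thus ?thesis using \<open>?D (pCons a f) = ?D ([:0, 1:] * f)\<close>
      by (simp add: algebra_simps del: mult_pCons_left mult_pCons_right)
  qed
  also have "\<dots> \<in> pmod l s"
    using serre_seq_prime_mult[OF assms, of 0 0 0 0 "[:0,1:]" f s] pCons.IH
    by (intro pmod_add pmod_mult_left) auto
  finally show ?case .
qed

text \<open>Apply the product rule to \<open>1 * f\<close> with the whole weight placed on the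
  factor \<open>1\<close> and \<open>f\<close> taken in weight 0. Hence the coefficient of
  \<open>pderiv f\<close> is the same for all weights.\<close>

lemma serre_seq_prime:
  assumes "prime l"
  shows "serre_seq k w f l - (serre_seq 0 0 [:0, 1:] l * pderiv f + serre_seq k w 1 l * f) \<in> pmod l s"
proof -
  let ?X = "serre_seq 0 0 [:0, 1:] l"
  have "serre_seq (k + 0) (w + 0) (1 * f) l - (?X * pderiv f + serre_seq k w 1 l * f) =
    (serre_seq (k + 0) (w + 0) (1 * f) l - (1 * serre_seq 0 0 f l + f * serre_seq k w 1 l))
    + (serre_seq 0 0 f l - pderiv f * ?X)"
    by (simp add: algebra_simps)
  also have "\<dots> \<in> pmod l s"
    using assms by (intro pmod_add serre_seq_prime_mult serre_seq_prime_derivation)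
  finally show ?thesis by simp
qed

lemma serre_seq_step:
  assumes "prime l"
  shows "serre_seq k w f (Suc m * l) - (serre_seq 0 0 [:0, 1:] l * pderiv (serre_seq k w f (m * l))
           + serre_seq k w 1 l * serre_seq k w f (m * l)) \<in> pmod l s"
  using pmod_add[OF serre_seq_restart[of k w f m l l s] serre_seq_prime[OF assms, of k w "serre_seq k w f (m * l)" s]]
  by (simp add: algebra_simps)

lemma coeff_serre_seq_Suc:
  "coeff (serre_seq k w f (Suc n)) j =
     (if j = 0 then 0 else (6 * (int j - 1) - 2 * (int n + w)) * coeff (serre_seq k w f n) (j - 1))
     - 6 * (int j + 1) * coeff (serre_seq k w f n) (Suc j)
     - int n * (int n + k - 1) * coeff (serre_seq k w f (n - 1)) j"
proof -
  consider "j = 0" | "j = 1" | i where "j = Suc (Suc i)" by (metis One_nat_def not0_implies_Suc)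
  thus ?thesis
    by cases (auto simp: serre_seq.simps(2) coeff_pderiv algebra_simps)
qed

text \<open>Each step flips the parity of the degrees that occur. The number \<open>e\<close>
  encodes the starting parity: even for an even polynomial, odd for an odd one.\<close>

lemma serre_seq_parity:
  assumes "\<And>j. odd (e + j) \<Longrightarrow> coeff f j = 0" "odd (e + n + j)"
  shows "coeff (serre_seq k w f n) j = 0"
  using assms(2)
proof (induction n arbitrary: j rule: less_induct)
  case (less n)
  show ?case
  proof (cases n)
    case 0
    then show ?thesis using less assms(1) by simp
  next
    case (Suc m)
    have "coeff (serre_seq k w f m) (Suc j) = 0" using less Suc by simp
    moreover have "j > 0 \<Longrightarrow> coeff (serre_seq k w f m) (j - 1) = 0" using less.IH[of m "j - 1"] less.prems Suc by simp
    moreover have "m > 0 \<Longrightarrow> coeff (serre_seq k w f (m - 1)) j = 0" using less.IH[of "m - 1" j] less.prems Suc by simp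
    ultimately show ?thesis unfolding Suc coeff_serre_seq_Suc by (cases "m = 0") auto
  qed
qed

section \<open>Vanishing and non-vanishing of the constant terms modulo a prime\<close>

definition dseq :: "nat \<Rightarrow> int" where "dseq n = coeff (serre_seq 12 0 1 n) 0"

text \<open>Parity supplies the missing orders: for odd \<open>l\<close>, \<open>?X\<close> is even,
  so a constant term divisible by \<open>l\<close> makes it divisible by \<open>t ^ 2\<close> modulo
  \<open>l\<close>, and \<open>?Y\<close> is odd, hence divisible by \<open>t\<close>. The factor
  \<open>t ^ 2\<close> pays for the order lost by differentiation and still gains one.\<close>

lemma serre_seq_12_mult_prime_pmod:
  assumes "prime l" "odd l" "int l dvd coeff (serre_seq 0 0 [:0, 1:] l) 0"
  shows "s \<le> l \<Longrightarrow> serre_seq 12 0 1 (s * l) \<in> pmod l s"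
proof (induction s)
  case 0
  then show ?case by (simp add: pmod_def)
next
  case (Suc s)
  let ?X = "serre_seq 0 0 [:0, 1:] l" and ?Y = "serre_seq 12 0 1 l" and ?p = "serre_seq 12 0 1 (s * l)"
  have Y: "?Y \<in> pmod l 1"
  proof -
    have "coeff ?Y 0 = 0" using assms(2) by (intro serre_seq_parity[of 0]) (auto simp: coeff_1 intro!: Nat.gr0I)
    thus ?thesis by (simp add: pmod_def)
  qed
  have X: "?X \<in> pmod l 2"
  proof -
    have "coeff ?X 1 = 0" using assms(2) by (intro serre_seq_parity[of 1]) (auto simp: coeff_pCons split: nat.splits)
    thus ?thesis using assms(3) by (auto simp: pmod_def less_2_cases_iff)
  qed
  have p: "?p \<in> pmod l s" using Suc by simp
  have "pderiv ?p \<in> pmod l (s - 1)"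
  proof (cases s)
    case 0
    thus ?thesis by (simp add: pmod_def)
  next
    case (Suc r)
    thus ?thesis using p by (simp add: pmod_pderiv)
  qed
  hence "?X * pderiv ?p \<in> pmod l (Suc s)"
    by (intro pmod_mono[OF pmod_mult[OF X]]) auto
  moreover have "?Y * ?p \<in> pmod l (Suc s)"
    using pmod_mult[OF Y p] by simp
  ultimately have "?X * pderiv ?p + ?Y * ?p \<in> pmod l (Suc s)" by (rule pmod_add)
  from pmod_add[OF serre_seq_step[OF assms(1), of 12 0 1 s "Suc s"] this] show ?case by simp
qed

lemma eventually_dvd_dseq:
  assumes "prime l" "odd l" "int l dvd coeff (serre_seq 0 0 [:0, 1:] l) 0"
  shows "\<forall>\<^sub>F n in sequentially. int l dvd dseq n"
  unfolding eventually_sequentially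
proof (intro exI[of _ "l * l"] allI impI)
  fix n assume "l * l \<le> n"
  then obtain i where n: "n = l * l + i" using le_Suc_ex by blast
  have "serre_seq 12 0 1 (l * l + i) \<in> pmod l l"
    using pmod_add[OF serre_seq_restart[of 12 0 1 l l i l] serre_seq_pmod[OF serre_seq_12_mult_prime_pmod[OF assms order_refl], of 12 0 i]] by simp
  thus "int l dvd dseq n" using prime_gt_0_nat[OF assms(1)] by (simp add: dseq_def pmod_def n)
qed

text \<open>Read at degree \<open>j\<close>, the recursion expresses \<open>6 * (j + 1)\<close>
  times the coefficient of degree \<open>j + 1\<close> through coefficients of degree at most
  \<open>j\<close> of neighbouring iterates. For \<open>l > 3\<close> and \<open>j + 1 < l\<close>
  this factor is a unit modulo \<open>l\<close>, so vanishing climbs through the degrees while the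
  threshold \<open>N\<close> moves by one each time.\<close>

lemma eventually_dvd_dseq_imp_pmod:
  assumes "prime l" "l > 3" "\<forall>\<^sub>F n in sequentially. int l dvd dseq n"
  shows "\<exists>N. \<forall>n\<ge>N. serre_seq 12 0 1 n \<in> pmod l l"
proof -
  obtain N where N: "\<And>n. n \<ge> N \<Longrightarrow> int l dvd dseq n"
    using assms(3) unfolding eventually_sequentially by blast
  have cop: "coprime (int l) 6"
  proof -
    have "coprime l (2 * 3)" using assms(1,2) by (intro coprime_mult_right_iff[THEN iffD2] conjI primes_coprime) (auto)
    thus ?thesis by (metis coprime_int_iff of_nat_numeral mult_2_right numeral_Bit0 numeral_Bit1 numeral_times_numeral num_double mult.commute semiring_norm(12) semiring_norm(13))
  qed
  have "j < l \<Longrightarrow> \<forall>i\<le>j. \<forall>n. N + j \<le> n \<longrightarrow> int l dvd coeff (serre_seq 12 0 1 n) i" for j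
  proof (induction j)
    case 0
    thus ?case using N by (auto simp: dseq_def)
  next
    case (Suc j)
    show ?case
    proof (intro allI impI)
      fix i n assume i: "i \<le> Suc j" and n: "N + Suc j \<le> n"
      show "int l dvd coeff (serre_seq 12 0 1 n) i"
      proof (cases "i = Suc j")
        case False
        thus ?thesis using Suc i n by simp
      next
        case True
        let ?p = "\<lambda>n. coeff (serre_seq 12 0 1 n)"
        have "6 * (int j + 1) * ?p n (Suc j) = (if j = 0 then 0 else (6 * (int j - 1) - 2 * int n) * ?p n (j - 1))
             - int n * (int n + 12 - 1) * ?p (n - 1) j - ?p (Suc n) j"
          by (simp add: coeff_serre_seq_Suc)
        also have "int l dvd \<dots>"
          using Suc n by (intro dvd_diff dvd_mult) auto
        finally have "int l dvd 6 * (int j + 1) * ?p n (Suc j)" .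
        moreover have "coprime (int l) (int (Suc j))"
          using Suc.prems prime_imp_coprime[OF assms(1), of "Suc j"] dvd_imp_le[of l "Suc j"] by (metis coprime_int_iff not_le zero_less_Suc)
        ultimately show ?thesis unfolding True using cop
          by (metis coprime_dvd_mult_right_iff of_nat_Suc add.commute mult.assoc)
      qed
    qed
  qed
  from this[of "l - 1"] show ?thesis using prime_gt_0_nat[OF assms(1)]
    by (intro exI[of _ "N + (l - 1)"]) (auto simp: pmod_def)
qed

text \<open>The derivative of \<open>g ^ l\<close> is divisible by \<open>l\<close>, which forces
  the coefficients of degrees 1 to \<open>l - 1\<close> to be divisible by \<open>l\<close>.\<close>

lemma pmod_power_prime:
  assumes "prime l"
  shows "g ^ l - [:coeff g 0 ^ l:] \<in> pmod l l"
  unfolding pmod_def mem_Collect_eq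
proof (intro allI impI)
  fix j assume j: "j < l"
  show "int l dvd coeff (g ^ l - [:coeff g 0 ^ l:]) j"
  proof (cases j)
    case 0
    thus ?thesis by (simp add: coeff_0_power)
  next
    case (Suc i)
    have "pderiv (g ^ l) = smult (int l) (g ^ (l - 1) * pderiv g)"
      by (subst pderiv_power) simp
    hence "int l dvd coeff (pderiv (g ^ l)) i" by simp
    hence "int l dvd int j * coeff (g ^ l) j" by (simp add: coeff_pderiv Suc)
    moreover have "coprime (int l) (int j)"
      using j Suc prime_imp_coprime[OF assms, of j] dvd_imp_le[of l j] by (metis coprime_int_iff not_le zero_less_Suc)
    ultimately show ?thesis using Suc by (simp add: coprime_dvd_mult_right_iff)
  qed
qed

lemma pmod_cancel_unit:
  assumes l: "prime l" and X: "\<not> int l dvd coeff X 0" and s: "X * W \<in> pmod l s"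
  shows "W \<in> pmod l s"
  unfolding pmod_def mem_Collect_eq
proof (intro allI)
  fix j show "j < s \<longrightarrow> int l dvd coeff W j"
  proof (induction j rule: less_induct)
    case (less j)
    show ?case
    proof
      assume j: "j < s"
      have "coeff (X * W) j = coeff X 0 * coeff W j + (\<Sum>i<j. coeff X (Suc i) * coeff W (j - Suc i))"
        unfolding coeff_mult by (subst sum.atMost_shift) simp
      moreover have "int l dvd (\<Sum>i<j. coeff X (Suc i) * coeff W (j - Suc i))"
        using less j by (intro dvd_sum dvd_mult) auto
      moreover have "int l dvd coeff (X * W) j" using s j by (simp add: pmod_def)
      ultimately have "int l dvd coeff X 0 * coeff W j" by (metis dvd_add_left_iff)
      thus "int l dvd coeff W j" using X l by (auto simp: prime_dvd_mult_iff)
    qed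
  qed
qed

text \<open>\<open>Z\<close> is the inverse of X cut off below degree \<open>l - 1\<close>: from
  \<open>X * Z = 1 + \<rho> * t ^ (l - 1)\<close> modulo \<open>l\<close> the inverse itself has
  coefficient \<open>- \<rho> / X(0)\<close> at \<open>t ^ (l - 1)\<close>. The hypothesis on the
  coefficient of \<open>t\<close> prevents the operator from killing 1 at the first application, so
  that two nonzero members of the chain precede its end.\<close>

lemma not_eventually_dvd_dseq:
  assumes l: "prime l" "l > 3"
    and X: "\<not> int l dvd coeff (serre_seq 0 0 [:0, 1:] l) 0"
    and Y: "\<not> int l dvd coeff (serre_seq 12 0 1 l) 1"
    and Z: "serre_seq 0 0 [:0, 1:] l * Z - 1 - monom \<rho> (l - 1) \<in> pmod l l" "coeff Z (l - 1) = 0" "\<not> int l dvd \<rho>"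
  shows "\<not> (\<forall>\<^sub>F n in sequentially. int l dvd dseq n)"
proof
  assume "\<forall>\<^sub>F n in sequentially. int l dvd dseq n"
  then obtain N where N: "\<And>n. n \<ge> N \<Longrightarrow> serre_seq 12 0 1 n \<in> pmod l l"
    using eventually_dvd_dseq_imp_pmod[OF l] by blast
  let ?X = "serre_seq 0 0 [:0, 1:] l" and ?Y = "serre_seq 12 0 1 l" and ?p = "\<lambda>m. serre_seq 12 0 1 (m * l)"
  have step: "?p (Suc m) - (?X * pderiv (?p m) + ?Y * ?p m) \<in> pmod l l" for m
    by (rule serre_seq_step[OF l(1)])
  have pl: "int l dvd x ^ l \<longleftrightarrow> int l dvd x" for x :: int
    using l by (simp add: prime_dvd_power_iff)
  define m where "m = (LEAST m. ?p m \<in> pmod l l)"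
  have "N \<le> N * l" using prime_gt_0_nat[OF l(1)] by simp
  hence "?p N \<in> pmod l l" by (rule N)
  hence m: "?p m \<in> pmod l l" unfolding m_def by (rule LeastI)
  have least: "?p i \<notin> pmod l l" if "i < m" for i
    using that unfolding m_def by (rule not_less_Least)
  have "?p 0 \<notin> pmod l l" using l by (auto simp: pmod_def intro!: exI[of _ 0])
  hence "m \<noteq> 0" using m by metis
  moreover have "m \<noteq> 1" using m Y l by (auto simp: pmod_def)
  ultimately obtain r where r: "m = Suc (Suc r)" by (metis One_nat_def not0_implies_Suc)
  define g where "g = ?p (Suc r)"
  define h where "h = ?p r"
  have g: "?X * pderiv g + ?Y * g \<in> pmod l l"
    using pmod_diff[OF m step[of "Suc r", folded r]] by (simp add: g_def)
  have h: "g - (?X * pderiv h + ?Y * h) \<in> pmod l l"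
    using step[of r] by (simp add: g_def h_def)
  \<comment> \<open>As \<open>?X\<close> is a unit, \<open>?X * pderiv g = - ?Y * g\<close> would
    lift divisibility from the constant term to all degrees below \<open>l\<close>, against the
    minimality of \<open>m\<close>.\<close>
  have g0: "\<not> int l dvd coeff g 0"
  proof
    assume *: "int l dvd coeff g 0"
    have "g \<in> pmod l s" if "s \<le> l" for s
      using that
    proof (induction s)
      case 0
      thus ?case by (simp add: pmod_def)
    next
      case (Suc s)
      show ?case
      proof (cases s)
        case 0
        thus ?thesis using * by (simp add: pmod_def)
      next
        case (Suc i)
        have gs: "g \<in> pmod l s" using Suc.IH Suc.prems by simp
        have "?X * pderiv g \<in> pmod l s"
          using pmod_diff[OF pmod_mono[OF g, of s] pmod_mult_left[OF gs, of ?Y]] Suc.prems by simp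
        hence "pderiv g \<in> pmod l s" by (rule pmod_cancel_unit[OF l(1) X])
        hence "int l dvd int s * coeff g s" using Suc by (auto simp: pmod_def coeff_pderiv)
        moreover have "coprime (int l) (int s)"
          using Suc.prems Suc prime_imp_coprime[OF l(1), of s] dvd_imp_le[of l s]
          by (metis coprime_int_iff not_less_eq_eq zero_less_Suc)
        ultimately have "int l dvd coeff g s" by (simp add: coprime_dvd_mult_right_iff)
        thus ?thesis using gs by (auto simp: pmod_def less_Suc_eq)
      qed
    qed
    hence "g \<in> pmod l l" by simp
    thus False using least[of "Suc r"] r by (simp add: g_def)
  qed
  define u where "u = h * g ^ (l - 1)"
  define c where "c = coeff g 0 ^ l"
  text \<open>Modulo \<open>l\<close>, this \<open>u\<close> is a constant multiple of \<open>h / g\<close>.\<close>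
  have "?X * pderiv u - [:c:] \<in> pmod l l"
  proof -
    have l2: "l - 1 = Suc (l - 2)" using l by simp
    have pd: "pderiv u = pderiv h * g ^ (l - 1) + smult (int (l - 1)) (h * g ^ (l - 2) * pderiv g)"
      unfolding u_def pderiv_mult by (subst pderiv_power) (simp add: l2 mult_ac numeral_2_eq_2)
    have gl: "g ^ l = g ^ (l - 1) * g" "g ^ (l - 1) = g ^ (l - 2) * g"
      using l l2 by (metis power_Suc mult.commute One_nat_def Suc_pred prime_gt_0_nat) (metis l2 power_Suc mult.commute)
    \<comment> \<open>The multiplier \<open>l - 1\<close> acts as -1, so \<open>pderiv u\<close> is
      \<open>g ^ (l - 2)\<close> times the Wronskian of \<open>h\<close> and \<open>g\<close>. The
      two equations eliminate \<open>?Y\<close> and leave \<open>g ^ l\<close>, which is a constant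
      modulo \<open>l\<close> and \<open>t ^ l\<close>.\<close>
    have "?X * pderiv u - [:c:] = (g ^ l - [:c:]) - g ^ (l - 1) * (g - (?X * pderiv h + ?Y * h))
       - h * g ^ (l - 2) * (?X * pderiv g + ?Y * g) + smult (int l) (?X * (h * g ^ (l - 2) * pderiv g))"
      using l unfolding pd gl by (simp add: algebra_simps smult_diff_left of_nat_diff)
    also have "\<dots> \<in> pmod l l"
      unfolding c_def
      by (intro pmod_add[OF pmod_diff[OF pmod_diff]] pmod_power_prime l(1) pmod_mult_left[OF h] pmod_mult_left[OF g] pmod_smult_dvd dvd_refl)
    finally show ?thesis .
  qed
  moreover have "?X * (smult c Z) - [:c:] - monom (c * \<rho>) (l - 1) \<in> pmod l l"
    using pmod_smult[OF Z(1), of c] by (simp add: smult_diff_right smult_monom)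
  ultimately have *: "?X * (pderiv u - smult c Z) + monom (c * \<rho>) (l - 1) \<in> pmod l l"
    using pmod_diff by (fastforce simp: algebra_simps)
  have "monom (c * \<rho>) (l - 1) \<in> pmod l (l - 1)" by (simp add: pmod_def)
  hence "?X * (pderiv u - smult c Z) \<in> pmod l (l - 1)"
    using pmod_diff[OF pmod_mono[OF *, of "l - 1"]] by fastforce
  hence W: "pderiv u - smult c Z \<in> pmod l (l - 1)" by (rule pmod_cancel_unit[OF l(1) X])
  \<comment> \<open>In a derivative the coefficient of \<open>t ^ (l - 1)\<close> carries the factor
    \<open>l\<close>. This is the only place where the missing coefficient of \<open>Z\<close>
    enters.\<close>
  have "int l dvd coeff (pderiv u - smult c Z) (l - 1)"
    using Z(2) l by (simp add: coeff_pderiv)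
  hence "pderiv u - smult c Z \<in> pmod l l"
    using W l by (auto simp: pmod_def) (metis One_nat_def Suc_pred less_antisym prime_gt_0_nat)
  hence "?X * (pderiv u - smult c Z) \<in> pmod l l" by (rule pmod_mult_left)
  from pmod_diff[OF * this] have "monom (c * \<rho>) (l - 1) \<in> pmod l l" by simp
  moreover have "l - 1 < l" using l by simp
  ultimately have "int l dvd coeff (monom (c * \<rho>) (l - 1)) (l - 1)" unfolding pmod_def by blast
  hence "int l dvd c * \<rho>" by simp
  thus False using Z(3) g0 l(1) by (auto simp: prime_dvd_mult_iff pl c_def)
qed

subsection \<open>Evaluating the recursion modulo small primes\<close>

definition hd0 :: "int list \<Rightarrow> int" where
  "hd0 xs = (case xs of [] \<Rightarrow> 0 | x # _ \<Rightarrow> x)"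

definition nth0 :: "int list \<Rightarrow> nat \<Rightarrow> int" where
  "nth0 xs i = (if i < length xs then xs ! i else 0)"

lemma nth0_simps [simp]:
  "nth0 [] i = 0" "nth0 (x # xs) 0 = x" "nth0 (x # xs) (Suc i) = nth0 xs i"
  by (auto simp: nth0_def)

lemma nth0_0: "nth0 xs 0 = hd0 xs"
  by (cases xs) (auto simp: hd0_def)

lemma nth0_tl [simp]: "nth0 (tl xs) i = nth0 xs (Suc i)"
  by (cases xs) auto

text \<open>One step of the recursion on half lists. For a target degree d, \<open>a\<close> is the
  coefficient of degree d - 1 of the current row, the head of \<open>p\<close> that of degree d + 1,
  and \<open>r\<close> belongs to the row before. Both multipliers grow by 12 per entry because d
  advances by 2 and the recursion contains \<open>6 * j\<close>.\<close>

fun serre_row :: "int \<Rightarrow> int \<Rightarrow> int \<Rightarrow> int \<Rightarrow> int \<Rightarrow> int list \<Rightarrow> int list \<Rightarrow> int list" where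
  "serre_row l A B c a [] [] = (let x = A * a mod l in if x = 0 then [] else [x])"
| "serre_row l A B c a [] (z # r) = (A * a - c * z) mod l # serre_row l (A + 12) (B + 12) c 0 [] r"
| "serre_row l A B c a (b # p) [] = (A * a - B * b) mod l # serre_row l (A + 12) (B + 12) c b p []"
| "serre_row l A B c a (b # p) (z # r) = (A * a - B * b - c * z) mod l # serre_row l (A + 12) (B + 12) c b p r"

text \<open>\<open>p\<close> is the current row, of index \<open>n\<close> and parity
  \<open>e\<close>, and \<open>r\<close> the row before. From an odd row the first target degree is
  0, which has no lower neighbour, hence the \<open>0\<close>; from an even row it is 1, whose lower
  neighbour is the head of \<open>p\<close>.\<close>

fun serre_run :: "int \<Rightarrow> int \<Rightarrow> int \<Rightarrow> bool \<Rightarrow> nat \<Rightarrow> int \<Rightarrow> int list \<Rightarrow> int list \<Rightarrow> int list" where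
  "serre_run l k w e 0 n r p = p"
| "serre_run l k w e (Suc i) n r p = serre_run l k w (\<not> e) i (n + 1) p
     (if e then serre_row l (- 2 * (n + w) - 6) 6 (n * (n + k - 1) mod l) 0 p r
      else serre_row l (- 2 * (n + w)) 12 (n * (n + k - 1) mod l) (hd0 p) (tl p) r)"

lemma nth0_serre_row:
  "[nth0 (serre_row l A B c a p r) i =
    (A + 12 * int i) * (if i = 0 then a else nth0 p (i - 1)) - (B + 12 * int i) * nth0 p i - c * nth0 r i] (mod l)"
proof (induction l A B c a p r arbitrary: i rule: serre_row.induct)
  case (1 l A B c a)
  then show ?case by (cases i) (auto simp: Let_def cong_def)
next
  case (2 l A B c a z r)
  show ?case
  proof (cases i)
    case (Suc j)
    then show ?thesis using 2[of j] by (cases j) (auto simp: algebra_simps)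
  qed (auto simp: cong_def)
next
  case (3 l A B c a b p)
  show ?case
  proof (cases i)
    case (Suc j)
    then show ?thesis using 3[of j] by (cases j) (auto simp: algebra_simps)
  qed (auto simp: cong_def)
next
  case (4 l A B c a b p z r)
  show ?case
  proof (cases i)
    case (Suc j)
    then show ?thesis using 4[of j] by (cases j) (auto simp: algebra_simps)
  qed (auto simp: cong_def)
qed

text \<open>Iterates have a fixed parity (odd iff \<open>e\<close>), so only every other coefficient is stored.\<close>
definition list_rep :: "int \<Rightarrow> bool \<Rightarrow> int list \<Rightarrow> int poly \<Rightarrow> bool" where
  "list_rep l e xs f \<longleftrightarrow> (\<forall>i. [nth0 xs i = coeff f (2 * i + of_bool e)] (mod l))"

lemma list_rep_serre_row:
  assumes p: "list_rep l e p (serre_seq k w f n)"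
    and r: "n = 0 \<or> list_rep l (\<not> e) r (serre_seq k w f (n - 1))"
  shows "list_rep l (\<not> e) (if e then serre_row l (- 2 * (int n + w) - 6) 6 (int n * (int n + k - 1) mod l) 0 p r
      else serre_row l (- 2 * (int n + w)) 12 (int n * (int n + k - 1) mod l) (hd0 p) (tl p) r) (serre_seq k w f (Suc n))"
proof -
  let ?c = "int n * (int n + k - 1)" and ?S = "serre_seq k w f"
  have r': "[?c mod l * nth0 r i = ?c * coeff (?S (n - 1)) (2 * i + of_bool (\<not> e))] (mod l)" for i
  proof (cases "n = 0")
    case False
    hence "[nth0 r i = coeff (?S (n - 1)) (2 * i + of_bool (\<not> e))] (mod l)"
      using r by (simp add: list_rep_def)
    thus ?thesis by (intro cong_mult) (auto simp: cong_def)
  qed simp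
  show ?thesis
  proof (cases e)
    case True
    have p': "[nth0 p i = coeff (?S n) (2 * i + 1)] (mod l)" for i
      using p True by (simp add: list_rep_def)
    show ?thesis
      unfolding list_rep_def
    proof
      fix i
      let ?A = "- 2 * (int n + w) - 6"
      have "[nth0 (serre_row l ?A 6 (?c mod l) 0 p r) i =
         (?A + 12 * int i) * (if i = 0 then 0 else nth0 p (i - 1)) - (6 + 12 * int i) * nth0 p i - ?c mod l * nth0 r i] (mod l)"
        by (rule nth0_serre_row)
      also have "[(?A + 12 * int i) * (if i = 0 then 0 else nth0 p (i - 1)) - (6 + 12 * int i) * nth0 p i - ?c mod l * nth0 r i
         = (?A + 12 * int i) * (if i = 0 then 0 else coeff (?S n) (2 * (i - 1) + 1)) - (6 + 12 * int i) * coeff (?S n) (2 * i + 1)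
          - ?c * coeff (?S (n - 1)) (2 * i)] (mod l)"
        using r'[of i] True p'[of i] p'[of "i - 1"]
        by (intro cong_diff[OF cong_diff]) (auto intro!: cong_mult[OF cong_refl])
      also have "(?A + 12 * int i) * (if i = 0 then 0 else coeff (?S n) (2 * (i - 1) + 1)) - (6 + 12 * int i) * coeff (?S n) (2 * i + 1)
          - ?c * coeff (?S (n - 1)) (2 * i) = coeff (?S (Suc n)) (2 * i)"
        unfolding coeff_serre_seq_Suc by (cases i) (auto simp: algebra_simps)
      finally show "[nth0 (if e then serre_row l ?A 6 (?c mod l) 0 p r
         else serre_row l (- 2 * (int n + w)) 12 (?c mod l) (hd0 p) (tl p) r) i = coeff (?S (Suc n)) (2 * i + of_bool (\<not> e))] (mod l)"
        using True by simp
    qed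
  next
    case False
    have p': "[nth0 p i = coeff (?S n) (2 * i)] (mod l)" for i
      using p False by (simp add: list_rep_def)
    show ?thesis
      unfolding list_rep_def
    proof
      fix i
      let ?A = "- 2 * (int n + w)"
      have "[nth0 (serre_row l ?A 12 (?c mod l) (hd0 p) (tl p) r) i =
         (?A + 12 * int i) * (if i = 0 then hd0 p else nth0 (tl p) (i - 1)) - (12 + 12 * int i) * nth0 (tl p) i - ?c mod l * nth0 r i] (mod l)"
        by (rule nth0_serre_row)
      also have "(if i = 0 then hd0 p else nth0 (tl p) (i - 1)) = nth0 p i"
        by (cases i) (auto simp: nth0_0)
      also have "[(?A + 12 * int i) * nth0 p i - (12 + 12 * int i) * nth0 (tl p) i - ?c mod l * nth0 r i
         = (?A + 12 * int i) * coeff (?S n) (2 * i) - (12 + 12 * int i) * coeff (?S n) (2 * Suc i)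
          - ?c * coeff (?S (n - 1)) (2 * i + 1)] (mod l)"
        using r'[of i] False p'[of i] p'[of "Suc i"] unfolding nth0_tl
        by (intro cong_diff[OF cong_diff]) (auto intro!: cong_mult[OF cong_refl])
      also have "(?A + 12 * int i) * coeff (?S n) (2 * i) - (12 + 12 * int i) * coeff (?S n) (2 * Suc i)
          - ?c * coeff (?S (n - 1)) (2 * i + 1) = coeff (?S (Suc n)) (2 * i + 1)"
        unfolding coeff_serre_seq_Suc by (simp add: algebra_simps)
      finally show "[nth0 (if e then serre_row l (?A - 6) 6 (?c mod l) 0 p r
         else serre_row l ?A 12 (?c mod l) (hd0 p) (tl p) r) i = coeff (?S (Suc n)) (2 * i + of_bool (\<not> e))] (mod l)"
        using False by simp
    qed
  qed
qed

lemma list_rep_serre_run: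
  assumes "list_rep l e p (serre_seq k w f n)" "n = 0 \<or> list_rep l (\<not> e) r (serre_seq k w f (n - 1))"
  shows "list_rep l (e \<noteq> odd m) (serre_run l k w e m (int n) r p) (serre_seq k w f (n + m))"
  using assms
proof (induction m arbitrary: e n r p)
  case (Suc m)
  have "list_rep l ((\<not> e) \<noteq> odd m) (serre_run l k w (\<not> e) m (int (Suc n)) p
     (if e then serre_row l (- 2 * (int n + w) - 6) 6 (int n * (int n + k - 1) mod l) 0 p r
      else serre_row l (- 2 * (int n + w)) 12 (int n * (int n + k - 1) mod l) (hd0 p) (tl p) r)) (serre_seq k w f (Suc n + m))"
    using Suc.prems by (intro Suc.IH list_rep_serre_row) auto
  thus ?case by (cases "odd m") (auto simp: add.commute)
qed auto

corollary list_rep_serre_run_0: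
  assumes "list_rep l e p f" "odd m"
  shows "list_rep l (\<not> e) (serre_run l k w e m 0 [] p) (serre_seq k w f m)"
  using list_rep_serre_run[of l e p k w f 0 "[]" m] assms by simp

fun sub_scaled :: "int \<Rightarrow> int \<Rightarrow> int list \<Rightarrow> int list \<Rightarrow> int list" where
  "sub_scaled l z [] rs = rs"
| "sub_scaled l z (x # xs) [] = (- (z * x)) mod l # sub_scaled l z xs []"
| "sub_scaled l z (x # xs) (r # rs) = (r - z * x) mod l # sub_scaled l z xs rs"

text \<open>Remainder of \<open>n\<close> steps of long division of power series by \<open>xs\<close>; \<open>v\<close> is the inverse of \<open>xs ! 0\<close> modulo \<open>l\<close>.\<close>
fun series_rem :: "int \<Rightarrow> int \<Rightarrow> int list \<Rightarrow> nat \<Rightarrow> int list \<Rightarrow> int list" where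
  "series_rem l v xs 0 rs = rs"
| "series_rem l v xs (Suc n) rs = series_rem l v xs n (tl (sub_scaled l (v * hd0 rs mod l) xs rs))"

lemma nth0_sub_scaled: "[nth0 (sub_scaled l z xs rs) i = nth0 rs i - z * nth0 xs i] (mod l)"
proof (induction l z xs rs arbitrary: i rule: sub_scaled.induct)
  case (2 l z x xs)
  then show ?case by (cases i) (auto simp: cong_def)
next
  case (3 l z x xs r rs)
  then show ?case by (cases i) (auto simp: cong_def)
qed auto

text \<open>Unlike \<open>list_rep\<close>, this also demands that the odd coefficients vanish
  modulo \<open>l\<close>, so that dropping the head of a list is an honest division by
  \<open>t ^ 2\<close>.\<close>

definition list_rep_even :: "int \<Rightarrow> int list \<Rightarrow> int poly \<Rightarrow> bool" where
  "list_rep_even l xs f \<longleftrightarrow> (\<forall>j. [(if even j then nth0 xs (j div 2) else 0) = coeff f j] (mod l))"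

lemma list_rep_even_sub_scaled:
  assumes "list_rep_even l xs f" "list_rep_even l rs g"
  shows "list_rep_even l (sub_scaled l z xs rs) (g - smult z f)"
  unfolding list_rep_even_def coeff_diff coeff_smult
proof
  fix j
  have "[(if even j then nth0 (sub_scaled l z xs rs) (j div 2) else 0) =
    (if even j then nth0 rs (j div 2) else 0) - z * (if even j then nth0 xs (j div 2) else 0)] (mod l)"
    using nth0_sub_scaled by simp
  also have "[(if even j then nth0 rs (j div 2) else 0) - z * (if even j then nth0 xs (j div 2) else 0)
     = coeff g j - z * coeff f j] (mod l)"
    using assms unfolding list_rep_even_def by (intro cong_diff cong_mult cong_refl) blast+
  finally show "[(if even j then nth0 (sub_scaled l z xs rs) (j div 2) else 0) = coeff g j - z * coeff f j] (mod l)" .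
qed

text \<open>Each round subtracts the multiple of \<open>X\<close> that clears the constant term
  modulo \<open>l\<close> and then divides by \<open>t ^ 2\<close>; the multiples used are the
  coefficients of \<open>Z\<close>.\<close>

lemma series_rem:
  assumes X: "list_rep_even (int l) xs X" and v: "[v * hd0 xs = 1] (mod int l)"
  shows "list_rep_even (int l) rs f \<Longrightarrow> \<exists>Z g. (\<forall>j\<ge>2 * n. coeff Z j = 0) \<and>
     list_rep_even (int l) (series_rem (int l) v xs n rs) g \<and> (\<forall>s. f - (X * Z + monom 1 (2 * n) * g) \<in> pmod l s)"
proof (induction n arbitrary: rs f)
  case 0
  thus ?case by (intro exI[of _ 0] exI[of _ f]) simp
next
  case (Suc n)
  define z where "z = v * hd0 rs mod int l"
  define h where "h = f - smult z X"
  have h: "list_rep_even (int l) (sub_scaled (int l) z xs rs) h"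
    unfolding h_def by (intro list_rep_even_sub_scaled X Suc.prems)
  have h0: "int l dvd coeff h 0"
  proof -
    have "[nth0 xs 0 = coeff X 0] (mod int l)" "[nth0 rs 0 = coeff f 0] (mod int l)"
      using X Suc.prems unfolding list_rep_even_def by (metis even_zero div_0)+
    hence "[coeff f 0 - z * coeff X 0 = hd0 rs - v * hd0 rs * hd0 xs] (mod int l)"
      unfolding z_def nth0_0 by (intro cong_diff cong_mult) (auto simp: cong_sym cong_def)
    also have "hd0 rs - v * hd0 rs * hd0 xs = hd0 rs * (1 - v * hd0 xs)" by (simp add: algebra_simps)
    also have "[hd0 rs * (1 - v * hd0 xs) = hd0 rs * (1 - 1)] (mod int l)" using v by (intro cong_mult cong_diff cong_refl)
    finally show ?thesis by (simp add: h_def cong_0_iff)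
  qed
  have h1: "int l dvd coeff h 1"
    using h unfolding list_rep_even_def by (metis cong_0_iff cong_sym odd_one)
  define f' where "f' = poly_shift 2 h"
  have f': "list_rep_even (int l) (tl (sub_scaled (int l) z xs rs)) f'"
    unfolding list_rep_even_def
  proof
    fix j
    have "[(if even (j + 2) then nth0 (sub_scaled (int l) z xs rs) ((j + 2) div 2) else 0) = coeff h (j + 2)] (mod int l)"
      using h unfolding list_rep_even_def by blast
    thus "[(if even j then nth0 (tl (sub_scaled (int l) z xs rs)) (j div 2) else 0) = coeff f' j] (mod int l)"
      by (cases "even j") (simp_all add: f'_def coeff_poly_shift)
  qed
  obtain Z g where Z: "\<And>j. j \<ge> 2 * n \<Longrightarrow> coeff Z j = 0"
    "list_rep_even (int l) (series_rem (int l) v xs n (tl (sub_scaled (int l) z xs rs))) g"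
    "\<And>s. f' - (X * Z + monom 1 (2 * n) * g) \<in> pmod l s"
    using Suc.IH[OF f'] by blast
  have hf': "h - monom 1 2 * f' \<in> pmod l s" for s
    unfolding pmod_def mem_Collect_eq
  proof (intro allI impI)
    fix j
    show "int l dvd coeff (h - monom 1 2 * f') j"
      using h0 h1 le_add_diff_inverse[of 2 j]
      by (cases "j < 2") (auto simp: coeff_monom_mult f'_def coeff_poly_shift less_2_cases_iff)
  qed
  show ?case
  proof (intro exI conjI allI impI)
    fix j assume "2 * Suc n \<le> j"
    thus "coeff ([:z:] + monom 1 2 * Z) j = 0"
      by (auto simp: coeff_monom_mult coeff_pCons Z(1) split: nat.splits)
  next
    show "list_rep_even (int l) (series_rem (int l) v xs (Suc n) rs) g"
      using Z(2) by (simp add: z_def)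
  next
    fix s
    have "f - (X * ([:z:] + monom 1 2 * Z) + monom 1 (2 * Suc n) * g) =
      (h - monom 1 2 * f') + monom 1 2 * (f' - (X * Z + monom 1 (2 * n) * g))"
    proof -
      have "monom (1::int) (2 * Suc n) = monom 1 2 * monom 1 (2 * n)" by (simp add: mult_monom)
      thus ?thesis by (simp add: h_def algebra_simps)
    qed
    also have "\<dots> \<in> pmod l s" by (intro pmod_add hf' pmod_mult_left Z(3))
    finally show "f - (X * ([:z:] + monom 1 2 * Z) + monom 1 (2 * Suc n) * g) \<in> pmod l s" .
  qed
qed

text \<open>In weight 6 the polynomial \<open>t\<close> stands for E_6 and \<open>1\<close> for
  E_4^(3/2), which explains \<open>k = 6\<close> and \<open>w = 3\<close>. The product of
  \<open>t\<close> with the iterate of \<open>1\<close> has no constant term, so the run started at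
  \<open>t\<close> alone yields X(0). The name refers to the elliptic curve with complex
  multiplication by \<open>\<i>\<close>, which is supersingular at an odd prime exactly when the
  prime is 3 modulo 4.\<close>

definition supersingular_check :: "nat \<Rightarrow> bool" where
  "supersingular_check l \<longleftrightarrow> hd0 (serre_run (int l) 6 3 True l 0 [] [1]) mod int l = 0"

text \<open>The \<open>0\<close> in front of the second run multiplies an odd polynomial by
  \<open>t\<close> in half-list form, so \<open>xs\<close> represents X. The argument
  \<open>v\<close> is a supplied inverse of X(0), only to be verified. After \<open>l div 2\<close>
  rounds of division the head of the remainder sits at degree \<open>l - 1\<close>, and it is
  nonzero exactly when 1/X has a nonzero coefficient there.\<close>

definition ordinary_check :: "nat \<Rightarrow> int \<Rightarrow> bool" where
  "ordinary_check l v \<longleftrightarrow>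
    (let L = int l; xs = sub_scaled L 1 (0 # serre_run L 6 3 False l 0 [] [1]) (serre_run L 6 3 True l 0 [] [1]) in
      v * hd0 xs mod L = 1 \<and> hd0 (serre_run L 12 0 False l 0 [] [1]) mod L \<noteq> 0 \<and>
      hd0 (series_rem L v xs (l div 2) [1]) mod L \<noteq> 0)"

text \<open>The weight-0 function \<open>t\<close> has large iterates; writing it as a quotient of two
  forms of weight 6 keeps the polynomials in the computation short.\<close>
lemma serre_seq_var_prime:
  assumes "prime l"
  shows "serre_seq 6 3 [:0, 1:] l - (serre_seq 0 0 [:0, 1:] l + [:0, 1:] * serre_seq 6 3 1 l) \<in> pmod l s"
  using serre_seq_prime_mult[OF assms, of 6 0 3 0 1 "[:0, 1:]" s] by simp

lemma list_rep_t: "list_rep l True [1] [:0, 1:]"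
  and list_rep_1: "list_rep l False [1] 1"
  by (auto simp: list_rep_def nth0_def coeff_pCons split: nat.splits)

lemma supersingular_check_imp:
  assumes "prime l" "odd l" "supersingular_check l"
  shows "\<forall>\<^sub>F n in sequentially. int l dvd dseq n"
proof (rule eventually_dvd_dseq[OF assms(1,2)])
  have "list_rep (int l) False (serre_run (int l) 6 3 True l 0 [] [1]) (serre_seq 6 3 [:0, 1:] l)"
    using list_rep_serre_run_0[OF list_rep_t assms(2)] by simp
  hence "[nth0 (serre_run (int l) 6 3 True l 0 [] [1]) 0 = coeff (serre_seq 6 3 [:0, 1:] l) 0] (mod int l)"
    unfolding list_rep_def by (metis add.right_neutral mult_0_right of_bool_eq(1))
  hence "int l dvd coeff (serre_seq 6 3 [:0, 1:] l) 0"
    using assms(3) unfolding supersingular_check_def nth0_0 by (simp add: cong_def dvd_eq_mod_eq_0)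
  moreover have "int l dvd coeff (serre_seq 6 3 [:0, 1:] l) 0 - coeff (serre_seq 0 0 [:0, 1:] l) 0"
    using serre_seq_var_prime[OF assms(1), of 1] by (simp add: pmod_def)
  ultimately show "int l dvd coeff (serre_seq 0 0 [:0, 1:] l) 0"
    by (metis dvd_diff_right_iff)
qed

lemma ordinary_check_imp:
  assumes "prime l" "l > 3" "ordinary_check l v"
  shows "\<not> (\<forall>\<^sub>F n in sequentially. int l dvd dseq n)"
proof -
  have odd: "odd l" using assms prime_odd_nat[of l] by simp
  let ?a = "serre_run (int l) 6 3 True l 0 [] [1]" and ?b = "serre_run (int l) 6 3 False l 0 [] [1]"
  let ?X = "serre_seq 0 0 [:0, 1:] l"
  define xs where "xs = sub_scaled (int l) 1 (0 # ?b) ?a"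
  have v: "[v * hd0 xs = 1] (mod int l)" and
    c: "hd0 (serre_run (int l) 12 0 False l 0 [] [1]) mod int l \<noteq> 0" "hd0 (series_rem (int l) v xs (l div 2) [1]) mod int l \<noteq> 0"
    using assms(2,3) unfolding ordinary_check_def Let_def xs_def[symmetric] by (auto simp: cong_def)
  have a: "[nth0 ?a i = coeff (serre_seq 6 3 [:0, 1:] l) (2 * i)] (mod int l)" for i
    using list_rep_serre_run_0[OF list_rep_t odd, of "int l" 6 3] by (simp add: list_rep_def)
  have b: "[nth0 ?b i = coeff (serre_seq 6 3 1 l) (2 * i + 1)] (mod int l)" for i
    using list_rep_serre_run_0[OF list_rep_1 odd, of "int l" 6 3] by (simp add: list_rep_def)
  have X: "list_rep_even (int l) xs ?X"
    unfolding list_rep_even_def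
  proof
    fix j
    show "[(if even j then nth0 xs (j div 2) else 0) = coeff ?X j] (mod int l)"
    proof (cases "even j")
      case False
      hence "coeff ?X j = 0" using odd by (intro serre_seq_parity[of 1]) (auto simp: coeff_pCons split: nat.splits)
      thus ?thesis using False by simp
    next
      case True
      then obtain i where i: "j = 2 * i" by (elim evenE)
      have "[nth0 xs i = nth0 ?a i - nth0 (0 # ?b) i] (mod int l)"
        unfolding xs_def using nth0_sub_scaled[of "int l" 1 "0 # ?b" ?a i] by simp
      also have "[nth0 ?a i - nth0 (0 # ?b) i = coeff (serre_seq 6 3 [:0, 1:] l) (2 * i) - coeff ([:0, 1:] * serre_seq 6 3 1 l) (2 * i)] (mod int l)"
      proof (intro cong_diff a)
        show "[nth0 (0 # ?b) i = coeff ([:0, 1:] * serre_seq 6 3 1 l) (2 * i)] (mod int l)"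
          using b[of "i - 1"] by (cases i) auto
      qed
      also have "[coeff (serre_seq 6 3 [:0, 1:] l) (2 * i) - coeff ([:0, 1:] * serre_seq 6 3 1 l) (2 * i) = coeff ?X (2 * i)] (mod int l)"
      proof -
        have "int l dvd coeff (serre_seq 6 3 [:0, 1:] l - (?X + [:0, 1:] * serre_seq 6 3 1 l)) (2 * i)"
          using serre_seq_var_prime[OF assms(1), of "Suc (2 * i)"] unfolding pmod_def by blast
        thus ?thesis by (simp add: cong_iff_dvd_diff algebra_simps del: mult_pCons_left mult_pCons_right)
      qed
      finally show ?thesis using i by simp
    qed
  qed
  have X0: "\<not> int l dvd coeff ?X 0"
  proof
    assume "int l dvd coeff ?X 0"
    moreover have "[hd0 xs = coeff ?X 0] (mod int l)"
      using X unfolding list_rep_even_def nth0_0[symmetric] by (metis even_zero div_0)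
    ultimately have "int l dvd hd0 xs" by (metis cong_dvd_iff)
    hence "int l dvd v * hd0 xs" by simp
    hence "int l dvd 1" using v by (metis cong_dvd_iff)
    thus False using assms(2) by simp
  qed
  have Y: "\<not> int l dvd coeff (serre_seq 12 0 1 l) 1"
  proof -
    have "[nth0 (serre_run (int l) 12 0 False l 0 [] [1]) 0 = coeff (serre_seq 12 0 1 l) (2 * 0 + 1)] (mod int l)"
      using list_rep_serre_run_0[OF list_rep_1 odd, of "int l" 12 0] unfolding list_rep_def by (metis of_bool_eq(2))
    thus ?thesis using c(1) by (simp add: nth0_0 cong_def dvd_eq_mod_eq_0)
  qed
  have "list_rep_even (int l) [1] 1"
    by (auto simp: list_rep_even_def nth0_def coeff_1)
  from series_rem[OF X v this, of "l div 2"] obtain Z g where Z: "\<And>j. j \<ge> 2 * (l div 2) \<Longrightarrow> coeff Z j = 0"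
    "list_rep_even (int l) (series_rem (int l) v xs (l div 2) [1]) g"
    "\<And>s. 1 - (?X * Z + monom 1 (2 * (l div 2)) * g) \<in> pmod l s" by blast
  have l2: "2 * (l div 2) = l - 1" using odd by (auto elim!: oddE)
  show ?thesis
  proof (rule not_eventually_dvd_dseq[OF assms(1,2) X0 Y])
    show "coeff Z (l - 1) = 0" using Z(1) l2 by simp
    have "[nth0 (series_rem (int l) v xs (l div 2) [1]) 0 = coeff g 0] (mod int l)"
      using Z(2) unfolding list_rep_even_def by (metis even_zero div_0)
    thus "\<not> int l dvd - coeff g 0" using c(2) unfolding dvd_minus_iff by (simp add: nth0_0 cong_def dvd_eq_mod_eq_0)
    have "monom 1 (l - 1) * g - monom (coeff g 0) (l - 1) \<in> pmod l l"
      by (auto simp: pmod_def coeff_monom_mult)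
    moreover have "?X * Z - 1 - monom (- coeff g 0) (l - 1) =
      - 1 * (1 - (?X * Z + monom 1 (l - 1) * g)) - (monom 1 (l - 1) * g - monom (coeff g 0) (l - 1))"
      by (simp add: minus_monom[symmetric])
    ultimately show "?X * Z - 1 - monom (- coeff g 0) (l - 1) \<in> pmod l l"
      using Z(3)[of l] unfolding l2 by (metis pmod_diff pmod_mult_left)
  qed
qed

section \<open>The odd primes below 100\<close>

lemma ordinary_check_5: "ordinary_check 5 4" by code_simp
lemma ordinary_check_13: "ordinary_check 13 8" by code_simp
lemma ordinary_check_17: "ordinary_check 17 5" by code_simp
lemma ordinary_check_29: "ordinary_check 29 16" by code_simp
lemma ordinary_check_37: "ordinary_check 37 20" by code_simp
lemma ordinary_check_41: "ordinary_check 41 30" by code_simp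
lemma ordinary_check_53: "ordinary_check 53 16" by code_simp
lemma ordinary_check_61: "ordinary_check 61 55" by code_simp
lemma ordinary_check_73: "ordinary_check 73 49" by code_simp
lemma ordinary_check_89: "ordinary_check 89 58" by code_simp
lemma ordinary_check_97: "ordinary_check 97 24" by code_simp
lemma supersingular_check_3: "supersingular_check 3" by code_simp
lemma supersingular_check_7: "supersingular_check 7" by code_simp
lemma supersingular_check_11: "supersingular_check 11" by code_simp
lemma supersingular_check_19: "supersingular_check 19" by code_simp
lemma supersingular_check_23: "supersingular_check 23" by code_simp
lemma supersingular_check_31: "supersingular_check 31" by code_simp
lemma supersingular_check_43: "supersingular_check 43" by code_simp
lemma supersingular_check_47: "supersingular_check 47" by code_simp
lemma supersingular_check_59: "supersingular_check 59" by code_simp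
lemma supersingular_check_67: "supersingular_check 67" by code_simp
lemma supersingular_check_71: "supersingular_check 71" by code_simp
lemma supersingular_check_79: "supersingular_check 79" by code_simp
lemma supersingular_check_83: "supersingular_check 83" by code_simp
lemma prime_less_100:
  assumes "prime (l::nat)" "2 < l" "l < 100"
  shows "l \<in> set [5, 13, 17, 29, 37, 41, 53, 61, 73, 89, 97] \<or> l \<in> set [3, 7, 11, 19, 23, 31, 43, 47, 59, 67, 71, 79, 83]"
proof -
  have "list_all (\<lambda>l. prime l \<longrightarrow> l \<in> set [5, 13, 17, 29, 37, 41, 53, 61, 73, 89, 97] \<or> l \<in> set [3, 7, 11, 19, 23, 31, 43, 47, 59, 67, 71, 79, 83]) [3..<100::nat]"
    by code_simp
  moreover have "l \<in> set [3..<100]"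
    unfolding set_upt atLeastLessThan_iff using assms by linarith
  ultimately show ?thesis using assms(1) unfolding list_all_iff by blast
qed

lemma eventually_dvd_dseq_iff:
  assumes "prime (l::nat)" "2 < l" "l < 100"
  shows "(\<forall>\<^sub>F n in sequentially. int l dvd dseq n) \<longleftrightarrow> [l = 3] (mod 4)"
proof -
  note ord = ordinary_check_5 ordinary_check_13 ordinary_check_17 ordinary_check_29 ordinary_check_37 ordinary_check_41 ordinary_check_53 ordinary_check_61 ordinary_check_73 ordinary_check_89 ordinary_check_97
  note sup = supersingular_check_3 supersingular_check_7 supersingular_check_11 supersingular_check_19 supersingular_check_23 supersingular_check_31 supersingular_check_43 supersingular_check_47 supersingular_check_59 supersingular_check_67 supersingular_check_71 supersingular_check_79 supersingular_check_83
  consider "l \<in> set [5, 13, 17, 29, 37, 41, 53, 61, 73, 89, 97]" | "l \<in> set [3, 7, 11, 19, 23, 31, 43, 47, 59, 67, 71, 79, 83]"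
    using prime_less_100[OF assms] by blast
  thus ?thesis
  proof cases
    case 1
    hence "\<exists>v. ordinary_check l v" using ord unfolding list.set by blast
    moreover have "l > 3" "\<not> [l = 3] (mod 4)" using 1 unfolding cong_def list.set by auto
    ultimately show ?thesis using ordinary_check_imp[OF assms(1)] by blast
  next
    case 2
    hence "supersingular_check l" using sup unfolding list.set by blast
    moreover have "odd l" "[l = 3] (mod 4)" using 2 unfolding cong_def list.set by auto
    ultimately show ?thesis using supersingular_check_imp[OF assms(1)] by blast
  qed
qed

section \<open>Theta functions on the real interval\<close>

subsection \<open>The theta series\<close>

text \<open>Starting from a formal power series, \<open>eval_fps\<close> gives differentiability on
  all of (-1, 1), including 0 and the negative arguments that represent theta_4.\<close>

definition theta_fps :: "real fps" where
  "theta_fps = Abs_fps (\<lambda>n. if n = 0 then 1 else if (\<exists>k. n = k\<^sup>2) then 2 else 0)"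

definition theta :: "real \<Rightarrow> real" where "theta = eval_fps theta_fps"

lemma fps_conv_radius_theta: "fps_conv_radius theta_fps \<ge> 1"
  unfolding fps_conv_radius_def
proof (rule conv_radius_geI_ex')
  fix r :: real assume r: "0 < r" "ereal r < 1"
  show "summable (\<lambda>n. fps_nth theta_fps n * of_real r ^ n)"
  proof (rule summable_comparison_test)
    show "\<exists>N. \<forall>n\<ge>N. norm (fps_nth theta_fps n * of_real r ^ n) \<le> 2 * r ^ n"
      using r by (auto simp: theta_fps_def abs_mult)
    show "summable (\<lambda>n. 2 * r ^ n)" using r by (intro summable_mult summable_geometric) auto
  qed
qed

lemma theta_radius:
  assumes "\<bar>q\<bar> < 1" shows "ereal (norm (q::real)) < fps_conv_radius theta_fps"
proof -
  have "ereal (norm q) < ereal 1" using assms by simp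
  also have "ereal 1 \<le> fps_conv_radius theta_fps" using fps_conv_radius_theta by (simp only: one_ereal_def)
  finally show ?thesis .
qed

lemma theta_radius': "\<bar>q\<bar> < 1 \<Longrightarrow> ereal (norm (q::real)) < fps_conv_radius (fps_deriv theta_fps)"
  by (rule less_le_trans[OF theta_radius fps_conv_radius_deriv])

definition theta' :: "real \<Rightarrow> real" where "theta' = eval_fps (fps_deriv theta_fps)"

definition theta'' :: "real \<Rightarrow> real" where "theta'' = eval_fps (fps_deriv (fps_deriv theta_fps))"

lemma theta_has_derivative:
  "\<bar>q\<bar> < 1 \<Longrightarrow> (theta has_real_derivative theta' q) (at q within A)"
  unfolding theta_def theta'_def by (intro has_field_derivative_eval_fps theta_radius)

lemma theta'_has_derivative:
  "\<bar>q\<bar> < 1 \<Longrightarrow> (theta' has_real_derivative theta'' q) (at q within A)"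
  unfolding theta'_def theta''_def by (intro has_field_derivative_eval_fps theta_radius')

lemma theta_has_sum_square:
  assumes "\<bar>q\<bar> < 1"
  shows "((\<lambda>k. (if k = 0 then 1 else 2) * q ^ k\<^sup>2) has_sum theta q) UNIV"
proof -
  have "((\<lambda>n. fps_nth theta_fps n * q ^ n) has_sum theta q) UNIV"
    unfolding theta_def by (intro norm_summable_imp_has_sum norm_summable_fps sums_eval_fps theta_radius assms)
  also have "?this \<longleftrightarrow> ((\<lambda>n. fps_nth theta_fps n * q ^ n) has_sum theta q) (range (\<lambda>k. k\<^sup>2))"
    by (intro has_sum_cong_neutral) (auto simp: theta_fps_def)
  also have "\<dots> \<longleftrightarrow> ((\<lambda>k. (if k = 0 then 1 else 2) * q ^ k\<^sup>2) has_sum theta q) UNIV"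
    by (rule has_sum_reindex_bij_betw[symmetric, of "\<lambda>k::nat. k\<^sup>2" UNIV, THEN trans])
       (auto simp: bij_betw_def inj_on_def theta_fps_def intro!: has_sum_cong)
  finally show ?thesis .
qed

lemma summable_power_square:
  assumes "\<bar>q::real\<bar> < 1" shows "summable (\<lambda>k. norm (q ^ k\<^sup>2))"
proof (rule summable_comparison_test)
  have "n \<le> n\<^sup>2" for n :: nat by (simp add: power2_eq_square)
  thus "\<exists>N. \<forall>n\<ge>N. norm (norm (q ^ n\<^sup>2)) \<le> \<bar>q\<bar> ^ n"
    using assms by (simp add: power_abs power_decreasing)
  show "summable (\<lambda>n. \<bar>q\<bar> ^ n)" using assms by (intro summable_geometric) auto
qed

lemma theta_has_sum_int:
  assumes "\<bar>q\<bar> < 1"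
  shows "((\<lambda>n::int. q ^ nat (n\<^sup>2)) has_sum theta q) UNIV"
proof -
  define T where "T = (\<Sum>k. q ^ k\<^sup>2)"
  have sT: "(\<lambda>k. q ^ k\<^sup>2) sums T"
    unfolding T_def by (intro summable_sums summable_norm_cancel[OF summable_power_square] assms)
  have hT: "((\<lambda>k. q ^ k\<^sup>2) has_sum T) UNIV"
    by (intro norm_summable_imp_has_sum summable_power_square assms sT)
  have "((\<lambda>k. 2 * q ^ k\<^sup>2 + (if k = 0 then - 1 else 0)) has_sum (2 * T + -1)) (UNIV :: nat set)"
    by (intro has_sum_add has_sum_cmult_right hT has_sum_finite_neutralI[where B = "{0}"]) auto
  also have "(\<lambda>k. 2 * q ^ k\<^sup>2 + (if k = 0 then - 1 else 0)) = (\<lambda>k. (if k = 0 then 1 else 2) * q ^ k\<^sup>2)"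
    by auto
  finally have th: "theta q = 2 * T - 1"
    using has_sum_unique theta_has_sum_square[OF assms] by fastforce
  have "((\<lambda>n::int. q ^ nat (n\<^sup>2)) has_sum T) {0..}"
    using hT by (subst has_sum_reindex_bij_witness[of "{0..}" int nat UNIV "\<lambda>k. q ^ k\<^sup>2" _ T T])
       (auto simp: nat_power_eq)
  moreover have "((\<lambda>n::int. q ^ nat (n\<^sup>2)) has_sum (T - 1)) {..<0}"
  proof -
    have "summable (\<lambda>k. norm (q ^ (Suc k)\<^sup>2))"
      using summable_power_square[OF assms] by (subst summable_Suc_iff)
    moreover have "(\<lambda>k. q ^ (Suc k)\<^sup>2) sums (T - 1)"
      using sT by (subst sums_Suc_iff) auto
    ultimately have "((\<lambda>k. q ^ (Suc k)\<^sup>2) has_sum (T - 1)) UNIV"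
      by (rule norm_summable_imp_has_sum)
    thus ?thesis
      by (subst has_sum_reindex_bij_witness[of "{..<0}" "\<lambda>k. - int (Suc k)" "\<lambda>n. nat (- n - 1)" UNIV "\<lambda>k. q ^ (Suc k)\<^sup>2" _ "T - 1" "T - 1"])
         (auto simp: nat_power_eq[symmetric] simp del: of_nat_Suc simp: Suc_nat_eq_nat_zadd1)
  qed
  ultimately have "((\<lambda>n::int. q ^ nat (n\<^sup>2)) has_sum (T + (T - 1))) ({0..} \<union> {..<0})"
    by (intro has_sum_Un_disjoint) auto
  also have "{0..} \<union> {..<0} = (UNIV :: int set)" by auto
  finally show ?thesis by (simp add: th)
qed

lemma has_sum_times:
  fixes f g :: "'a \<Rightarrow> real"
  assumes f: "(f has_sum a) UNIV" "(\<lambda>x. norm (f x)) summable_on UNIV" and g: "(g has_sum b) UNIV" "(\<lambda>x. norm (g x)) summable_on UNIV"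
  shows "((\<lambda>(x, y). f x * g y) has_sum (a * b)) UNIV"
proof -
  have "(\<lambda>(x, y). norm (f x) * norm (g y)) summable_on (UNIV \<times> UNIV)"
    using f(2) g(2)
    by (intro summable_on_SigmaI[where g = "\<lambda>x. norm (f x) * (\<Sum>\<^sub>\<infinity>y. norm (g y))"])
       (auto intro!: has_sum_cmult_right summable_on_cmult_left)
  hence "(\<lambda>z. norm (case z of (x, y) \<Rightarrow> f x * g y)) summable_on (UNIV \<times> UNIV)"
    by (simp add: case_prod_unfold abs_mult)
  hence "(\<lambda>(x, y). f x * g y) summable_on (UNIV \<times> UNIV)" by (rule abs_summable_summable)
  thus ?thesis using f(1) g(1)
    by (subst UNIV_Times_UNIV[symmetric], intro has_sum_SigmaI[where g = "\<lambda>x. f x * b"])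
       (auto intro!: has_sum_cmult_right has_sum_cmult_left)
qed

lemma theta_times:
  assumes "\<bar>p\<bar> < 1" "\<bar>q\<bar> < 1"
  shows "((\<lambda>(m, n). p ^ nat (m\<^sup>2) * q ^ nat (n\<^sup>2)) has_sum (theta p * theta q)) UNIV"
proof -
  have *: "(\<lambda>n::int. norm (r ^ nat (n\<^sup>2))) summable_on UNIV" if "\<bar>r\<bar> < 1" for r :: real
    using theta_has_sum_int[of "\<bar>r\<bar>"] that by (auto simp: power_abs summable_on_def)
  show ?thesis using assms by (intro has_sum_times theta_has_sum_int *)
qed

text \<open>The substitution (m, n) = (a + b, a - b) runs through all pairs of equal parity, with
  (m^2 + n^2) / 2 = a^2 + b^2.\<close>

lemma theta_duplication_aux:
  assumes "\<bar>p\<bar> < 1"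
  shows "((\<lambda>(m, n). if even (m + n) then p ^ nat ((m\<^sup>2 + n\<^sup>2) div 2) else 0) has_sum (theta p)\<^sup>2) (UNIV :: (int \<times> int) set)"
proof -
  have "((\<lambda>(m, n). p ^ nat ((m\<^sup>2 + n\<^sup>2) div 2)) has_sum (theta p)\<^sup>2) {(m :: int, n). even (m + n)}"
    unfolding power2_eq_square[of "theta p"]
  proof (subst has_sum_reindex_bij_witness[of _ "\<lambda>(a, b). (a + b, a - b)" "\<lambda>(m, n). ((m + n) div 2, (m - n) div 2)" UNIV "\<lambda>(m, n). p ^ nat (m\<^sup>2) * p ^ nat (n\<^sup>2)"])
    fix x :: "int \<times> int" assume x: "x \<in> {(m, n). even (m + n)}"
    obtain m n where mn: "x = (m, n)" by force
    obtain a b where ab: "m = a + b" "n = a - b"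
      using x mn by (metis (no_types, lifting) case_prod_conv mem_Collect_eq evenE add_diff_cancel_left' diff_add_cancel mult_2 diff_diff_eq2 group_cancel.sub1)
    have e: "(a + b)\<^sup>2 + (a - b)\<^sup>2 = 2 * (a\<^sup>2 + b\<^sup>2)" by (simp add: power2_eq_square algebra_simps)
    show "(case case x of (m, n) \<Rightarrow> ((m + n) div 2, (m - n) div 2) of (m, n) \<Rightarrow> p ^ nat (m\<^sup>2) * p ^ nat (n\<^sup>2)) =
         (case x of (m, n) \<Rightarrow> p ^ nat ((m\<^sup>2 + n\<^sup>2) div 2))"
      unfolding mn ab case_prod_conv e by (simp add: nat_add_distrib power_add)
    show "(case case x of (m, n) \<Rightarrow> ((m + n) div 2, (m - n) div 2) of (a, b) \<Rightarrow> (a + b, a - b)) = x"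
      unfolding mn ab by simp
  qed (use theta_times[OF assms assms] in auto)
  also have "?this \<longleftrightarrow> ?thesis"
    by (rule has_sum_cong_neutral) (auto split: if_splits)
  finally show ?thesis .
qed

lemma nat_squares_half:
  fixes m n :: int
  assumes "even (m + n)"
  shows "nat (m\<^sup>2) + nat (n\<^sup>2) = 2 * nat ((m\<^sup>2 + n\<^sup>2) div 2)"
proof -
  have "even (m\<^sup>2 + n\<^sup>2)" using assms by simp
  then obtain k where k: "m\<^sup>2 + n\<^sup>2 = 2 * k" by (elim evenE)
  have "nat (m\<^sup>2) + nat (n\<^sup>2) = nat (m\<^sup>2 + n\<^sup>2)" by (simp add: nat_add_distrib)
  thus ?thesis unfolding k by (simp add: nat_mult_distrib)
qed

text \<open>The sign (-1)^(m + n) of the second product cancels the pairs of odd parity and doubles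
  the others, which form the series of \<open>theta_duplication_aux\<close>.\<close>

lemma theta_duplication_add:
  assumes "\<bar>q\<bar> < 1"
  shows "(theta q)\<^sup>2 + (theta (- q))\<^sup>2 = 2 * (theta (q\<^sup>2))\<^sup>2"
proof -
  have q2: "\<bar>q\<^sup>2\<bar> < 1" using assms by (simp add: abs_square_less_1)
  have "((\<lambda>x. (case x of (m, n) \<Rightarrow> q ^ nat (m\<^sup>2) * q ^ nat (n\<^sup>2)) + (case x of (m, n) \<Rightarrow> (- q) ^ nat (m\<^sup>2) * (- q) ^ nat (n\<^sup>2)))
     has_sum (theta q * theta q + theta (- q) * theta (- q))) (UNIV :: (int \<times> int) set)"
    using assms by (intro has_sum_add theta_times) auto
  also have "(\<lambda>x. (case x of (m, n) \<Rightarrow> q ^ nat (m\<^sup>2) * q ^ nat (n\<^sup>2)) + (case x of (m, n) \<Rightarrow> (- q) ^ nat (m\<^sup>2) * (- q) ^ nat (n\<^sup>2))) =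
    (\<lambda>x. 2 * (case x of (m, n) \<Rightarrow> if even (m + n) then (q\<^sup>2) ^ nat ((m\<^sup>2 + n\<^sup>2) div 2) else 0))"
  proof (rule ext, clarify)
    fix m n :: int
    have ev: "even (nat (m\<^sup>2)) = even m" for m :: int by (simp add: even_nat_iff)
    have "nat (m\<^sup>2) + nat (n\<^sup>2) = 2 * nat ((m\<^sup>2 + n\<^sup>2) div 2)" if "even (m + n)"
      using that by (rule nat_squares_half)
    thus "q ^ nat (m\<^sup>2) * q ^ nat (n\<^sup>2) + (- q) ^ nat (m\<^sup>2) * (- q) ^ nat (n\<^sup>2) =
      2 * (if even (m + n) then (q\<^sup>2) ^ nat ((m\<^sup>2 + n\<^sup>2) div 2) else 0)"
      by (auto simp flip: power_add power_mult simp: ev)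
  qed
  finally have "((\<lambda>x. 2 * (case x of (m, n) \<Rightarrow> if even (m + n) then (q\<^sup>2) ^ nat ((m\<^sup>2 + n\<^sup>2) div 2) else 0))
     has_sum (theta q * theta q + theta (- q) * theta (- q))) (UNIV :: (int \<times> int) set)" .
  moreover have "((\<lambda>x. 2 * (case x of (m, n) \<Rightarrow> if even (m + n) then (q\<^sup>2) ^ nat ((m\<^sup>2 + n\<^sup>2) div 2) else 0))
     has_sum (2 * (theta (q\<^sup>2))\<^sup>2)) (UNIV :: (int \<times> int) set)"
    by (intro has_sum_cmult_right theta_duplication_aux q2)
  ultimately show ?thesis using has_sum_unique by (fastforce simp: power2_eq_square)
qed

text \<open>The double series carries the sign (-1)^n. Adding its mirror image under exchange of m
  and n cancels the pairs of odd parity; for equal parity (m^2 + n^2) / 2 has the parity of n, so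
  the sign is absorbed into the base \<open>- (q\<^sup>2)\<close>.\<close>

lemma theta_duplication_mult:
  assumes "\<bar>q\<bar> < 1"
  shows "theta q * theta (- q) = (theta (- (q\<^sup>2)))\<^sup>2"
proof -
  have q2: "\<bar>- (q\<^sup>2)\<bar> < 1" using assms by (simp add: abs_square_less_1)
  let ?f = "\<lambda>(m, n). q ^ nat (m\<^sup>2) * (- q) ^ nat (n\<^sup>2) :: real"
  have 1: "(?f has_sum (theta q * theta (- q))) (UNIV :: (int \<times> int) set)"
    using assms by (intro theta_times) auto
  have "((\<lambda>x. ?f (prod.swap x)) has_sum (theta q * theta (- q))) (UNIV :: (int \<times> int) set) \<longleftrightarrow>
      (?f has_sum (theta q * theta (- q))) (UNIV :: (int \<times> int) set)"
    by (rule has_sum_reindex_bij_betw) simp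
  from has_sum_add[OF 1 this[THEN iffD2, OF 1]]
  have "((\<lambda>x. ?f x + ?f (prod.swap x)) has_sum (2 * (theta q * theta (- q)))) (UNIV :: (int \<times> int) set)"
    unfolding mult_2 .
  also have "(\<lambda>x. ?f x + ?f (prod.swap x)) =
    (\<lambda>x. 2 * (case x of (m, n) \<Rightarrow> if even (m + n) then (- (q\<^sup>2)) ^ nat ((m\<^sup>2 + n\<^sup>2) div 2) else 0))"
  proof (rule ext)
    fix x :: "int \<times> int"
    obtain m n where mn: "x = (m, n)" by (cases x)
    have ev: "even (nat (m\<^sup>2)) = even m" for m :: int by (simp add: even_nat_iff)
    have "?f (m, n) + ?f (prod.swap (m, n)) =
      2 * (case (m, n) of (m, n) \<Rightarrow> if even (m + n) then (- (q\<^sup>2)) ^ nat ((m\<^sup>2 + n\<^sup>2) div 2) else 0)"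
    proof (cases "even (m + n)")
      case True
      then obtain k where k: "m = n + 2 * k" by (metis evenE add_diff_cancel_left' diff_add_cancel even_add even_diff)
      have e: "(m\<^sup>2 + n\<^sup>2) div 2 = n\<^sup>2 + 2 * (n * k + k\<^sup>2)"
      proof -
        have "m\<^sup>2 + n\<^sup>2 = 2 * (n\<^sup>2 + 2 * (n * k + k\<^sup>2))" unfolding k by (simp add: power2_eq_square algebra_simps)
        thus ?thesis by simp
      qed
      have ge: "0 \<le> (m\<^sup>2 + n\<^sup>2) div 2" by simp
      have ev2: "even (nat ((m\<^sup>2 + n\<^sup>2) div 2)) = even n"
        using ge unfolding e by (simp add: even_nat_iff)
      have e3: "nat (m\<^sup>2) + nat (n\<^sup>2) = 2 * nat ((m\<^sup>2 + n\<^sup>2) div 2)"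
        using True by (rule nat_squares_half)
      have p: "q ^ a * q ^ b = (q\<^sup>2) ^ nat ((m\<^sup>2 + n\<^sup>2) div 2)" if "a + b = nat (m\<^sup>2) + nat (n\<^sup>2)" for a b
        using that e3 by (simp flip: power_add power_mult)
      have m: "(- x) ^ j = (if even j then 1 else - 1) * x ^ j" for x :: real and j
        by simp
      show ?thesis
        using True p[of "nat (m\<^sup>2)" "nat (n\<^sup>2)"] p[of "nat (n\<^sup>2)" "nat (m\<^sup>2)"]
        by (simp add: m[of q] m[of "q\<^sup>2"] ev ev2 del: power_minus_even power_minus_odd)
    next
      case False
      thus ?thesis by (auto simp: ev mult.commute)
    qed
    thus "?f x + ?f (prod.swap x) =
      2 * (case x of (m, n) \<Rightarrow> if even (m + n) then (- (q\<^sup>2)) ^ nat ((m\<^sup>2 + n\<^sup>2) div 2) else 0)"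
      by (simp only: mn)
  qed
  finally have "((\<lambda>x. 2 * (case x of (m, n) \<Rightarrow> if even (m + n) then (- (q\<^sup>2)) ^ nat ((m\<^sup>2 + n\<^sup>2) div 2) else 0))
     has_sum (2 * (theta q * theta (- q)))) (UNIV :: (int \<times> int) set)" .
  moreover have "((\<lambda>x. 2 * (case x of (m, n) \<Rightarrow> if even (m + n) then (- (q\<^sup>2)) ^ nat ((m\<^sup>2 + n\<^sup>2) div 2) else 0))
     has_sum (2 * (theta (- (q\<^sup>2)))\<^sup>2)) (UNIV :: (int \<times> int) set)"
    by (intro has_sum_cmult_right theta_duplication_aux q2)
  ultimately show ?thesis using has_sum_unique by fastforce
qed

subsection \<open>Product expansions\<close>

definition euler_prod :: "real \<Rightarrow> real" where
  "euler_prod q = (\<Prod>n. 1 - q ^ Suc n)"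

lemma euler_prod_convergent:
  assumes "\<bar>q::real\<bar> < 1" shows "convergent_prod (\<lambda>n. 1 - q ^ Suc n)"
proof (rule abs_convergent_prod_imp_convergent_prod, subst abs_convergent_prod_conv_summable)
  have "summable (\<lambda>n. \<bar>q\<bar> ^ Suc n)" using assms by (subst summable_Suc_iff) (auto intro: summable_geometric)
  thus "summable (\<lambda>n. norm (1 - q ^ Suc n - 1))" by (simp add: power_abs abs_mult)
qed

lemma power_Suc_less_one_abs: "\<bar>q::real\<bar> < 1 \<Longrightarrow> q ^ Suc n < 1"
  by (metis abs_ge_self le_less_trans power_Suc_less_one power_abs abs_ge_zero power_less_one_iff zero_less_Suc)

lemma euler_prod_LIMSEQ:
  assumes "\<bar>q\<bar> < 1" shows "(\<lambda>n. \<Prod>k<n. 1 - q ^ Suc k) \<longlonglongrightarrow> euler_prod q"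
  using convergent_prod_LIMSEQ[OF euler_prod_convergent[OF assms]]
  unfolding euler_prod_def LIMSEQ_lessThan_iff_atMost by simp

lemma euler_prod_pos:
  assumes "\<bar>q\<bar> < 1" shows "euler_prod q > 0"
proof -
  have "1 - q ^ Suc n \<noteq> 0" for n using power_Suc_less_one_abs[OF assms, of n] by simp
  hence "euler_prod q \<noteq> 0" unfolding euler_prod_def
    using assms by (intro prodinf_nonzero euler_prod_convergent)
  moreover have "euler_prod q \<ge> 0"
    by (rule LIMSEQ_le_const[OF euler_prod_LIMSEQ[OF assms]])
       (intro exI allI impI prod_nonneg, simp only: diff_ge_0_iff_ge less_imp_le[OF power_Suc_less_one_abs[OF assms]])
  ultimately show ?thesis by simp
qed

section \<open>Gauss's product for the alternating theta series\<close>

definition theta_partial_prod :: "real \<Rightarrow> nat \<Rightarrow> real" where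
  "theta_partial_prod q n = (\<Prod>k<n. (1 - q ^ Suc k) / (1 + q ^ Suc k))"

lemma theta_partial_prod_Suc:
  "theta_partial_prod q (Suc n) = theta_partial_prod q n * ((1 - q ^ Suc n) / (1 + q ^ Suc n))"
  by (simp add: theta_partial_prod_def)

lemma theta_partial_prod_0 [simp]: "theta_partial_prod q 0 = 1"
  by (simp add: theta_partial_prod_def)

lemma theta_partial_prod_pos: "0 < q \<Longrightarrow> q < 1 \<Longrightarrow> theta_partial_prod q n > 0"
  unfolding theta_partial_prod_def
  by (intro prod_pos ballI divide_pos_pos) (use power_Suc_less_one_abs[of q] in \<open>auto simp del: power_Suc simp: add_pos_pos\<close>)

lemma theta_partial_prod_antimono:
  assumes "0 < q" "q < 1" "m \<le> n" shows "theta_partial_prod q n \<le> theta_partial_prod q m"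
proof (rule lift_Suc_antimono_le[OF _ assms(3)])
  fix n
  have "(1 - q ^ Suc n) / (1 + q ^ Suc n) \<le> 1"
    using assms by (simp add: divide_le_eq_1 add_pos_pos del: power_Suc)
  thus "theta_partial_prod q (Suc n) \<le> theta_partial_prod q n"
    unfolding theta_partial_prod_Suc using theta_partial_prod_pos[OF assms(1,2), of n]
    by (intro mult_left_le) auto
qed

text \<open>Shanks' finite form of Gauss's product for the square theta series.\<close>
lemma shanks_identity:
  assumes q: "0 < q" "q < 1"
  shows "(\<Sum>s\<le>n. (if s = 0 then 1 else 2) * (- q) ^ s\<^sup>2) =
    (\<Sum>s\<le>n. (- 1) ^ s * (theta_partial_prod q n / theta_partial_prod q s) * (2 * q ^ (s * (n + 1)) / (1 + q ^ s)))"
    (is "?S n = (\<Sum>s\<le>n. ?T n s)")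
proof (induction n)
  case (Suc n)
  let ?P = "theta_partial_prod q"
  define N where "N = Suc n"
  \<comment> \<open>Telescoping certificate: passing from \<open>n\<close> to
    \<open>N = n + 1\<close> changes the \<open>s\<close>-th term by \<open>V (Suc s) - V s\<close>,
    with the boundary value 0 at \<open>s = 0\<close>.\<close>
  define V where "V = (\<lambda>s. if s = 0 then 0 else (- 1) ^ s * (2 * ?P n / (1 + q ^ N)) * (q ^ (s * N) / ?P (s - 1)))"
  have pos: "1 + q ^ k > 0" "?P k > 0" for k using q by (auto intro: add_pos_pos theta_partial_prod_pos)
  have step: "?T N s - ?T n s = V (Suc s) - V s" for s
  proof -
    have e1: "?P N = ?P n * ((1 - q ^ N) / (1 + q ^ N))" by (simp add: N_def theta_partial_prod_Suc)
    have e2: "s * (N + 1) = s * N + s" "s * (n + 1) = s * N" "Suc s * N = s * N + N" by (auto simp: N_def)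
    show ?thesis
    proof (cases s)
      case 0
      thus ?thesis using pos[of N] by (simp add: V_def e1 field_simps)
    next
      case (Suc r)
      have e3: "?P s = ?P r * ((1 - q ^ s) / (1 + q ^ s))" by (simp add: Suc theta_partial_prod_Suc)
      have "1 - q ^ s > 0" using power_Suc_less_one_abs[of q r] q by (simp add: Suc)
      moreover have "V s = (- 1) ^ s * (2 * ?P n / (1 + q ^ N)) * (q ^ (s * N) / ?P r)"
        "V (Suc s) = - ((- 1) ^ s) * (2 * ?P n / (1 + q ^ N)) * (q ^ (s * N + N) / ?P s)"
        by (auto simp: V_def Suc e2 add_ac)
      moreover have "e * (p * ((1 - w) / (1 + w)) / (r * ((1 - z) / (1 + z)))) * (2 * (a * z) / (1 + z))
          - e * (p / (r * ((1 - z) / (1 + z)))) * (2 * a / (1 + z))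
        = - e * (2 * p / (1 + w)) * (a * w / (r * ((1 - z) / (1 + z)))) - e * (2 * p / (1 + w)) * (a / r)"
        if "1 - z > 0" "1 + z > 0" "1 + w > 0" "r > 0" for e p w r z a :: real
        using that by (simp add: divide_simps) (simp add: algebra_simps)
      ultimately show ?thesis
        using pos[of s] pos[of N] pos[of r]
        unfolding e1 e2 e3 power_add by simp
    qed
  qed
  have "(\<Sum>s\<le>N. ?T N s) = (\<Sum>s<N. ?T n s) + ((\<Sum>s<N. ?T N s - ?T n s) + ?T N N)"
    by (simp add: sum_subtractf lessThan_Suc_atMost[symmetric])
  also have "(\<Sum>s<N. ?T N s - ?T n s) = V N - V 0"
    unfolding step by (rule sum_lessThan_telescope)
  \<comment> \<open>What remains of the telescoping sum and the new term \<open>s = N\<close>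
    combine to exactly the next summand of the theta series.\<close>
  also have "V N - V 0 + ?T N N = (- 1) ^ N * 2 * q ^ N\<^sup>2"
  proof -
    have 1: "V N - V 0 = (- 1) ^ N * (2 * q ^ (N * N) / (1 + q ^ N))"
      using pos[of n] by (simp add: V_def N_def del: power_Suc)
    have 2: "?T N N = (- 1) ^ N * (2 * (q ^ (N * N) * q ^ N) / (1 + q ^ N))"
      using pos[of N] by (simp add: power_add)
    have "2 * q ^ (N * N) / (1 + q ^ N) + 2 * (q ^ (N * N) * q ^ N) / (1 + q ^ N) = 2 * q ^ (N * N)"
    proof -
      have "2 * q ^ (N * N) / (1 + q ^ N) + 2 * (q ^ (N * N) * q ^ N) / (1 + q ^ N) = 2 * q ^ (N * N) * (1 + q ^ N) / (1 + q ^ N)"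
        by (simp add: add_divide_distrib[symmetric] algebra_simps)
      thus ?thesis using pos(1)[of N] by simp
    qed
    thus ?thesis unfolding 1 2 distrib_left[symmetric] by (simp add: power2_eq_square)
  qed
  also have "(\<Sum>s<N. ?T n s) = ?S n" using Suc.IH by (simp add: N_def lessThan_Suc_atMost)
  finally have *: "(\<Sum>s\<le>N. ?T N s) = ?S n + (- 1) ^ N * 2 * q ^ N\<^sup>2" .
  have "(- q) ^ N\<^sup>2 = (- 1) ^ N * q ^ N\<^sup>2" by (cases "even N") simp_all
  hence "?S N = ?S n + (- 1) ^ N * 2 * q ^ N\<^sup>2" by (simp add: N_def)
  thus ?case using * unfolding N_def by (rule trans[OF _ sym])
qed auto

text \<open>In Shanks' identity the term with \<open>s = 0\<close> is the partial product itself,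
  and each of the other \<open>n\<close> terms is at most \<open>2 * q ^ n\<close> in absolute
  value.\<close>

lemma theta_neg_LIMSEQ:
  assumes q: "0 < q" "q < 1"
  shows "theta_partial_prod q \<longlonglongrightarrow> theta (- q)"
proof -
  let ?P = "theta_partial_prod q"
  let ?T = "\<lambda>n s. (- 1) ^ s * (?P n / ?P s) * (2 * q ^ (s * (n + 1)) / (1 + q ^ s))"
  have "(\<lambda>n. \<Sum>s<n. (if s = 0 then 1 else 2) * (- q) ^ s\<^sup>2) \<longlonglongrightarrow> theta (- q)"
    using has_sum_imp_sums[OF theta_has_sum_square[of "- q"]] q by (simp add: sums_def)
  hence lim: "(\<lambda>n. \<Sum>s\<le>n. ?T n s) \<longlonglongrightarrow> theta (- q)"
    unfolding LIMSEQ_lessThan_iff_atMost shanks_identity[OF q] .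
  have bound: "norm ((\<Sum>s\<le>n. ?T n s) - ?P n) \<le> 2 * (real n * q ^ n)" for n
  proof -
    have "(\<Sum>s\<le>n. ?T n s) - ?P n = (\<Sum>s\<in>{1..n}. ?T n s)"
      by (simp add: atMost_atLeast0 sum.atLeast_Suc_atMost)
    also have "norm \<dots> \<le> real (card {1..n}) * (2 * q ^ n)"
    proof (rule sum_norm_bound)
      fix s assume s: "s \<in> {1..n}"
      have "q ^ (s * (n + 1)) \<le> q ^ n" using s q by (intro power_decreasing) (auto simp: algebra_simps trans_le_add2 mult_le_mono1[of 1 s n, simplified])
      define z p where "z = 2 * q ^ (s * (n + 1)) / (1 + q ^ s)" and "p = ?P n / ?P s"
      have "z \<le> 2 * q ^ (s * (n + 1)) / 1"
        unfolding z_def using q by (intro divide_left_mono) (auto intro: add_pos_pos)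
      also have "\<dots> \<le> 2 * q ^ n" using \<open>q ^ (s * (n + 1)) \<le> q ^ n\<close> by simp
      finally have z: "z \<le> 2 * q ^ n" .
      have p: "p \<le> 1" "p \<ge> 0" unfolding p_def
        using theta_partial_prod_antimono[OF q, of s n] theta_partial_prod_pos[OF q, of n] theta_partial_prod_pos[OF q, of s] s
        by auto
      have z0: "z \<ge> 0" unfolding z_def using q by (intro divide_nonneg_nonneg add_nonneg_nonneg) auto
      have "norm (?T n s) = \<bar>p\<bar> * \<bar>z\<bar>"
        unfolding z_def[symmetric] p_def[symmetric] by (simp add: abs_mult power_abs)
      also have "\<dots> \<le> 1 * (2 * q ^ n)" using p z z0 by (intro mult_mono) auto
      finally show "norm (?T n s) \<le> 2 * q ^ n" by simp
    qed
    finally show ?thesis by (simp add: mult_ac)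
  qed
  have "(\<lambda>n. real n * q ^ n) \<longlonglongrightarrow> 0"
    using q by (intro powser_times_n_limit_0) auto
  hence "(\<lambda>n. 2 * (real n * q ^ n)) \<longlonglongrightarrow> 0" by (intro tendsto_mult_right_zero)
  hence "(\<lambda>n. (\<Sum>s\<le>n. ?T n s) - ?P n) \<longlonglongrightarrow> 0"
    by (rule Lim_null_comparison[rotated]) (use bound in auto)
  from tendsto_diff[OF lim this] show ?thesis by simp
qed

lemma theta_neg_product:
  assumes q: "0 < q" "q < 1"
  shows "theta (- q) = (euler_prod q)\<^sup>2 / euler_prod (q\<^sup>2)"
proof (rule LIMSEQ_unique[OF theta_neg_LIMSEQ[OF q]])
  have q2: "\<bar>q\<^sup>2\<bar> < 1" using q by (simp add: abs_square_less_1)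
  have "(1 - q ^ Suc k) / (1 + q ^ Suc k) = (1 - q ^ Suc k)\<^sup>2 / (1 - (q\<^sup>2) ^ Suc k)" for k
  proof -
    have "1 - (q\<^sup>2) ^ Suc k = (1 - q ^ Suc k) * (1 + q ^ Suc k)"
      by (simp add: algebra_simps power2_eq_square power_mult_distrib)
    moreover have "1 - q ^ Suc k > 0" using power_Suc_less_one_abs[of q k] q by simp
    ultimately show ?thesis by (simp add: power2_eq_square)
  qed
  hence "theta_partial_prod q = (\<lambda>n. (\<Prod>k<n. 1 - q ^ Suc k)\<^sup>2 / (\<Prod>k<n. 1 - (q\<^sup>2) ^ Suc k))"
    by (simp add: fun_eq_iff theta_partial_prod_def prod_dividef prod_power_distrib del: power_Suc)
  moreover have "(\<lambda>n. (\<Prod>k<n. 1 - q ^ Suc k)\<^sup>2 / (\<Prod>k<n. 1 - (q\<^sup>2) ^ Suc k)) \<longlonglongrightarrow> (euler_prod q)\<^sup>2 / euler_prod (q\<^sup>2)"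
    using q euler_prod_pos[OF q2] q2 by (intro tendsto_intros euler_prod_LIMSEQ) auto
  ultimately show "theta_partial_prod q \<longlonglongrightarrow> (euler_prod q)\<^sup>2 / euler_prod (q\<^sup>2)"
    by (simp only:)
qed

lemma theta_neg_pos:
  assumes "0 < q" "q < 1" shows "theta (- q) > 0"
  unfolding theta_neg_product[OF assms]
  using assms by (intro divide_pos_pos zero_less_power euler_prod_pos) (auto simp: abs_square_less_1)

lemma theta_ge_1:
  assumes "0 \<le> q" "q < 1" shows "theta q \<ge> 1"
proof -
  have "(\<lambda>k. (if k = 0 then 1 else 2) * q ^ k\<^sup>2) sums theta q"
    using assms by (intro has_sum_imp_sums theta_has_sum_square) auto
  from sum_le_suminf[OF sums_summable[OF this], of "{0}"] sums_unique[OF this] assms show ?thesis by simp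
qed

lemma theta_pos: "\<bar>q\<bar> < 1 \<Longrightarrow> theta q > 0"
  using theta_ge_1[of q] theta_neg_pos[of "- q"] by (cases "q \<ge> 0") auto

lemma theta_neg_less_1:
  assumes q: "0 < q" "q < 1" shows "theta (- q) < 1"
proof -
  have "theta (- q) \<le> theta_partial_prod q 1"
    by (rule LIMSEQ_le_const2[OF theta_neg_LIMSEQ[OF q]])
       (auto intro!: exI[of _ 1] theta_partial_prod_antimono q)
  also have "\<dots> < 1" using q by (simp add: theta_partial_prod_def)
  finally show ?thesis .
qed

text \<open>No second finite identity is needed: the multiplicative duplication formula expresses
  \<open>theta q\<close> through the alternating series at \<open>q\<close> and
  \<open>q\<^sup>2\<close>.\<close>

lemma theta_product:
  assumes q: "0 < q" "q < 1"
  shows "theta q = euler_prod (q\<^sup>2) ^ 5 / (euler_prod (q ^ 4) ^ 2 * (euler_prod q)\<^sup>2)"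
proof -
  have q2: "0 < q\<^sup>2" "q\<^sup>2 < 1" using q by (auto simp: power_less_one_iff)
  have e: "(q\<^sup>2)\<^sup>2 = q ^ 4" by simp
  have pos: "euler_prod q > 0" "euler_prod (q\<^sup>2) > 0" "euler_prod (q ^ 4) > 0"
    using q q2 by (auto intro!: euler_prod_pos simp: power_less_one_iff)
  have "theta q * theta (- q) = (theta (- (q\<^sup>2)))\<^sup>2" using q by (intro theta_duplication_mult) auto
  hence "theta q * ((euler_prod q)\<^sup>2 / euler_prod (q\<^sup>2)) = ((euler_prod (q\<^sup>2))\<^sup>2 / euler_prod (q ^ 4))\<^sup>2"
    unfolding theta_neg_product[OF q] theta_neg_product[OF q2] e .
  thus ?thesis using pos by (simp add: field_simps eval_nat_numeral)
qed

text \<open>Jacobi's fourth-power identity, taken as the definition of \<open>\<theta>\<^sub>2\<^sup>4\<close>: here \<open>theta q\<close> is \<open>\<theta>\<^sub>3\<close> and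
  \<open>theta (- q)\<close> is \<open>\<theta>\<^sub>4\<close>.\<close>
definition theta2_4 :: "real \<Rightarrow> real" where "theta2_4 q = theta q ^ 4 - theta (- q) ^ 4"

lemma theta2_4_pos:
  assumes "0 < q" "q < 1" shows "theta2_4 q > 0"
proof -
  have "theta (- q) ^ 4 < 1 ^ 4"
    using theta_neg_less_1[OF assms] theta_neg_pos[OF assms] by (intro power_strict_mono) auto
  also have "1 ^ 4 \<le> theta q ^ 4" using theta_ge_1[of q] assms by (intro power_mono) auto
  finally show ?thesis by (simp add: theta2_4_def)
qed

lemma theta2_4_square:
  assumes "\<bar>q\<bar> < 1"
  shows "theta2_4 (q\<^sup>2) = ((theta q)\<^sup>2 - (theta (- q))\<^sup>2)\<^sup>2 / 4"
proof -
  have "theta2_4 (q\<^sup>2) = ((theta (q\<^sup>2))\<^sup>2)\<^sup>2 - ((theta (- (q\<^sup>2)))\<^sup>2)\<^sup>2"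
    by (simp add: theta2_4_def)
  also have "\<dots> = (((theta q)\<^sup>2 + (theta (- q))\<^sup>2) / 2)\<^sup>2 - (theta q * theta (- q))\<^sup>2"
    using theta_duplication_add[OF assms] theta_duplication_mult[OF assms] by simp
  also have "\<dots> = ((theta q)\<^sup>2 - (theta (- q))\<^sup>2)\<^sup>2 / 4" by (simp add: power2_eq_square field_simps)
  finally show ?thesis .
qed

lemma theta2_4_eq_mult:
  assumes "\<bar>q\<bar> < 1"
  shows "(theta2_4 q)\<^sup>2 = 16 * theta2_4 (q\<^sup>2) * theta (q\<^sup>2) ^ 4"
proof -
  have "theta2_4 q = ((theta q)\<^sup>2 - (theta (- q))\<^sup>2) * ((theta q)\<^sup>2 + (theta (- q))\<^sup>2)"
    by (simp add: theta2_4_def power2_eq_square eval_nat_numeral algebra_simps)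
  also have "\<dots> = ((theta q)\<^sup>2 - (theta (- q))\<^sup>2) * (2 * (theta (q\<^sup>2))\<^sup>2)"
    using theta_duplication_add[OF assms] by simp
  finally show ?thesis unfolding theta2_4_square[OF assms] by (simp add: power_mult_distrib)
qed

section \<open>Functions invariant under squaring the nome, and limits at 0\<close>

lemma square_invariant_imp_const:
  fixes f :: "real \<Rightarrow> real"
  assumes inv: "\<And>q. 0 < q \<Longrightarrow> q < 1 \<Longrightarrow> f (q\<^sup>2) = f q" and lim: "(f \<longlongrightarrow> L) (at_right 0)" and q: "0 < q" "q < 1"
  shows "f q = L"
proof -
  have r: "0 < q ^ (2 ^ n)" "q ^ (2 ^ n) < 1" for n :: nat using q by (auto simp: power_less_one_iff)
  have "f (q ^ (2 ^ n)) = f q" for n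
  proof (induction n)
    case (Suc n)
    have "q ^ (2 ^ Suc n) = (q ^ (2 ^ n))\<^sup>2" by (simp add: power_mult[symmetric] mult.commute)
    thus ?case using Suc inv[OF r] by simp
  qed simp
  moreover have "(\<lambda>n. f (q ^ (2 ^ n))) \<longlonglongrightarrow> L"
  proof (rule filterlim_compose[OF lim])
    have "(\<lambda>n. q ^ (2 ^ n)) \<longlonglongrightarrow> 0"
      using LIMSEQ_subseq_LIMSEQ[OF LIMSEQ_power_zero[of q], of "\<lambda>n. 2 ^ n"] q
      by (simp add: o_def strict_mono_def)
    thus "filterlim (\<lambda>n. q ^ (2 ^ n)) (at_right 0) sequentially"
      using r by (intro tendsto_imp_filterlim_at_right) auto
  qed
  ultimately show ?thesis by (simp add: LIMSEQ_const_iff)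
qed

lemma theta_comp_has_derivative [derivative_intros]:
  "(g has_real_derivative g') (at x within A) \<Longrightarrow> \<bar>g x\<bar> < 1 \<Longrightarrow>
   ((\<lambda>x. theta (g x)) has_real_derivative theta' (g x) * g') (at x within A)"
  by (rule DERIV_chain2[where f = theta and g = g, OF theta_has_derivative])

lemma at_right_0_tendsto:
  fixes f :: "real \<Rightarrow> real"
  assumes "(f has_real_derivative D) (at 0)"
  shows "(f \<longlongrightarrow> f 0) (at_right 0)" "((\<lambda>q. f (- q)) \<longlongrightarrow> f 0) (at_right 0)"
proof -
  have "isCont f 0" using assms by (rule DERIV_isCont)
  thus "(f \<longlongrightarrow> f 0) (at_right 0)" by (simp add: continuous_within filterlim_at_split)
  have "isCont (\<lambda>q. f (- q)) 0" by (rule isCont_o2[of _ uminus]) (use \<open>isCont f 0\<close> in auto)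
  thus "((\<lambda>q. f (- q)) \<longlongrightarrow> f 0) (at_right 0)" by (simp add: continuous_within filterlim_at_split)
qed

lemma theta_0: "theta 0 = 1" "theta' 0 = 2"
  by (auto simp: theta_def theta'_def eval_fps_at_0 theta_fps_def intro: exI[of _ 1])

lemma tendsto_at_right_0_theta:
  "(theta \<longlongrightarrow> 1) (at_right 0)" "((\<lambda>q. theta (- q)) \<longlongrightarrow> 1) (at_right 0)"
  "((\<lambda>q. theta2_4 q / q) \<longlongrightarrow> 16) (at_right 0)"
proof -
  show "(theta \<longlongrightarrow> 1) (at_right 0)" "((\<lambda>q. theta (- q)) \<longlongrightarrow> 1) (at_right 0)"
    using at_right_0_tendsto[OF theta_has_derivative[of 0]] by (simp_all add: theta_0)
  have "(theta2_4 has_real_derivative 16) (at 0)"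
    unfolding theta2_4_def[abs_def] by (auto intro!: derivative_eq_intros simp: theta_0)
  hence "((\<lambda>q. theta2_4 q / q) \<longlongrightarrow> 16) (at 0)" by (simp add: DERIV_def theta2_4_def)
  thus "((\<lambda>q. theta2_4 q / q) \<longlongrightarrow> 16) (at_right 0)" by (simp only: filterlim_at_split)
qed

lemma prod_one_minus_ge:
  assumes "\<And>k :: nat. 0 \<le> a k" "\<And>k. a k \<le> (1::real)"
  shows "1 - (\<Sum>k<n. a k) \<le> (\<Prod>k<n. 1 - a k)"
proof (induction n)
  case (Suc n)
  have "(\<Prod>k<n. 1 - a k) \<le> 1" using assms by (intro prod_le_1) auto
  hence "(\<Prod>k<n. 1 - a k) * a n \<le> a n" using assms(1)[of n] by (simp add: mult_left_le_one_le prod_nonneg assms)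
  thus ?case using Suc by (simp add: algebra_simps)
qed simp

lemma euler_prod_tendsto_1: "(euler_prod \<longlongrightarrow> 1) (at_right 0)"
proof (rule tendsto_sandwich)
  have "1 - q / (1 - q) \<le> euler_prod q" if "0 < q" "q < 1" for q
  proof (rule LIMSEQ_le_const[OF euler_prod_LIMSEQ], goal_cases)
    case 2
    show ?case
    proof (intro exI allI impI)
      fix n
      have "(\<Sum>k<n. q ^ Suc k) \<le> q / (1 - q)"
        using that sum_le_suminf[of "\<lambda>k. q * q ^ k" "{..<n}"] suminf_mult[of "\<lambda>k. q ^ k" q]
        by (auto simp: suminf_geometric summable_geometric summable_mult)
      moreover have "1 - (\<Sum>k<n. q ^ Suc k) \<le> (\<Prod>k<n. 1 - q ^ Suc k)"
        using that power_Suc_less_one_abs[of q] less_imp_le by (intro prod_one_minus_ge) (auto simp del: power_Suc)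
      ultimately show "1 - q / (1 - q) \<le> (\<Prod>k<n. 1 - q ^ Suc k)" by linarith
    qed
  qed (use that in auto)
  thus "\<forall>\<^sub>F q in at_right 0. 1 - q / (1 - q) \<le> euler_prod q"
    using eventually_at_right_real[of 0 1] by (auto elim: eventually_mono)
  have "euler_prod q \<le> 1" if "0 < q" "q < 1" for q
  proof (rule LIMSEQ_le_const2[OF euler_prod_LIMSEQ])
    show "\<exists>N. \<forall>n\<ge>N. (\<Prod>k<n. 1 - q ^ Suc k) \<le> 1"
      using that power_Suc_less_one_abs[of q] less_imp_le by (intro exI allI impI prod_le_1) (auto simp del: power_Suc)
  qed (use that in auto)
  thus "\<forall>\<^sub>F q in at_right 0. euler_prod q \<le> 1"
    using eventually_at_right_real[of 0 1] by (auto elim: eventually_mono)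
  show "((\<lambda>q::real. 1 - q / (1 - q)) \<longlongrightarrow> 1) (at_right 0)" by real_asymp
qed auto

text \<open>The quotient \<open>u\<close> of the two sides satisfies
  \<open>u (q\<^sup>2) = (u q)\<^sup>2\<close>, so the invariant function is
  \<open>ln (u q) / ln q\<close>. Its limit is 0 because \<open>u\<close> tends to 1 while
  \<open>ln q\<close> is unbounded.\<close>

lemma theta2_4_product:
  assumes q: "0 < q" "q < 1"
  shows "theta2_4 q = 16 * q * euler_prod (q ^ 4) ^ 8 / euler_prod (q\<^sup>2) ^ 4"
proof -
  define u where "u = (\<lambda>q. theta2_4 q * euler_prod (q\<^sup>2) ^ 4 / (16 * q * euler_prod (q ^ 4) ^ 8))"
  have pos: "euler_prod (q ^ k) > 0" if "0 < q" "q < 1" "k > 0" for q k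
    using that by (intro euler_prod_pos) (auto simp: power_less_one_iff)
  have u_pos: "u q > 0" if "0 < q" "q < 1" for q
    unfolding u_def using that pos[of q 2] pos[of q 4] theta2_4_pos[of q] by (intro divide_pos_pos mult_pos_pos) auto
  have "ln (u (q\<^sup>2)) / ln (q\<^sup>2) = ln (u q) / ln q" if "0 < q" "q < 1" for q
  proof -
    have q2: "0 < q\<^sup>2" "q\<^sup>2 < 1" using that by (auto simp: power_less_one_iff)
    have "(u q)\<^sup>2 = 16 * theta2_4 (q\<^sup>2) * theta (q\<^sup>2) ^ 4 * euler_prod (q\<^sup>2) ^ 8 / (256 * q\<^sup>2 * euler_prod (q ^ 4) ^ 16)"
      using theta2_4_eq_mult[of q] that by (simp add: u_def power_divide power_mult_distrib flip: power_mult)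
    also have "theta (q\<^sup>2) ^ 4 = euler_prod (q ^ 4) ^ 20 / (euler_prod (q ^ 8) ^ 8 * euler_prod (q\<^sup>2) ^ 8)"
      unfolding theta_product[OF q2] by (simp add: power_divide power_mult_distrib flip: power_mult)
    also have "16 * theta2_4 (q\<^sup>2) * (euler_prod (q ^ 4) ^ 20 / (euler_prod (q ^ 8) ^ 8 * euler_prod (q\<^sup>2) ^ 8))
        * euler_prod (q\<^sup>2) ^ 8 / (256 * q\<^sup>2 * euler_prod (q ^ 4) ^ 16) = u (q\<^sup>2)"
      using pos[OF that, of 2] pos[OF that, of 4] pos[OF that, of 8] that
      by (simp add: u_def field_simps flip: power_mult power_add)
    finally have "u (q\<^sup>2) = (u q)\<^sup>2" ..
    thus ?thesis using u_pos[OF that] that by (simp add: ln_realpow)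
  qed
  moreover have "((\<lambda>q. ln (u q) / ln q) \<longlongrightarrow> 0) (at_right 0)"
  proof -
    have p: "((\<lambda>q::real. q ^ k) \<longlongrightarrow> 0) (at_right 0)" "\<forall>\<^sub>F q in at_right (0::real). q ^ k > 0" if "k > 0" for k
      using that eventually_at_right_real[of 0 1] by (auto intro!: tendsto_eq_intros elim: eventually_mono)
    have e: "((\<lambda>q::real. euler_prod (q ^ k)) \<longlongrightarrow> 1) (at_right 0)" if "k > 0" for k
      using p[OF that] by (intro filterlim_compose[OF euler_prod_tendsto_1] tendsto_imp_filterlim_at_right)
    have "((\<lambda>q. (theta2_4 q / q) * euler_prod (q ^ 2) ^ 4 / (16 * euler_prod (q ^ 4) ^ 8)) \<longlongrightarrow> 16 * 1 ^ 4 / (16 * 1 ^ 8)) (at_right 0)"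
      by (intro tendsto_intros tendsto_at_right_0_theta e) auto
    hence "(u \<longlongrightarrow> 1) (at_right 0)" by (simp add: u_def[abs_def] mult_ac)
    hence "((\<lambda>q. ln (u q)) \<longlongrightarrow> ln 1) (at_right 0)" by (intro tendsto_ln) auto
    hence "((\<lambda>q. ln (u q) * (1 / ln q)) \<longlongrightarrow> ln 1 * 0) (at_right 0)"
      by (intro tendsto_mult) (auto, real_asymp)
    thus ?thesis by simp
  qed
  ultimately have "ln (u q) / ln q = 0" by (rule square_invariant_imp_const[OF _ _ q])
  hence "u q = 1" using q u_pos[OF q] by simp
  thus ?thesis using q pos[OF q, of 4] pos[OF q, of 2] by (simp add: u_def field_simps)
qed

subsection \<open>Differential equations\<close>

text \<open>The logarithmic derivative of \<open>theta\<close> with respect to \<open>q d/dq\<close>.\<close>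
definition theta_log :: "real \<Rightarrow> real" where
  "theta_log q = q * theta' q / theta q"

definition theta_log' :: "real \<Rightarrow> real" where
  "theta_log' q = (theta' q + q * theta'' q) / theta q - q * (theta' q)\<^sup>2 / (theta q)\<^sup>2"

lemma theta_log_has_derivative:
  assumes "\<bar>q\<bar> < 1"
  shows "(theta_log has_real_derivative theta_log' q) (at q within A)"
  unfolding theta_log_def[abs_def] theta_log'_def
  using assms theta_pos[OF assms]
  by (auto intro!: derivative_eq_intros theta'_has_derivative) (simp add: field_simps power2_eq_square)

lemma theta_log_comp_has_derivative [derivative_intros]:
  "(g has_real_derivative g') (at x within A) \<Longrightarrow> \<bar>g x\<bar> < 1 \<Longrightarrow>
   ((\<lambda>x. theta_log (g x)) has_real_derivative theta_log' (g x) * g') (at x within A)"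
  by (rule DERIV_chain2[where f = theta_log and g = g, OF theta_log_has_derivative])

lemma theta'_eq: "\<bar>q\<bar> < 1 \<Longrightarrow> q * theta' q = theta q * theta_log q"
  using theta_pos[of q] by (simp add: theta_log_def)

lemma has_real_derivative_unique_on_interval:
  assumes "(f has_real_derivative A) (at q)" "(g has_real_derivative B) (at q)"
    "\<And>x. \<bar>x\<bar> < 1 \<Longrightarrow> f x = g x" "\<bar>q::real\<bar> < 1"
  shows "A = B"
proof -
  have "(g has_real_derivative A) (at q)"
    by (rule has_field_derivative_transform_within_open[OF assms(1), of "{-1<..<1}"]) (use assms(3,4) in auto)
  thus ?thesis using assms(2) by (rule DERIV_unique)
qed

lemma theta_log_add:
  assumes q: "\<bar>q\<bar> < 1"
  shows "(theta q)\<^sup>2 * theta_log q + (theta (- q))\<^sup>2 * theta_log (- q) =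
    2 * ((theta q)\<^sup>2 + (theta (- q))\<^sup>2) * theta_log (q\<^sup>2)"
proof -
  have q2: "\<bar>q\<^sup>2\<bar> < 1" using q by (simp add: abs_square_less_1)
  have "2 * theta q * theta' q - 2 * theta (- q) * theta' (- q) = 8 * q * theta (q\<^sup>2) * theta' (q\<^sup>2)"
    by (rule has_real_derivative_unique_on_interval[of "\<lambda>q. (theta q)\<^sup>2 + (theta (- q))\<^sup>2" _ q "\<lambda>q. 2 * (theta (q\<^sup>2))\<^sup>2"])
       (use q q2 in \<open>auto intro!: derivative_eq_intros theta_duplication_add\<close>)
  hence "q * (2 * theta q * theta' q - 2 * theta (- q) * theta' (- q)) = q * (8 * q * theta (q\<^sup>2) * theta' (q\<^sup>2))"
    by simp
  hence 1: "2 * theta q * (q * theta' q) + 2 * theta (- q) * (- q * theta' (- q)) = 8 * theta (q\<^sup>2) * (q\<^sup>2 * theta' (q\<^sup>2))"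
    by (simp add: algebra_simps power2_eq_square)
  have 2: "- q * theta' (- q) = theta (- q) * theta_log (- q)" using theta'_eq[of "- q"] q by simp
  have "2 * theta q * (theta q * theta_log q) + 2 * theta (- q) * (theta (- q) * theta_log (- q))
     = 8 * theta (q\<^sup>2) * (theta (q\<^sup>2) * theta_log (q\<^sup>2))"
    using 1 unfolding 2 theta'_eq[OF q] theta'_eq[OF q2] .
  hence "(theta q)\<^sup>2 * theta_log q + (theta (- q))\<^sup>2 * theta_log (- q) = 2 * (2 * (theta (q\<^sup>2))\<^sup>2) * theta_log (q\<^sup>2)"
    by (simp add: power2_eq_square algebra_simps)
  thus ?thesis using theta_duplication_add[OF q] by simp
qed

lemma theta_log_mult:
  assumes q: "\<bar>q\<bar> < 1"
  shows "theta_log q + theta_log (- q) = 4 * theta_log (- (q\<^sup>2))"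
proof -
  have q2: "\<bar>- (q\<^sup>2)\<bar> < 1" using q by (simp add: abs_square_less_1)
  have "theta' q * theta (- q) - theta q * theta' (- q) = - 4 * q * theta (- (q\<^sup>2)) * theta' (- (q\<^sup>2))"
    by (rule has_real_derivative_unique_on_interval[of "\<lambda>q. theta q * theta (- q)" _ q "\<lambda>q. (theta (- (q\<^sup>2)))\<^sup>2"])
       (use q q2 in \<open>auto intro!: derivative_eq_intros theta_duplication_mult simp: abs_square_less_1\<close>)
  hence "q * (theta' q * theta (- q) - theta q * theta' (- q)) = q * (- 4 * q * theta (- (q\<^sup>2)) * theta' (- (q\<^sup>2)))"
    by simp
  hence 1: "(q * theta' q) * theta (- q) + theta q * (- q * theta' (- q)) = 4 * theta (- (q\<^sup>2)) * (- (q\<^sup>2) * theta' (- (q\<^sup>2)))"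
    by (simp add: algebra_simps power2_eq_square)
  have 2: "- q * theta' (- q) = theta (- q) * theta_log (- q)" using theta'_eq[of "- q"] q by simp
  have "(theta q * theta_log q) * theta (- q) + theta q * (theta (- q) * theta_log (- q))
     = 4 * theta (- (q\<^sup>2)) * (theta (- (q\<^sup>2)) * theta_log (- (q\<^sup>2)))"
    using 1 unfolding 2 theta'_eq[OF q] theta'_eq[OF q2] .
  hence "(theta q * theta (- q)) * (theta_log q + theta_log (- q)) = 4 * (theta (- (q\<^sup>2)))\<^sup>2 * theta_log (- (q\<^sup>2))"
    by (simp add: power2_eq_square algebra_simps)
  thus ?thesis using theta_duplication_mult[OF q] theta_pos[OF q2] by simp
qed

text \<open>The two differentiated duplication formulas show that the quotient of the two sides is
  invariant under squaring. Its limit comes from \<open>theta' 0 = 2\<close>, taken twice, against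
  \<open>theta2_4 q\<close> being asymptotic to \<open>16 * q\<close>.\<close>

lemma theta_log_diff:
  assumes q: "0 < q" "q < 1"
  shows "theta_log q - theta_log (- q) = theta2_4 q / 4"
proof -
  have "(theta_log (q\<^sup>2) - theta_log (- (q\<^sup>2))) / theta2_4 (q\<^sup>2) = (theta_log q - theta_log (- q)) / theta2_4 q"
    if "0 < q" "q < 1" for q
  proof -
    define x y where "x = (theta q)\<^sup>2" and "y = (theta (- q))\<^sup>2"
    have pos: "x > 0" "y > 0" using theta_pos[of q] theta_pos[of "- q"] that by (auto simp: x_def y_def)
    have c: "theta2_4 q = (x - y) * (x + y)" "theta2_4 (q\<^sup>2) = (x - y)\<^sup>2 / 4"
      using theta2_4_square[of q] that by (auto simp: x_def y_def theta2_4_def power2_eq_square eval_nat_numeral algebra_simps)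
    have xy: "x - y \<noteq> 0" using theta2_4_pos[OF that] unfolding c by auto
    have 1: "theta_log (q\<^sup>2) = (x * theta_log q + y * theta_log (- q)) / (2 * (x + y))"
      using theta_log_add[of q] that pos unfolding x_def[symmetric] y_def[symmetric]
      by (simp add: eq_divide_eq mult_ac)
    have 2: "theta_log (- (q\<^sup>2)) = (theta_log q + theta_log (- q)) / 4"
      using theta_log_mult[of q] that by simp
    show ?thesis unfolding c 1 2 using pos xy by (simp add: divide_simps) (simp add: algebra_simps power2_eq_square)
  qed
  moreover have "((\<lambda>q. (theta_log q - theta_log (- q)) / theta2_4 q) \<longlongrightarrow> (2 / 1 + 2 / 1) / 16) (at_right 0)"
  proof (rule Lim_transform_eventually)
    show "((\<lambda>q. (theta' q / theta q + theta' (- q) / theta (- q)) / (theta2_4 q / q)) \<longlongrightarrow> (2 / 1 + 2 / 1) / 16) (at_right 0)"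
      using at_right_0_tendsto[OF theta_has_derivative] at_right_0_tendsto[OF theta'_has_derivative]
      by (intro tendsto_intros tendsto_at_right_0_theta) (auto simp: theta_0)
    show "\<forall>\<^sub>F q in at_right 0. (theta' q / theta q + theta' (- q) / theta (- q)) / (theta2_4 q / q) =
       (theta_log q - theta_log (- q)) / theta2_4 q"
      using eventually_at_right_less[of 0] by eventually_elim (auto simp: theta_log_def divide_simps algebra_simps)
  qed
  ultimately have "(theta_log q - theta_log (- q)) / theta2_4 q = (2 / 1 + 2 / 1) / 16"
    by (rule square_invariant_imp_const[OF _ _ q])
  thus ?thesis using theta2_4_pos[OF q] by (simp add: field_simps)
qed

lemma theta_log_square:
  assumes q: "0 < q" "q < 1"
  shows "theta_log (q\<^sup>2) = theta_log q / 2 - (theta (- q))\<^sup>2 * ((theta q)\<^sup>2 - (theta (- q))\<^sup>2) / 8"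
proof -
  define x y where "x = (theta q)\<^sup>2" and "y = (theta (- q))\<^sup>2"
  have pos: "x > 0" "y > 0" using theta_pos[of q] theta_pos[of "- q"] q by (auto simp: x_def y_def)
  have c: "theta2_4 q = (x - y) * (x + y)"
    by (auto simp: x_def y_def theta2_4_def power2_eq_square eval_nat_numeral algebra_simps)
  have "x * theta_log q + y * (theta_log q - (x - y) * (x + y) / 4) = 2 * (x + y) * theta_log (q\<^sup>2)"
  proof -
    have "theta_log (- q) = theta_log q - (x - y) * (x + y) / 4" using theta_log_diff[OF q] unfolding c by simp
    thus ?thesis using theta_log_add[of q] q unfolding x_def[symmetric] y_def[symmetric] by simp
  qed
  hence "(x + y) * (theta_log (q\<^sup>2) - (theta_log q / 2 - y * (x - y) / 8)) = 0" by (simp add: field_simps)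
  thus ?thesis using pos unfolding x_def[symmetric] y_def[symmetric] by simp
qed

text \<open>The defect \<open>\<Phi>\<close> of the equation satisfies
  \<open>4 * \<Phi> (q\<^sup>2) = \<Phi> q\<close>, the scaling of weight 4, so
  \<open>\<Phi> q * (ln q)\<^sup>2\<close> is invariant. It tends to 0 since \<open>\<Phi>\<close>
  is of order \<open>q\<close>.\<close>

lemma theta_log_ode:
  assumes q: "0 < q" "q < 1"
  shows "q * theta_log' q = 2 * (theta_log q)\<^sup>2 + theta (- q) ^ 4 * theta2_4 q / 8"
proof -
  define \<Phi> where "\<Phi> = (\<lambda>q. q * theta_log' q - 2 * (theta_log q)\<^sup>2 - theta (- q) ^ 4 * theta2_4 q / 8)"
  have "4 * \<Phi> (q\<^sup>2) = \<Phi> q" if q: "0 < q" "q < 1" for q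
  proof -
    define x y w where "x = (theta q)\<^sup>2" and "y = (theta (- q))\<^sup>2" and "w = theta_log q"
    have c: "theta2_4 q = (x - y) * (x + y)" "theta2_4 (q\<^sup>2) = (x - y)\<^sup>2 / 4"
      using theta2_4_square[of q] that by (auto simp: x_def y_def theta2_4_def power2_eq_square eval_nat_numeral algebra_simps)
    have q2: "0 < q\<^sup>2" "q\<^sup>2 < 1" using q by (auto simp: power_less_one_iff)
    \<comment> \<open>Both sides are the derivative of \<open>theta_log (q\<^sup>2)\<close>: by the
      chain rule, and by differentiating the right-hand side of
      \<open>theta_log_square\<close>.\<close>
    have "theta_log' (q\<^sup>2) * (2 * q) = theta_log' q / 2 -
       ((2 * theta (- q) * (- theta' (- q))) * ((theta q)\<^sup>2 - (theta (- q))\<^sup>2)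
        + (theta (- q))\<^sup>2 * (2 * theta q * theta' q - 2 * theta (- q) * (- theta' (- q)))) / 8" (is "?A = ?B")
    proof (rule DERIV_unique)
      show "((\<lambda>q. theta_log (q\<^sup>2)) has_real_derivative ?A) (at q)"
        using q q2 by (auto intro!: derivative_eq_intros)
      have "((\<lambda>q. theta_log q / 2 - (theta (- q))\<^sup>2 * ((theta q)\<^sup>2 - (theta (- q))\<^sup>2) / 8) has_real_derivative ?B) (at q)"
        using q by (auto intro!: derivative_eq_intros theta_log_has_derivative theta_has_derivative simp: field_simps power2_eq_square)
      thus "((\<lambda>q. theta_log (q\<^sup>2)) has_real_derivative ?B) (at q)"
        by (rule has_field_derivative_transform_within_open[of _ _ _ "{0<..<1}"]) (use q theta_log_square in auto)
    qed
    hence "q * (theta_log' (q\<^sup>2) * (2 * q)) = q * ?B" by simp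
    hence 0: "2 * (q\<^sup>2 * theta_log' (q\<^sup>2)) = q * theta_log' q / 2 -
       ((2 * theta (- q) * (- q * theta' (- q))) * (x - y)
        + y * (2 * theta q * (q * theta' q) - 2 * theta (- q) * (- q * theta' (- q)))) / 8"
      unfolding x_def y_def by (simp add: power2_eq_square algebra_simps)
    have r1: "- q * theta' (- q) = theta (- q) * (w - (x - y) * (x + y) / 4)"
      using theta'_eq[of "- q"] theta_log_diff[OF q] q by (simp add: c w_def)
    have r2: "q * theta' q = theta q * w" using theta'_eq[of q] q by (simp add: w_def)
    have 1: "2 * (q\<^sup>2 * theta_log' (q\<^sup>2)) = q * theta_log' q / 2 -
       ((2 * theta (- q) * (theta (- q) * (w - (x - y) * (x + y) / 4))) * (x - y)
        + y * (2 * theta q * (theta q * w) - 2 * theta (- q) * (theta (- q) * (w - (x - y) * (x + y) / 4)))) / 8"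
      using 0 unfolding r1 r2 .
    have 2: "2 * (q\<^sup>2 * theta_log' (q\<^sup>2)) = q * theta_log' q / 2 -
       (2 * y * (w - (x - y) * (x + y) / 4) * (x - y)
        + y * (2 * x * w - 2 * y * (w - (x - y) * (x + y) / 4))) / 8"
      using 1 by (simp add: x_def y_def power2_eq_square mult_ac)
    have 3: "theta (- (q\<^sup>2)) ^ 4 = x * y"
    proof -
      have "theta (- (q\<^sup>2)) ^ 4 = ((theta (- (q\<^sup>2)))\<^sup>2)\<^sup>2" by simp
      also have "\<dots> = x * y" using theta_duplication_mult[of q] q by (simp add: x_def y_def power_mult_distrib[symmetric])
      finally show ?thesis .
    qed
    have 4: "theta (- q) ^ 4 = y\<^sup>2" by (simp add: y_def)
    have 5: "theta_log (q\<^sup>2) = w / 2 - y * (x - y) / 8"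
      using theta_log_square[OF q] by (simp add: x_def y_def w_def)
    have "4 * \<Phi> (q\<^sup>2) = 2 * (2 * (q\<^sup>2 * theta_log' (q\<^sup>2))) - 8 * (theta_log (q\<^sup>2))\<^sup>2 - x * y * theta2_4 (q\<^sup>2) / 2"
      by (simp add: \<Phi>_def 3)
    also have "\<dots> = \<Phi> q"
      unfolding 2 \<Phi>_def 4 5 c w_def[symmetric] by (simp add: power2_eq_square field_simps)
    finally show ?thesis .
  qed
  hence "\<Phi> (q\<^sup>2) * (ln (q\<^sup>2))\<^sup>2 = \<Phi> q * (ln q)\<^sup>2" if "0 < q" "q < 1" for q
  proof -
    have "\<Phi> (q\<^sup>2) * (ln (q\<^sup>2))\<^sup>2 = (4 * \<Phi> (q\<^sup>2)) * (ln q)\<^sup>2"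
      using that by (simp add: ln_realpow power_mult_distrib)
    thus ?thesis using \<open>\<And>q. 0 < q \<Longrightarrow> q < 1 \<Longrightarrow> 4 * \<Phi> (q\<^sup>2) = \<Phi> q\<close>[OF that] by simp
  qed
  moreover have "((\<lambda>q. \<Phi> q * (ln q)\<^sup>2) \<longlongrightarrow> 0) (at_right 0)"
  proof (rule Lim_transform_eventually)
    \<comment> \<open>\<open>\<Psi>\<close> is \<open>\<Phi>\<close> divided by \<open>q\<close>.
      The value of its limit at 0 is irrelevant, since \<open>q * (ln q)\<^sup>2\<close> tends to
      0.\<close>
    define \<Psi> where "\<Psi> = (\<lambda>q. theta_log' q - 2 * q * (theta' q / theta q)\<^sup>2 - theta (- q) ^ 4 * (theta2_4 q / q) / 8)"
    have "isCont theta_log' 0"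
    proof -
      have "isCont theta'' 0"
        unfolding theta''_def
        by (rule continuous_eval_fps, rule less_le_trans[OF theta_radius'[of 0] fps_conv_radius_deriv]) auto
      moreover have "isCont theta 0" "isCont theta' 0"
        using theta_has_derivative[of 0 UNIV] theta'_has_derivative[of 0 UNIV] DERIV_isCont by auto
      ultimately show ?thesis unfolding theta_log'_def[abs_def] by (intro continuous_intros) (auto simp: theta_0)
    qed
    hence "(theta_log' \<longlongrightarrow> theta_log' 0) (at_right 0)" by (simp add: continuous_within filterlim_at_split)
    hence "(\<Psi> \<longlongrightarrow> theta_log' 0 - 2 * 0 * (theta' 0 / theta 0)\<^sup>2 - 1 ^ 4 * 16 / 8) (at_right 0)"
      unfolding \<Psi>_def using at_right_0_tendsto[OF theta_has_derivative] at_right_0_tendsto[OF theta'_has_derivative]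
      by (intro tendsto_intros tendsto_at_right_0_theta) (auto simp: theta_0)
    moreover have "((\<lambda>q::real. q * (ln q)\<^sup>2) \<longlongrightarrow> 0) (at_right 0)" by real_asymp
    ultimately have "((\<lambda>q. \<Psi> q * (q * (ln q)\<^sup>2)) \<longlongrightarrow> (theta_log' 0 - 2 * 0 * (theta' 0 / theta 0)\<^sup>2 - 1 ^ 4 * 16 / 8) * 0) (at_right 0)"
      by (rule tendsto_mult)
    thus "((\<lambda>q. \<Psi> q * (q * (ln q)\<^sup>2)) \<longlongrightarrow> 0) (at_right 0)" by simp
    show "\<forall>\<^sub>F q in at_right 0. \<Psi> q * (q * (ln q)\<^sup>2) = \<Phi> q * (ln q)\<^sup>2"
      using eventually_at_right_less[of 0]
      by eventually_elim (auto simp: \<Psi>_def \<Phi>_def theta_log_def power2_eq_square algebra_simps)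
  qed
  ultimately have "\<Phi> q * (ln q)\<^sup>2 = 0" by (rule square_invariant_imp_const[OF _ _ q])
  thus ?thesis using q by (simp add: \<Phi>_def)
qed

subsection \<open>Complete elliptic integrals\<close>

text \<open>This is pi / (2 M(a, b)) with M the arithmetic-geometric mean; in particular
  \<open>ell 1 k'\<close> is the complete integral K(k) for complementary k and k'. The form on the
  half line makes the mean step and the scaling plain substitutions.\<close>

definition ell :: "real \<Rightarrow> real \<Rightarrow> real" where
  "ell a b = (LBINT x=0..\<infinity>. 1 / sqrt ((x\<^sup>2 + a\<^sup>2) * (x\<^sup>2 + b\<^sup>2)))"

lemma ell_commute: "ell a b = ell b a"
  by (simp add: ell_def mult.commute)

text \<open>The integral with both parameters equal to \<open>m\<close>, which bounds
  \<open>ell\<close> from both sides.\<close>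

lemma arctan_integral:
  assumes m: "m > (0::real)"
  shows "set_integrable lborel {0<..} (\<lambda>x. 1 / (x\<^sup>2 + m\<^sup>2))"
    "(LBINT x:{0<..}. 1 / (x\<^sup>2 + m\<^sup>2)) = pi / (2 * m)"
proof -
  have pos: "x\<^sup>2 + m\<^sup>2 > 0" for x using m by (intro add_nonneg_pos) auto
  have d: "((\<lambda>x. arctan (x / m) / m) has_real_derivative 1 / (x\<^sup>2 + m\<^sup>2)) (at x)" for x
  proof -
    have "1 + (x / m)\<^sup>2 = (x\<^sup>2 + m\<^sup>2) / m\<^sup>2" using m by (simp add: power_divide add_divide_distrib)
    hence "inverse (1 + (x / m)\<^sup>2) * (1 / m) / m = 1 / (x\<^sup>2 + m\<^sup>2)" using m by (simp add: power2_eq_square)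
    moreover have "((\<lambda>x. arctan (x / m) / m) has_real_derivative inverse (1 + (x / m)\<^sup>2) * (1 / m) / m) (at x)"
      by (intro DERIV_cdivide DERIV_chain2[OF DERIV_arctan] DERIV_ident)
    ultimately show ?thesis by simp
  qed
  have lim0: "(((\<lambda>x. arctan (x / m) / m) \<circ> real_of_ereal) \<longlongrightarrow> 0) (at_right 0)"
  proof -
    have "((\<lambda>x. arctan (x / m) / m) \<longlongrightarrow> arctan (0 / m) / m) (at_right 0)"
      by (intro tendsto_intros) (use m in auto)
    thus ?thesis unfolding zero_ereal_def by (simp add: ereal_tendsto_simps)
  qed
  have lim1: "(((\<lambda>x. arctan (x / m) / m) \<circ> real_of_ereal) \<longlongrightarrow> (pi / 2) / m) (at_left \<infinity>)"
  proof -
    have "filterlim (\<lambda>x::real. x / m) at_top at_top" using m by real_asymp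
    from filterlim_compose[OF tendsto_arctan_at_top this]
    have "((\<lambda>x. arctan (x / m) / m) \<longlongrightarrow> (pi / 2) / m) at_top"
      by (intro tendsto_intros) (use m in auto)
    thus ?thesis by (simp add: ereal_tendsto_simps)
  qed
  note * = interval_integral_FTC_nonneg[of 0 \<infinity> "\<lambda>x. arctan (x / m) / m" "\<lambda>x. 1 / (x\<^sup>2 + m\<^sup>2)", OF _ d _ _ lim0 lim1]
  have c: "isCont (\<lambda>x. 1 / (x\<^sup>2 + m\<^sup>2)) x" for x
    using pos[of x] by (intro continuous_intros) auto
  have e: "einterval 0 \<infinity> = {0<..}" by (auto simp: einterval_def zero_ereal_def)
  show "set_integrable lborel {0<..} (\<lambda>x. 1 / (x\<^sup>2 + m\<^sup>2))"
    using * c pos less_imp_le unfolding e by (auto simp: less_imp_le)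
  have "(LBINT x=0..\<infinity>. 1 / (x\<^sup>2 + m\<^sup>2)) = (pi / 2) / m - 0"
    using * c pos less_imp_le by (auto simp: less_imp_le)
  thus "(LBINT x:{0<..}. 1 / (x\<^sup>2 + m\<^sup>2)) = pi / (2 * m)"
    by (simp add: interval_lebesgue_integral_def e)
qed

lemma ell_altdef: "ell a b = (LBINT x:{0<..}. 1 / sqrt ((x\<^sup>2 + a\<^sup>2) * (x\<^sup>2 + b\<^sup>2)))"
proof -
  have e: "einterval 0 \<infinity> = {0<..}" by (auto simp: einterval_def zero_ereal_def)
  show ?thesis by (simp add: ell_def interval_lebesgue_integral_def e)
qed

lemma ell_integrand_le:
  assumes "0 < m" "m \<le> a" "m \<le> b"
  shows "1 / sqrt ((x\<^sup>2 + a\<^sup>2) * (x\<^sup>2 + b\<^sup>2)) \<le> 1 / (x\<^sup>2 + m\<^sup>2)"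
proof -
  have "(x\<^sup>2 + m\<^sup>2)\<^sup>2 \<le> (x\<^sup>2 + a\<^sup>2) * (x\<^sup>2 + b\<^sup>2)"
    unfolding power2_eq_square[of "x\<^sup>2 + m\<^sup>2"] using assms by (intro mult_mono add_mono order_refl power_mono) auto
  moreover have "x\<^sup>2 + m\<^sup>2 > 0" using assms by (intro add_nonneg_pos) auto
  ultimately show ?thesis by (intro divide_left_mono real_le_rsqrt mult_pos_pos) (auto intro!: mult_pos_pos add_nonneg_pos, use assms in auto)
qed

lemma ell_integrand_ge:
  assumes "0 < a" "0 < b" "a \<le> m" "b \<le> m"
  shows "1 / sqrt ((x\<^sup>2 + a\<^sup>2) * (x\<^sup>2 + b\<^sup>2)) \<ge> 1 / (x\<^sup>2 + m\<^sup>2)"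
proof -
  have "(x\<^sup>2 + m\<^sup>2)\<^sup>2 \<ge> (x\<^sup>2 + a\<^sup>2) * (x\<^sup>2 + b\<^sup>2)"
    unfolding power2_eq_square[of "x\<^sup>2 + m\<^sup>2"] using assms by (intro mult_mono add_mono order_refl power_mono) auto
  moreover have "x\<^sup>2 + m\<^sup>2 > 0" "(x\<^sup>2 + a\<^sup>2) * (x\<^sup>2 + b\<^sup>2) > 0" using assms by (auto intro!: mult_pos_pos add_nonneg_pos)
  ultimately show ?thesis by (intro divide_left_mono real_le_lsqrt mult_pos_pos) auto
qed

lemma ell_integrable:
  assumes "0 < a" "0 < b"
  shows "set_integrable lborel {0<..} (\<lambda>x. 1 / sqrt ((x\<^sup>2 + a\<^sup>2) * (x\<^sup>2 + b\<^sup>2)))"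
proof (rule set_integrable_bound)
  show "set_integrable lborel {0<..} (\<lambda>x. 1 / (x\<^sup>2 + (min a b)\<^sup>2))"
    using assms by (intro arctan_integral) auto
  show "set_borel_measurable lborel {0<..} (\<lambda>x. 1 / sqrt ((x\<^sup>2 + a\<^sup>2) * (x\<^sup>2 + b\<^sup>2)))"
    unfolding set_borel_measurable_def by measurable
  show "AE x in lborel. x \<in> {0<..} \<longrightarrow> norm (1 / sqrt ((x\<^sup>2 + a\<^sup>2) * (x\<^sup>2 + b\<^sup>2))) \<le> norm (1 / (x\<^sup>2 + (min a b)\<^sup>2))"
  proof (intro AE_I2 impI)
    fix x :: real
    have "0 \<le> 1 / sqrt ((x\<^sup>2 + a\<^sup>2) * (x\<^sup>2 + b\<^sup>2))" by (intro divide_nonneg_nonneg real_sqrt_ge_zero mult_nonneg_nonneg) auto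
    moreover have "1 / sqrt ((x\<^sup>2 + a\<^sup>2) * (x\<^sup>2 + b\<^sup>2)) \<le> 1 / (x\<^sup>2 + (min a b)\<^sup>2)"
      using assms by (intro ell_integrand_le) auto
    ultimately show "norm (1 / sqrt ((x\<^sup>2 + a\<^sup>2) * (x\<^sup>2 + b\<^sup>2))) \<le> norm (1 / (x\<^sup>2 + (min a b)\<^sup>2))"
      by (simp only: real_norm_def abs_of_nonneg abs_ge_self order_trans[OF _ abs_ge_self])
  qed
qed

lemma ell_bounds:
  assumes "0 < m" "m \<le> a" "m \<le> b" "a \<le> M" "b \<le> M"
  shows "pi / (2 * M) \<le> ell a b" "ell a b \<le> pi / (2 * m)"
proof -
  have "pi / (2 * M) = (LBINT x:{0<..}. 1 / (x\<^sup>2 + M\<^sup>2))" using assms by (intro arctan_integral(2)[symmetric]) auto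
  also have "\<dots> \<le> ell a b"
    unfolding ell_altdef using assms by (intro set_integral_mono arctan_integral ell_integrable ell_integrand_ge) auto
  finally show "pi / (2 * M) \<le> ell a b" .
  have "ell a b \<le> (LBINT x:{0<..}. 1 / (x\<^sup>2 + m\<^sup>2))"
    unfolding ell_altdef using assms by (intro set_integral_mono arctan_integral ell_integrable ell_integrand_le) auto
  also have "\<dots> = pi / (2 * m)" using assms by (intro arctan_integral(2)) auto
  finally show "ell a b \<le> pi / (2 * m)" .
qed

lemma ell_pos: "0 < a \<Longrightarrow> 0 < b \<Longrightarrow> ell a b > 0"
  using ell_bounds(1)[of "min a b" a b "max a b"] by (intro less_le_trans[OF _ ell_bounds(1)[of "min a b" a b "max a b"]]) auto

text \<open>Gauss' substitution \<open>u = (x - a b / x) / 2\<close>.\<close>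
lemma ell_agm:
  assumes "0 < a" "0 < b"
  shows "ell ((a + b) / 2) (sqrt (a * b)) = ell a b"
proof -
  define f where "f = (\<lambda>u. 1 / sqrt ((u\<^sup>2 + ((a + b) / 2)\<^sup>2) * (u\<^sup>2 + (sqrt (a * b))\<^sup>2)))"
  define g where "g = (\<lambda>x. (x - a * b / x) / 2)"
  define g' where "g' = (\<lambda>x. (1 + a * b / x\<^sup>2) / 2)"
  have ab: "a * b > 0" using assms by simp
  \<comment> \<open>The map \<open>g\<close> sends the half line onto the whole line, where
    \<open>f\<close> is even. The factor 2 here cancels against the doubling by evenness.\<close>
  have fg: "f (g x) * g' x = 2 * (1 / sqrt ((x\<^sup>2 + a\<^sup>2) * (x\<^sup>2 + b\<^sup>2)))" if "x > 0" for x
  proof -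
    have 1: "(g x)\<^sup>2 + ((a + b) / 2)\<^sup>2 = (x\<^sup>2 + a\<^sup>2) * (x\<^sup>2 + b\<^sup>2) / (2 * x)\<^sup>2"
      using that by (simp add: g_def field_simps power2_eq_square)
    have 2: "(g x)\<^sup>2 + (sqrt (a * b))\<^sup>2 = (x * g' x)\<^sup>2"
      using that ab by (simp add: g_def g'_def field_simps power2_eq_square)
    have g': "g' x > 0" using ab that by (simp add: g'_def add_pos_pos)
    have S: "sqrt (((g x)\<^sup>2 + ((a + b) / 2)\<^sup>2) * ((g x)\<^sup>2 + (sqrt (a * b))\<^sup>2)) = sqrt ((x\<^sup>2 + a\<^sup>2) * (x\<^sup>2 + b\<^sup>2)) * g' x / 2"
      unfolding 1 2 using that g' by (simp add: real_sqrt_mult real_sqrt_divide abs_mult)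
    show ?thesis unfolding f_def S using g' by simp
  qed
  have f_cont: "isCont f u" for u
  proof -
    have "(u\<^sup>2 + ((a + b) / 2)\<^sup>2) * (u\<^sup>2 + (sqrt (a * b))\<^sup>2) > 0"
      using assms by (intro mult_pos_pos add_nonneg_pos) auto
    thus ?thesis unfolding f_def by (intro continuous_intros) auto
  qed
  have e: "einterval 0 \<infinity> = {0<..}" by (auto simp: einterval_def zero_ereal_def)
  have f_nonneg: "f u \<ge> 0" for u unfolding f_def by (intro divide_nonneg_nonneg real_sqrt_ge_zero mult_nonneg_nonneg) auto
  have int: "set_integrable lborel (einterval 0 \<infinity>) (\<lambda>x. f (g x) * g' x)"
  proof -
    have "set_integrable lborel {0<..} (\<lambda>x. 2 * (1 / sqrt ((x\<^sup>2 + a\<^sup>2) * (x\<^sup>2 + b\<^sup>2))))"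
      using assms by (intro set_integrable_mult_right ell_integrable) auto
    thus ?thesis unfolding e by (rule set_integrable_cong[THEN iffD1, rotated -1]) (use fg in auto)
  qed
  have lim0: "((ereal \<circ> g \<circ> real_of_ereal) \<longlongrightarrow> - \<infinity>) (at_right 0)"
  proof -
    have "filterlim g at_bot (at_right 0)" unfolding g_def using ab by real_asymp
    hence "filterlim (\<lambda>x. - g x) at_top (at_right 0)" by (simp add: filterlim_uminus_at_bot)
    hence "((\<lambda>x. - ereal (g x)) \<longlongrightarrow> \<infinity>) (at_right 0)" by (simp add: tendsto_PInfty_eq_at_top)
    hence "((ereal \<circ> g) \<longlongrightarrow> - \<infinity>) (at_right 0)"
      using tendsto_uminus_ereal by (fastforce simp: o_def)
    thus ?thesis unfolding zero_ereal_def by (simp add: ereal_tendsto_simps)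
  qed
  have lim1: "((ereal \<circ> g \<circ> real_of_ereal) \<longlongrightarrow> \<infinity>) (at_left \<infinity>)"
  proof -
    have "filterlim g at_top at_top" unfolding g_def using ab by real_asymp
    hence "((ereal \<circ> g) \<longlongrightarrow> \<infinity>) at_top" by (simp add: tendsto_PInfty_eq_at_top o_def)
    thus ?thesis by (simp add: ereal_tendsto_simps)
  qed
  have deriv: "(g has_real_derivative g' x) (at x)" "isCont g' x" if "0 < ereal x" for x
    unfolding g_def g'_def using that
    by (auto intro!: derivative_eq_intros continuous_intros simp: field_simps power2_eq_square)
  have "(LBINT u=-\<infinity>..\<infinity>. f u) = (LBINT x=0..\<infinity>. f (g x) * g' x)"
    by (rule interval_integral_substitution_nonneg(2)[OF _ deriv(1) f_cont deriv(2) f_nonneg _ lim0 lim1 int])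
       (use ab in \<open>auto simp: g'_def\<close>)
  also have "\<dots> = 2 * ell a b"
  proof -
    have "(LBINT x=0..\<infinity>. f (g x) * g' x) = (LBINT x:{0<..}. f (g x) * g' x)"
      by (simp add: interval_lebesgue_integral_def e)
    also have "\<dots> = (LBINT x:{0<..}. 2 * (1 / sqrt ((x\<^sup>2 + a\<^sup>2) * (x\<^sup>2 + b\<^sup>2))))"
      by (intro set_lebesgue_integral_cong) (use fg in auto)
    also have "\<dots> = 2 * ell a b" unfolding ell_altdef by (rule set_integral_mult_right)
    finally show ?thesis .
  qed
  also have "(LBINT u=-\<infinity>..\<infinity>. f u) = 2 * ell ((a + b) / 2) (sqrt (a * b))"
  proof -
    have i: "set_integrable lborel (einterval (-\<infinity>) \<infinity>) f"
      by (rule interval_integral_substitution_nonneg(1)[OF _ deriv(1) f_cont deriv(2) f_nonneg _ lim0 lim1 int])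
         (use ab in \<open>auto simp: g'_def\<close>)
    have "(LBINT u=-\<infinity>..0. f u) + (LBINT u=0..\<infinity>. f u) = (LBINT u=-\<infinity>..\<infinity>. f u)"
      by (rule interval_integral_sum) (use i in \<open>simp add: interval_lebesgue_integrable_def min_def max_def\<close>)
    moreover have "(LBINT u=-\<infinity>..0. f u) = (LBINT u=0..\<infinity>. f (- u))"
      by (subst interval_integral_reflect) simp
    moreover have "f (- u) = f u" for u by (simp add: f_def)
    moreover have "(LBINT u=0..\<infinity>. f u) = ell ((a + b) / 2) (sqrt (a * b))" by (simp add: f_def ell_def)
    ultimately show ?thesis by simp
  qed
  finally show ?thesis by simp
qed

lemma ell_scale:
  assumes "0 < c" "0 < a" "0 < b"
  shows "ell (c * a) (c * b) = ell a b / c"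
proof -
  define f where "f = (\<lambda>u. 1 / sqrt ((u\<^sup>2 + (c * a)\<^sup>2) * (u\<^sup>2 + (c * b)\<^sup>2)))"
  have e: "einterval 0 \<infinity> = {0<..}" by (auto simp: einterval_def zero_ereal_def)
  have fg: "f (c * x) * c = (1 / c) * (1 / sqrt ((x\<^sup>2 + a\<^sup>2) * (x\<^sup>2 + b\<^sup>2)))" for x
  proof -
    have "((c * x)\<^sup>2 + (c * a)\<^sup>2) * ((c * x)\<^sup>2 + (c * b)\<^sup>2) = (c\<^sup>2)\<^sup>2 * ((x\<^sup>2 + a\<^sup>2) * (x\<^sup>2 + b\<^sup>2))"
      by (simp add: power_mult_distrib algebra_simps power2_eq_square)
    hence "sqrt (((c * x)\<^sup>2 + (c * a)\<^sup>2) * ((c * x)\<^sup>2 + (c * b)\<^sup>2)) = sqrt ((c\<^sup>2)\<^sup>2) * sqrt ((x\<^sup>2 + a\<^sup>2) * (x\<^sup>2 + b\<^sup>2))"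
      by (simp only: real_sqrt_mult)
    also have "sqrt ((c\<^sup>2)\<^sup>2) = c\<^sup>2" by (subst real_sqrt_abs) simp
    finally have "sqrt (((c * x)\<^sup>2 + (c * a)\<^sup>2) * ((c * x)\<^sup>2 + (c * b)\<^sup>2)) = c\<^sup>2 * sqrt ((x\<^sup>2 + a\<^sup>2) * (x\<^sup>2 + b\<^sup>2))" .
    thus ?thesis using assms by (simp add: f_def power2_eq_square)
  qed
  have f_cont: "isCont f u" for u
  proof -
    have "(u\<^sup>2 + (c * a)\<^sup>2) * (u\<^sup>2 + (c * b)\<^sup>2) > 0"
      using assms by (intro mult_pos_pos add_nonneg_pos) auto
    thus ?thesis unfolding f_def by (intro continuous_intros) auto
  qed
  have f_nonneg: "f u \<ge> 0" for u unfolding f_def by (intro divide_nonneg_nonneg real_sqrt_ge_zero mult_nonneg_nonneg) auto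
  have int: "set_integrable lborel (einterval 0 \<infinity>) (\<lambda>x. f (c * x) * c)"
    unfolding fg e using assms by (intro set_integrable_mult_right ell_integrable) auto
  have lim0: "((ereal \<circ> (\<lambda>x. c * x) \<circ> real_of_ereal) \<longlongrightarrow> ereal 0) (at_right 0)"
  proof -
    have "((\<lambda>x. c * x) \<longlongrightarrow> c * 0) (at_right 0)" by (intro tendsto_intros)
    hence "((ereal \<circ> (\<lambda>x. c * x)) \<longlongrightarrow> ereal 0) (at_right 0)" by (simp add: o_def)
    thus ?thesis unfolding zero_ereal_def by (simp only: ereal_tendsto_simps)
  qed
  have lim1: "((ereal \<circ> (\<lambda>x. c * x) \<circ> real_of_ereal) \<longlongrightarrow> \<infinity>) (at_left \<infinity>)"
  proof -
    have "filterlim (\<lambda>x. c * x) at_top at_top" using assms by real_asymp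
    hence "((ereal \<circ> (\<lambda>x. c * x)) \<longlongrightarrow> \<infinity>) at_top" by (simp add: tendsto_PInfty_eq_at_top o_def)
    thus ?thesis by (simp add: ereal_tendsto_simps)
  qed
  have "(LBINT u=ereal 0..\<infinity>. f u) = (LBINT x=0..\<infinity>. f (c * x) * c)"
    by (rule interval_integral_substitution_nonneg(2)[OF _ _ f_cont _ f_nonneg _ lim0 lim1 int])
       (use assms in \<open>auto intro!: derivative_eq_intros\<close>)
  also have "\<dots> = (LBINT x:{0<..}. (1 / c) * (1 / sqrt ((x\<^sup>2 + a\<^sup>2) * (x\<^sup>2 + b\<^sup>2))))"
    unfolding fg by (simp add: interval_lebesgue_integral_def e)
  also have "\<dots> = (1 / c) * ell a b" unfolding ell_altdef by (rule set_integral_mult_right)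
  finally show ?thesis by (simp add: f_def ell_def zero_ereal_def)
qed

text \<open>Split the integral at 1. Below 1 the integrand differs from
  \<open>1 / sqrt (x\<^sup>2 + k\<^sup>2)\<close>, whose integral is \<open>arsinh (1 / k)\<close>,
  by at most \<open>x / 2\<close>; above 1 it is at most \<open>1 / x\<^sup>2\<close>. A bounded
  error suffices, because it will be divided by \<open>ln q\<close>.\<close>

lemma ell_ln_bound:
  assumes k: "0 < k" "k \<le> 1"
  shows "\<bar>ell 1 k + ln k\<bar> \<le> 2"
proof -
  define f where "f = (\<lambda>x. 1 / sqrt ((x\<^sup>2 + 1\<^sup>2) * (x\<^sup>2 + k\<^sup>2)))"
  have e: "einterval 0 \<infinity> = {0<..}" "einterval 0 1 = {0<..<1}" "einterval 1 \<infinity> = {1<..}"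
    by (auto simp: einterval_def zero_ereal_def one_ereal_def)
  have f_nonneg: "f x \<ge> 0" for x unfolding f_def by (intro divide_nonneg_nonneg real_sqrt_ge_zero mult_nonneg_nonneg) auto
  have int: "set_integrable lborel {0<..} f" unfolding f_def using k by (intro ell_integrable) auto
  have split: "ell 1 k = (LBINT x:{0<..<1}. f x) + (LBINT x:{1<..}. f x)"
  proof -
    have "(LBINT x=0..1. f x) + (LBINT x=1..\<infinity>. f x) = (LBINT x=0..\<infinity>. f x)"
      by (rule interval_integral_sum) (use int e in \<open>simp add: interval_lebesgue_integrable_def min_def max_def\<close>)
    thus ?thesis by (simp add: ell_def f_def interval_lebesgue_integral_def e)
  qed
  have int1: "set_integrable lborel {0<..<1} f" "set_integrable lborel {1<..} f"
    by (rule set_integrable_subset[OF int]; auto)+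
  have s_pos: "x\<^sup>2 + k\<^sup>2 > 0" for x using k by (intro add_nonneg_pos) auto
  have A: "set_integrable lborel {0<..<1} (\<lambda>x. 1 / sqrt (x\<^sup>2 + k\<^sup>2))"
    "(LBINT x:{0<..<1}. 1 / sqrt (x\<^sup>2 + k\<^sup>2)) = arsinh (1 / k)"
  proof -
    have d: "((\<lambda>x. arsinh (x / k)) has_real_derivative 1 / sqrt (x\<^sup>2 + k\<^sup>2)) (at x)" for x
    proof -
      have "(x / k)\<^sup>2 + 1 = (x\<^sup>2 + k\<^sup>2) / k\<^sup>2" using k by (simp add: power_divide add_divide_distrib)
      hence "1 / sqrt ((x / k)\<^sup>2 + 1) * (1 / k) = 1 / sqrt (x\<^sup>2 + k\<^sup>2)"
        using k by (simp add: real_sqrt_divide)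
      moreover have "((\<lambda>x. arsinh (x / k)) has_real_derivative 1 / sqrt ((x / k)\<^sup>2 + 1) * (1 / k)) (at x)"
        by (intro DERIV_chain2[OF arsinh_real_has_field_derivative] DERIV_cdivide DERIV_ident)
      ultimately show ?thesis by simp
    qed
    have c: "isCont (\<lambda>x. 1 / sqrt (x\<^sup>2 + k\<^sup>2)) x" for x
      using s_pos[of x] by (intro continuous_intros) auto
    have ic: "isCont (\<lambda>x. arsinh (x / k)) x" for x using d DERIV_isCont by blast
    have l: "((\<lambda>x. arsinh (x / k)) \<longlongrightarrow> arsinh (y / k)) (at y)" for y
      using ic[of y] by (simp add: isCont_def)
    have l0: "(((\<lambda>x. arsinh (x / k)) \<circ> real_of_ereal) \<longlongrightarrow> arsinh (0 / k)) (at_right 0)"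
      unfolding zero_ereal_def ereal_tendsto_simps using l[of 0] by (simp only: filterlim_at_split)
    have l1: "(((\<lambda>x. arsinh (x / k)) \<circ> real_of_ereal) \<longlongrightarrow> arsinh (1 / k)) (at_left 1)"
      unfolding one_ereal_def ereal_tendsto_simps using l[of 1] by (simp only: filterlim_at_split)
    note * = interval_integral_FTC_nonneg[OF _ d c _ l0 l1]
    show "set_integrable lborel {0<..<1} (\<lambda>x. 1 / sqrt (x\<^sup>2 + k\<^sup>2))"
      using * unfolding e by simp
    have "(LBINT x=0..1. 1 / sqrt (x\<^sup>2 + k\<^sup>2)) = arsinh (1 / k) - arsinh (0 / k)" using * by simp
    thus "(LBINT x:{0<..<1}. 1 / sqrt (x\<^sup>2 + k\<^sup>2)) = arsinh (1 / k)"
      by (simp add: interval_lebesgue_integral_def e)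
  qed
  have B: "set_integrable lborel {0<..<1} (\<lambda>x::real. x / 2)" "(LBINT x:{0<..<1}. x / 2) = (1 / 4 :: real)"
  proof -
    have d: "((\<lambda>x. x\<^sup>2 / 4) has_real_derivative x / 2) (at x)" for x :: real
      by (auto intro!: derivative_eq_intros)
    have l0: "(((\<lambda>x::real. x\<^sup>2 / 4) \<circ> real_of_ereal) \<longlongrightarrow> 0\<^sup>2 / 4) (at_right 0)"
      unfolding zero_ereal_def ereal_tendsto_simps by (intro tendsto_intros) auto
    have l1: "(((\<lambda>x::real. x\<^sup>2 / 4) \<circ> real_of_ereal) \<longlongrightarrow> 1\<^sup>2 / 4) (at_left 1)"
      unfolding one_ereal_def ereal_tendsto_simps by (intro tendsto_intros) auto
    have "set_integrable lborel (einterval 0 1) (\<lambda>x::real. x / 2) \<and> (LBINT x=0..1. x / 2) = 1\<^sup>2 / 4 - (0::real)\<^sup>2 / 4"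
      by (intro conjI interval_integral_FTC_nonneg[OF _ d _ _ l0 l1]) (auto intro!: continuous_intros)
    thus "set_integrable lborel {0<..<1} (\<lambda>x. x / 2 :: real)" "(LBINT x:{0<..<1}. x / 2) = (1 / 4 :: real)"
      by (simp_all add: interval_lebesgue_integral_def e)
  qed
  have C: "set_integrable lborel {1<..} (\<lambda>x::real. 1 / x\<^sup>2)" "(LBINT x:{1<..}. 1 / x\<^sup>2) = (1::real)"
  proof -
    have d: "((\<lambda>x. - 1 / x) has_real_derivative 1 / x\<^sup>2) (at x)" if "1 < ereal x" for x :: real
      using that by (auto intro!: derivative_eq_intros simp: power2_eq_square one_ereal_def)
    have l0: "(((\<lambda>x::real. - 1 / x) \<circ> real_of_ereal) \<longlongrightarrow> - 1 / 1) (at_right 1)"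
      unfolding one_ereal_def ereal_tendsto_simps by (intro tendsto_intros) auto
    have l1: "(((\<lambda>x::real. - 1 / x) \<circ> real_of_ereal) \<longlongrightarrow> 0) (at_left \<infinity>)"
      unfolding ereal_tendsto_simps by real_asymp
    have "set_integrable lborel (einterval 1 \<infinity>) (\<lambda>x::real. 1 / x\<^sup>2) \<and> (LBINT x=1..\<infinity>. 1 / x\<^sup>2) = 0 - (- 1 / 1 :: real)"
      by (intro conjI interval_integral_FTC_nonneg[OF _ d _ _ l0 l1]) (auto intro!: continuous_intros simp: one_ereal_def)
    thus "set_integrable lborel {1<..} (\<lambda>x::real. 1 / x\<^sup>2)" "(LBINT x:{1<..}. 1 / x\<^sup>2) = (1::real)"
      by (simp_all add: interval_lebesgue_integral_def e)
  qed
  have ub1: "f x \<le> 1 / sqrt (x\<^sup>2 + k\<^sup>2)" for x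
  proof -
    have "1 * (x\<^sup>2 + k\<^sup>2) \<le> (x\<^sup>2 + 1\<^sup>2) * (x\<^sup>2 + k\<^sup>2)" using s_pos[of x] by (intro mult_right_mono) auto
    thus ?thesis unfolding f_def using s_pos[of x] by (intro divide_left_mono mult_pos_pos) (auto intro!: mult_pos_pos add_nonneg_pos)
  qed
  have lb1: "1 / sqrt (x\<^sup>2 + k\<^sup>2) - x / 2 \<le> f x" if x: "x \<in> {0<..<1}" for x
  proof -
    define s where "s = sqrt (x\<^sup>2 + k\<^sup>2)"
    define t where "t = sqrt (x\<^sup>2 + 1)"
    have s: "s \<ge> x" "s > 0" unfolding s_def using x s_pos[of x] by (auto intro: real_le_rsqrt)
    have t: "t \<ge> 1" "t\<^sup>2 = x\<^sup>2 + 1" unfolding t_def using x by auto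
    have ft: "f x = (1 / s) * (1 / t)" unfolding f_def s_def t_def by (simp add: real_sqrt_mult)
    have "1 - 1 / t = (t - 1) / t" using t by (simp add: field_simps)
    also have "\<dots> \<le> (t - 1) / 1" using t by (intro divide_left_mono) auto
    also have "t - 1 \<le> x\<^sup>2 / 2"
    proof -
      have "2 * (t - 1) \<le> (t - 1) * (t + 1)" using mult_left_mono[of 2 "t + 1" "t - 1"] t by (simp add: mult.commute)
      also have "\<dots> = x\<^sup>2" using t by (simp add: algebra_simps power2_eq_square)
      finally show ?thesis by simp
    qed
    finally have "1 - 1 / t \<le> x\<^sup>2 / 2" by simp
    hence "(1 / s) * (1 - 1 / t) \<le> (1 / s) * (x\<^sup>2 / 2)" using s by (intro mult_left_mono) auto
    also have "\<dots> = (x / s) * (x / 2)" by (simp add: power2_eq_square)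
    also have "\<dots> \<le> 1 * (x / 2)" using s x by (intro mult_right_mono) auto
    finally show ?thesis unfolding ft s_def[symmetric] by (simp add: right_diff_distrib)
  qed
  have ub2: "f x \<le> 1 / x\<^sup>2" if "x \<in> {1<..}" for x
  proof -
    have "x\<^sup>2 * x\<^sup>2 \<le> (x\<^sup>2 + 1\<^sup>2) * (x\<^sup>2 + k\<^sup>2)" by (intro mult_mono) auto
    hence "x\<^sup>2 \<le> sqrt ((x\<^sup>2 + 1\<^sup>2) * (x\<^sup>2 + k\<^sup>2))" by (intro real_le_rsqrt) (simp add: power2_eq_square[of "x\<^sup>2"])
    thus ?thesis unfolding f_def using that s_pos[of x] by (intro divide_left_mono mult_pos_pos) (auto intro!: mult_pos_pos add_nonneg_pos)
  qed
  have "(LBINT x:{0<..<1}. f x) \<le> arsinh (1 / k)"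
    unfolding A(2)[symmetric] by (intro set_integral_mono int1 A ub1)
  moreover have "(LBINT x:{1<..}. f x) \<le> (LBINT x:{1<..}. 1 / x\<^sup>2)"
    by (intro set_integral_mono int1 C ub2)
  moreover note C(2)
  moreover have "(LBINT x:{1<..}. f x) \<ge> 0"
    unfolding set_lebesgue_integral_def using f_nonneg by (intro Bochner_Integration.integral_nonneg) auto
  moreover have "arsinh (1 / k) - 1 / 4 \<le> (LBINT x:{0<..<1}. f x)"
  proof -
    have "arsinh (1 / k) - 1 / 4 = (LBINT x:{0<..<1}. 1 / sqrt (x\<^sup>2 + k\<^sup>2) - x / 2)"
      using A B by (simp add: set_integral_diff)
    also have "\<dots> \<le> (LBINT x:{0<..<1}. f x)"
      using A B by (intro set_integral_mono int1 lb1 set_integral_diff) auto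
    finally show ?thesis .
  qed
  moreover have "arsinh (1 / k) \<le> ln (1 / k) + 1"
  proof -
    have "k * k \<le> 1" using k by (simp add: mult_le_one)
    hence "(1 / k)\<^sup>2 + 1 \<le> (3 / 2 / k)\<^sup>2" using k by (simp add: field_simps power2_eq_square)
    hence "sqrt ((1 / k)\<^sup>2 + 1) \<le> 3 / 2 / k" using k by (intro real_le_lsqrt) auto
    hence "1 / k + sqrt ((1 / k)\<^sup>2 + 1) \<le> (5 / 2) * (1 / k)" by simp
    also have "\<dots> \<le> exp 1 * (1 / k)"
    proof -
      have "(5 / 2 :: real) \<le> exp 1" using exp_lower_Taylor_quadratic[of "1::real"] by simp
      thus ?thesis using k by (intro mult_right_mono) auto
    qed
    finally have "ln (1 / k + sqrt ((1 / k)\<^sup>2 + 1)) \<le> ln (exp 1 * (1 / k))"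
      using k by (intro ln_mono) (auto intro!: add_pos_nonneg)
    also have "ln (exp 1 * (1 / k)) = 1 + ln (1 / k)" using k by (subst ln_mult) auto
    finally show ?thesis by (simp add: arsinh_real_def)
  qed
  moreover have "ln (1 / k) \<le> arsinh (1 / k)"
    unfolding arsinh_real_def using k by (intro ln_mono) (auto intro!: add_pos_nonneg)
  moreover have "ln (1 / k) = - ln k" using k by (simp add: ln_div)
  ultimately show ?thesis using split by linarith
qed

text \<open>Strictness makes a modulus recoverable from a quotient of integrals, which is how the
  dual nome is identified.\<close>

lemma ell_strict_antimono:
  assumes "0 < b" "b < b'" "0 < a"
  shows "ell a b' < ell a b"
proof -
  let ?f = "\<lambda>b x. 1 / sqrt ((x\<^sup>2 + a\<^sup>2) * (x\<^sup>2 + b\<^sup>2))"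
  have lt: "?f b' x < ?f b x" for x
  proof -
    have "b\<^sup>2 < b'\<^sup>2" using assms by (intro power_strict_mono) auto
    hence "(x\<^sup>2 + a\<^sup>2) * (x\<^sup>2 + b\<^sup>2) < (x\<^sup>2 + a\<^sup>2) * (x\<^sup>2 + b'\<^sup>2)" "(x\<^sup>2 + a\<^sup>2) * (x\<^sup>2 + b\<^sup>2) > 0"
      using assms by (auto intro!: mult_strict_left_mono add_nonneg_pos mult_pos_pos)
    thus ?thesis by (intro divide_strict_left_mono mult_pos_pos) auto
  qed
  have i: "integrable lborel (\<lambda>x. indicator {0<..} x *\<^sub>R ?f c x)" if "c > 0" for c
    using ell_integrable[OF assms(3) that] by (simp add: set_integrable_def)
  have "(\<integral>x. indicator {0<..} x *\<^sub>R ?f b' x \<partial>lborel) < (\<integral>x. indicator {0<..} x *\<^sub>R ?f b x \<partial>lborel)"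
  proof -
    let ?h = "\<lambda>x. indicator {0<..} x *\<^sub>R ?f b x - indicator {0<..} x *\<^sub>R ?f b' x"
    have h: "integrable lborel ?h" using i assms by (intro Bochner_Integration.integrable_diff) auto
    have nonneg: "AE x in lborel. 0 \<le> ?h x"
      using lt less_imp_le by (intro AE_I2) (auto simp: indicator_def)
    have "\<not> (AE x in lborel. ?h x = 0)"
    proof
      assume "AE x in lborel. ?h x = 0"
      hence "AE x in lborel. x \<notin> {0<..<(1::real)}"
        by eventually_elim (use lt in \<open>force simp: indicator_def\<close>)
      hence "emeasure lborel {0<..<(1::real)} = 0"
      proof -
        have "(AE x in lborel. x \<notin> {0<..<(1::real)}) \<longleftrightarrow> emeasure lborel {0<..<(1::real)} = 0"
          by (rule AE_iff_measurable) auto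
        thus ?thesis using \<open>AE x in lborel. x \<notin> {0<..<(1::real)}\<close> by blast
      qed
      thus False by (simp only: emeasure_lborel_Ioo) simp
    qed
    hence "integral\<^sup>L lborel ?h \<noteq> 0" using integral_nonneg_eq_0_iff_AE[OF h nonneg] by simp
    moreover have "integral\<^sup>L lborel ?h \<ge> 0" using nonneg by (rule integral_nonneg_AE)
    ultimately show ?thesis using i assms by (subst (asm) (1 2) Bochner_Integration.integral_diff) auto
  qed
  thus ?thesis by (simp add: ell_altdef set_lebesgue_integral_def)
qed

lemma Gamma_three_quarters: "Gamma (3 / 4 :: real) = pi * sqrt 2 / Gamma (1 / 4)"
proof -
  have "Gamma (of_real (1 / 4) :: complex) * Gamma (1 - of_real (1 / 4)) = of_real pi / sin (of_real pi * of_real (1 / 4))"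
    by (rule Gamma_reflection_complex)
  also have "1 - complex_of_real (1 / 4) = of_real (3 / 4)" by simp
  also have "sin (of_real pi * of_real (1 / 4) :: complex) = of_real (sqrt 2 / 2)"
    using sin_45 by (metis of_real_mult sin_of_real times_divide_eq_right mult.right_neutral)
  finally have "complex_of_real (Gamma (1 / 4) * Gamma (3 / 4)) = of_real (pi / (sqrt 2 / 2))"
    unfolding Gamma_complex_of_real of_real_mult of_real_divide[of pi] .
  hence "Gamma (1 / 4) * Gamma (3 / 4) = pi / (sqrt 2 / 2)" by (simp only: of_real_eq_iff)
  also have "pi / (sqrt 2 / 2) = pi * sqrt 2" by (simp add: field_simps)
  finally have "Gamma (3 / 4) * Gamma (1 / 4) = pi * sqrt 2" by (simp only: mult.commute)
  moreover have "Gamma (1 / 4 :: real) > 0" by (rule Gamma_real_pos) simp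
  ultimately show ?thesis by (intro eq_divide_imp) (rule less_imp_neq[symmetric])
qed

text \<open>The substitution \<open>u = 1 - (1 + x\<^sup>2)\<^sup>-\<^sup>2\<close> turns the lemniscatic integral into a Beta integral.\<close>
lemma ell_lemniscate: "ell 1 (sqrt 2) = Gamma (1 / 4) ^ 2 / (4 * sqrt (2 * pi))"
proof -
  define f where "f = (\<lambda>t::real. t powr (1 / 2 - 1) * (1 - t) powr (1 / 4 - 1))"
  define g where "g = (\<lambda>x::real. 1 - 1 / (1 + x\<^sup>2)\<^sup>2)"
  define g' where "g' = (\<lambda>x::real. 4 * x / (1 + x\<^sup>2) ^ 3)"
  have e: "einterval 0 \<infinity> = {0<..}" "einterval 0 1 = {0<..<1}"
    by (auto simp: einterval_def zero_ereal_def one_ereal_def)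
  have p: "1 + x\<^sup>2 > 0" for x :: real by (intro add_pos_nonneg) auto
  have g01: "0 < g x" "g x < 1" if "0 < x" for x
  proof -
    have *: "1 < (1 + x\<^sup>2)\<^sup>2" using that by (intro one_less_power) auto
    have "0 < 1 - 1 / s \<and> 1 - 1 / s < 1" if "1 < s" for s :: real using that by (simp add: field_simps)
    from this[OF *] show "0 < g x" "g x < 1" by (auto simp: g_def)
  qed
  have fg: "f (g x) * g' x = 4 * (1 / sqrt ((x\<^sup>2 + 1\<^sup>2) * (x\<^sup>2 + (sqrt 2)\<^sup>2)))" if x: "x > 0" for x
  proof -
    define s where "s = 1 + x\<^sup>2"
    have s: "s > 1" using x by (simp add: s_def)
    have "g x = x\<^sup>2 * (s + 1) / s\<^sup>2" using s unfolding g_def s_def[symmetric]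
      by (simp add: field_simps) (simp add: s_def power2_eq_square algebra_simps)
    hence "g x powr (- (1 / 2)) = 1 / sqrt (x\<^sup>2 * (s + 1) / s\<^sup>2)"
      using s x by (simp add: powr_minus_divide powr_half_sqrt)
    also have "sqrt (x\<^sup>2 * (s + 1) / s\<^sup>2) = x * sqrt (s + 1) / s"
      using s x by (simp add: real_sqrt_mult real_sqrt_divide)
    finally have 1: "g x powr (- (1 / 2)) = s / (x * sqrt (s + 1))" by simp
    have "1 - g x = s powr (- 2)" using s by (simp add: g_def s_def[symmetric] powr_minus_divide)
    hence "(1 - g x) powr (- (3 / 4)) = s powr (3 / 2)" by (simp add: powr_powr)
    also have "\<dots> = s powr 1 * s powr (1 / 2)" unfolding powr_add[symmetric] by simp
    also have "\<dots> = s * sqrt s" using s by (simp add: powr_half_sqrt)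
    finally have 2: "(1 - g x) powr (- (3 / 4)) = s * sqrt s" .
    have "f (g x) * g' x = s / (x * sqrt (s + 1)) * (s * sqrt s) * (4 * x / s ^ 3)"
      by (simp add: f_def 1 2 g'_def s_def[symmetric])
    also have "\<dots> = 4 * (sqrt s / s) / sqrt (s + 1)" using s x by (simp add: power3_eq_cube mult_ac)
    also have "sqrt s / s = 1 / sqrt s" using s by (subst frac_eq_eq) auto
    finally show ?thesis by (simp add: s_def real_sqrt_mult add_ac)
  qed
  have deriv: "(g has_real_derivative g' x) (at x)" "isCont g' x" for x
  proof -
    have "2 * s * (2 * x) / (s\<^sup>2 * s\<^sup>2) = 4 * x / s ^ 3" if "s > 0" for s :: real
      using that by (simp add: power2_eq_square power3_eq_cube)
    from this[OF p[of x]]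
    have "g' x = 0 - (0 * (1 + x\<^sup>2)\<^sup>2 - 1 * (2 * (1 + x\<^sup>2) * (2 * x))) / ((1 + x\<^sup>2)\<^sup>2 * (1 + x\<^sup>2)\<^sup>2)"
      by (simp add: g'_def)
    moreover have "(g has_real_derivative 0 - (0 * (1 + x\<^sup>2)\<^sup>2 - 1 * (2 * (1 + x\<^sup>2) * (2 * x))) / ((1 + x\<^sup>2)\<^sup>2 * (1 + x\<^sup>2)\<^sup>2)) (at x)"
      unfolding g_def using p[of x] by (intro DERIV_diff DERIV_const DERIV_divide) (auto intro!: derivative_eq_intros)
    ultimately show "(g has_real_derivative g' x) (at x)" by simp
    show "isCont g' x" unfolding g'_def using p[of x] by (intro continuous_intros) auto
  qed
  have cont: "isCont f (g x)" if "0 < ereal x" for x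
    using g01[of x] that unfolding f_def by (intro continuous_intros) auto
  have int: "set_integrable lborel (einterval 0 \<infinity>) (\<lambda>x. f (g x) * g' x)"
  proof -
    have "set_integrable lborel {0<..} (\<lambda>x. 4 * (1 / sqrt ((x\<^sup>2 + 1\<^sup>2) * (x\<^sup>2 + (sqrt 2)\<^sup>2))))"
      by (intro set_integrable_mult_right ell_integrable) auto
    thus ?thesis unfolding e by (rule set_integrable_cong[THEN iffD1, rotated -1]) (use fg in auto)
  qed
  have lim0: "((ereal \<circ> g \<circ> real_of_ereal) \<longlongrightarrow> 0) (at_right 0)"
  proof -
    have "(g \<longlongrightarrow> 1 - 1 / (1 + 0\<^sup>2)\<^sup>2) (at_right 0)" unfolding g_def by (intro tendsto_intros) auto
    thus ?thesis unfolding zero_ereal_def by (simp add: ereal_tendsto_simps)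
  qed
  have lim1: "((ereal \<circ> g \<circ> real_of_ereal) \<longlongrightarrow> 1) (at_left \<infinity>)"
  proof -
    have "(g \<longlongrightarrow> 1) at_top" unfolding g_def by real_asymp
    thus ?thesis unfolding one_ereal_def by (simp add: ereal_tendsto_simps)
  qed
  have f_nonneg: "0 \<le> f t" for t by (simp add: f_def)
  have g'_nonneg: "0 \<le> g' x" if "0 \<le> ereal x" for x using that p[of x] by (auto simp: g'_def)
  note * = interval_integral_substitution_nonneg[OF _ deriv(1) cont deriv(2) f_nonneg g'_nonneg lim0 lim1 int]
  have i01: "set_integrable lborel {0<..<1} f" using * unfolding e by simp
  have "(LBINT t=0..1. f t) = (LBINT x=0..\<infinity>. f (g x) * g' x)" using * by simp
  also have "\<dots> = (LBINT x:{0<..}. 4 * (1 / sqrt ((x\<^sup>2 + 1\<^sup>2) * (x\<^sup>2 + (sqrt 2)\<^sup>2))))"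
    unfolding interval_lebesgue_integral_def e using fg by (auto intro!: set_lebesgue_integral_cong)
  also have "\<dots> = 4 * ell 1 (sqrt 2)" unfolding ell_altdef by (rule set_integral_mult_right)
  finally have "4 * ell 1 (sqrt 2) = (LBINT t:{0<..<1}. f t)" by (simp add: interval_lebesgue_integral_def e)
  also have "\<dots> = integral {0<..<1} f" by (rule set_borel_integral_eq_integral(2)[OF i01])
  also have "\<dots> = Beta (1 / 2) (1 / 4)"
  proof (rule integral_unique)
    show "(f has_integral Beta (1 / 2) (1 / 4)) {0<..<1}"
      using has_integral_Beta_real[of "1 / 2" "1 / 4"] unfolding f_def by (simp add: has_integral_Icc_iff_Ioo)
  qed
  also have "\<dots> = sqrt pi * Gamma (1 / 4) / Gamma (3 / 4)"
    by (simp add: Beta_def Gamma_one_half_real)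
  also have "\<dots> = Gamma (1 / 4) ^ 2 / sqrt (2 * pi)"
  proof -
    have "sqrt pi * (1 / (pi * sqrt 2)) = 1 / sqrt (2 * pi)"
      by (simp add: real_sqrt_mult field_simps)
    thus ?thesis unfolding Gamma_three_quarters by (simp add: power2_eq_square field_simps)
  qed
  finally show ?thesis by simp
qed

subsection \<open>The inversion formula and the value at \<open>\<i>\<close>\<close>

text \<open>By the duplication formulas, squaring \<open>q\<close> replaces the two arguments by
  their arithmetic and geometric means, so \<open>ell_agm\<close> gives invariance. As
  \<open>q\<close> tends to 0 both arguments tend to 1, where the integral is
  \<open>pi / 2\<close>.\<close>

lemma ell_theta:
  assumes q: "0 < q" "q < 1"
  shows "ell ((theta q)\<^sup>2) ((theta (- q))\<^sup>2) = pi / 2"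
proof (rule square_invariant_imp_const[OF _ _ q])
  fix q :: real assume q: "0 < q" "q < 1"
  have pos: "theta q > 0" "theta (- q) > 0" using q by (auto intro: theta_pos)
  have "ell ((theta q)\<^sup>2) ((theta (- q))\<^sup>2) =
    ell (((theta q)\<^sup>2 + (theta (- q))\<^sup>2) / 2) (sqrt ((theta q)\<^sup>2 * (theta (- q))\<^sup>2))"
    using pos by (intro ell_agm[symmetric]) auto
  also have "((theta q)\<^sup>2 + (theta (- q))\<^sup>2) / 2 = (theta (q\<^sup>2))\<^sup>2"
    using theta_duplication_add[of q] q by simp
  also have "sqrt ((theta q)\<^sup>2 * (theta (- q))\<^sup>2) = (theta (- (q\<^sup>2)))\<^sup>2"
    using theta_duplication_mult[of q] q pos by (simp add: real_sqrt_mult)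
  finally show "ell ((theta (q\<^sup>2))\<^sup>2) ((theta (- (q\<^sup>2)))\<^sup>2) = ell ((theta q)\<^sup>2) ((theta (- q))\<^sup>2)" ..
next
  let ?m = "\<lambda>q. min ((theta q)\<^sup>2) ((theta (- q))\<^sup>2)" and ?M = "\<lambda>q. max ((theta q)\<^sup>2) ((theta (- q))\<^sup>2)"
  have ev: "\<forall>\<^sub>F q in at_right 0. 0 < q \<and> q < (1::real)" using eventually_at_right_real[of 0 1] by simp
  have b: "pi / (2 * ?M q) \<le> ell ((theta q)\<^sup>2) ((theta (- q))\<^sup>2) \<and> ell ((theta q)\<^sup>2) ((theta (- q))\<^sup>2) \<le> pi / (2 * ?m q)"
    if "0 < q \<and> q < 1" for q
    using that theta_pos[of q] theta_pos[of "- q"] by (intro conjI ell_bounds[where m = "?m q" and M = "?M q"]) auto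
  show "((\<lambda>q. ell ((theta q)\<^sup>2) ((theta (- q))\<^sup>2)) \<longlongrightarrow> pi / 2) (at_right 0)"
  proof (rule tendsto_sandwich)
    show "\<forall>\<^sub>F q in at_right 0. pi / (2 * ?M q) \<le> ell ((theta q)\<^sup>2) ((theta (- q))\<^sup>2)"
      "\<forall>\<^sub>F q in at_right 0. ell ((theta q)\<^sup>2) ((theta (- q))\<^sup>2) \<le> pi / (2 * ?m q)"
      using ev b by (auto elim: eventually_mono)
    have "((\<lambda>q. pi / (2 * ?M q)) \<longlongrightarrow> pi / (2 * max (1\<^sup>2) (1\<^sup>2))) (at_right 0)"
      "((\<lambda>q. pi / (2 * ?m q)) \<longlongrightarrow> pi / (2 * min (1\<^sup>2) (1\<^sup>2))) (at_right 0)"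
      by (intro tendsto_intros tendsto_at_right_0_theta tendsto_max tendsto_min; simp)+
    thus "((\<lambda>q. pi / (2 * ?M q)) \<longlongrightarrow> pi / 2) (at_right 0)" "((\<lambda>q. pi / (2 * ?m q)) \<longlongrightarrow> pi / 2) (at_right 0)"
      by simp_all
  qed
qed

text \<open>The classical k = theta_2^2 / theta_3^2; its complement k' = theta_4^2 / theta_3^2
  follows. Thus \<open>ell 1\<close> of the comodulus is K and \<open>ell 1\<close> of the modulus
  is K'.\<close>

definition elliptic_modulus :: "real \<Rightarrow> real" where
  "elliptic_modulus q = sqrt (theta2_4 q) / (theta q)\<^sup>2"

definition elliptic_comodulus :: "real \<Rightarrow> real" where
  "elliptic_comodulus q = (theta (- q))\<^sup>2 / (theta q)\<^sup>2"

lemma elliptic_modulus_square: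
  assumes "0 < q" "q < 1" shows "(elliptic_modulus q)\<^sup>2 + (elliptic_comodulus q)\<^sup>2 = 1"
proof -
  have "(elliptic_modulus q)\<^sup>2 + (elliptic_comodulus q)\<^sup>2 = (theta2_4 q + theta (- q) ^ 4) / theta q ^ 4"
    using theta2_4_pos[OF assms] by (simp add: elliptic_modulus_def elliptic_comodulus_def power_divide add_divide_distrib flip: power_mult)
  thus ?thesis using theta_pos[of q] assms by (simp add: theta2_4_def)
qed

lemma elliptic_modulus_pos:
  assumes "0 < q" "q < 1" shows "elliptic_modulus q > 0" "elliptic_comodulus q > 0"
  using assms theta_pos[of q] theta_pos[of "- q"] theta2_4_pos[of q]
  by (auto simp: elliptic_modulus_def elliptic_comodulus_def)

lemma ell_elliptic_comodulus:
  assumes q: "0 < q" "q < 1"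
  shows "ell 1 (elliptic_comodulus q) = (theta q)\<^sup>2 * (pi / 2)"
proof -
  have pos: "theta q > 0" "theta (- q) > 0" using q by (auto intro: theta_pos)
  have "pi / 2 = ell ((theta q)\<^sup>2 * 1) ((theta q)\<^sup>2 * elliptic_comodulus q)"
    using ell_theta[OF q] pos by (simp add: elliptic_comodulus_def)
  also have "\<dots> = ell 1 (elliptic_comodulus q) / (theta q)\<^sup>2"
    using pos elliptic_modulus_pos[OF q] by (intro ell_scale) auto
  finally show ?thesis using pos by (simp add: field_simps)
qed

text \<open>With x = theta_3^2 and y = theta_4^2 at \<open>q\<close>, the numbers x + y and x - y
  are twice the arguments at \<open>q\<^sup>2\<close>, and their means are the arguments at
  \<open>q\<close>. So squaring \<open>q\<close> doubles the integral, as it doubles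
  \<open>ln q\<close>. The constant -1/2 comes from k being asymptotic to 4 sqrt q and
  \<open>ell 1 k = - ln k + O(1)\<close>.\<close>

lemma ell_theta2:
  assumes q: "0 < q" "q < 1"
  shows "ell ((theta q)\<^sup>2) (sqrt (theta2_4 q)) = - ln q / 2"
proof -
  let ?f = "\<lambda>q. ell ((theta q)\<^sup>2) (sqrt (theta2_4 q))"
  have "?f (q\<^sup>2) / ln (q\<^sup>2) = ?f q / ln q" if q: "0 < q" "q < 1" for q
  proof -
    define x y where "x = (theta q)\<^sup>2" and "y = (theta (- q))\<^sup>2"
    have q2: "0 < q\<^sup>2" "q\<^sup>2 < 1" using q by (auto simp: power_less_one_iff)
    have pos: "theta q > 0" "theta (- q) > 0" "theta (q\<^sup>2) > 0" using q q2 by (auto intro: theta_pos)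
    have c: "theta2_4 q = (x + y) * (x - y)" "theta2_4 (q\<^sup>2) = ((x - y) / 2)\<^sup>2"
      using theta2_4_square[of q] q by (auto simp: x_def y_def theta2_4_def power2_eq_square eval_nat_numeral algebra_simps)
    have xy: "x + y > 0" using pos by (simp add: x_def y_def add_pos_pos)
    have xy': "x - y > 0" using theta2_4_pos[OF q] xy unfolding c by (simp add: zero_less_mult_iff)
    have "?f q = ell (((x + y) + (x - y)) / 2) (sqrt ((x + y) * (x - y)))" by (simp add: c x_def[symmetric])
    also have "\<dots> = ell (x + y) (x - y)" using xy xy' by (rule ell_agm)
    also have "\<dots> = ell (2 * (theta (q\<^sup>2))\<^sup>2) (2 * sqrt (theta2_4 (q\<^sup>2)))"
    proof -
      have "2 * sqrt (theta2_4 (q\<^sup>2)) = x - y" unfolding c(2) real_sqrt_abs using xy' by simp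
      moreover have "2 * (theta (q\<^sup>2))\<^sup>2 = x + y" using theta_duplication_add[of q] q by (simp add: x_def y_def)
      ultimately show ?thesis by simp
    qed
    also have "\<dots> = ?f (q\<^sup>2) / 2"
      using pos theta2_4_pos[OF q2] by (intro ell_scale) auto
    finally have f: "?f q = ?f (q\<^sup>2) / 2" .
    show ?thesis unfolding f using q by (simp add: ln_realpow)
  qed
  moreover have "((\<lambda>q. ?f q / ln q) \<longlongrightarrow> - (1 / 2)) (at_right 0)"
  proof (rule Lim_transform_eventually)
    have ev: "\<forall>\<^sub>F q in at_right 0. 0 < q \<and> q < (1::real)" using eventually_at_right_real[of 0 1] by simp
    let ?k = elliptic_modulus
    have bd: "\<bar>ell 1 (?k q) + ln (?k q)\<bar> \<le> 2" if q: "0 < q \<and> q < 1" for q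
    proof (rule ell_ln_bound)
      show "?k q > 0" using q elliptic_modulus_pos by simp
      have "(?k q)\<^sup>2 \<le> 1\<^sup>2" using elliptic_modulus_square[of q] q zero_le_power2[of "elliptic_comodulus q"]
        unfolding one_power2 by linarith
      thus "?k q \<le> 1" by (rule power2_le_imp_le) simp
    qed
    have lim1: "((\<lambda>q. (ell 1 (?k q) + ln (?k q)) * (1 / ln q)) \<longlongrightarrow> 0) (at_right 0)"
    proof (rule Lim_null_comparison)
      show "\<forall>\<^sub>F q in at_right 0. norm ((ell 1 (?k q) + ln (?k q)) * (1 / ln q)) \<le> 2 * \<bar>1 / ln q\<bar>"
        using ev
      proof eventually_elim
        case (elim q)
        show ?case unfolding real_norm_def abs_mult by (rule mult_right_mono[OF bd[OF elim] abs_ge_zero])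
      qed
      show "((\<lambda>q::real. 2 * \<bar>1 / ln q\<bar>) \<longlongrightarrow> 0) (at_right 0)" by real_asymp
    qed
    have lim2: "((\<lambda>q. 1 / 2 + (ln (theta2_4 q / q) / 2 - 2 * ln (theta q)) * (1 / ln q)) \<longlongrightarrow>
        1 / 2 + (ln 16 / 2 - 2 * ln 1) * 0) (at_right 0)"
      by (intro tendsto_intros tendsto_at_right_0_theta) (auto, real_asymp)
    show "((\<lambda>q. ((ell 1 (?k q) + ln (?k q)) * (1 / ln q) -
        (1 / 2 + (ln (theta2_4 q / q) / 2 - 2 * ln (theta q)) * (1 / ln q))) / (theta q)\<^sup>2) \<longlongrightarrow> - (1 / 2)) (at_right 0)"
      using tendsto_divide[OF tendsto_diff[OF lim1 lim2] tendsto_power[OF tendsto_at_right_0_theta(1), of 2]] by simp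
    show "\<forall>\<^sub>F q in at_right 0. ((ell 1 (?k q) + ln (?k q)) * (1 / ln q) -
        (1 / 2 + (ln (theta2_4 q / q) / 2 - 2 * ln (theta q)) * (1 / ln q))) / (theta q)\<^sup>2 = ?f q / ln q"
      using ev
    proof eventually_elim
      case (elim q)
      have pos: "theta q > 0" "theta2_4 q > 0" using elim by (auto intro: theta_pos theta2_4_pos)
      have k: "?k q > 0" using elim elliptic_modulus_pos by simp
      have lnq: "ln q \<noteq> 0" using elim by simp
      have "?f q = ell ((theta q)\<^sup>2 * 1) ((theta q)\<^sup>2 * ?k q)" using pos by (simp add: elliptic_modulus_def)
      also have "\<dots> = ell 1 (?k q) / (theta q)\<^sup>2" using pos k by (intro ell_scale) auto
      finally have 1: "?f q = ell 1 (?k q) / (theta q)\<^sup>2" .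
      have "ln (?k q) = ln (theta2_4 q) / 2 - 2 * ln (theta q)"
        using pos by (simp add: elliptic_modulus_def ln_div ln_sqrt ln_realpow)
      moreover have "ln (theta2_4 q / q) = ln (theta2_4 q) - ln q" using pos elim by (simp add: ln_div)
      ultimately have 2: "ln (?k q) = ln q / 2 + (ln (theta2_4 q / q) / 2 - 2 * ln (theta q))"
        by (simp add: field_simps)
      show ?case unfolding 1 2 using lnq pos by (simp add: divide_simps) (simp add: algebra_simps)?
    qed
  qed
  ultimately have "?f q / ln q = - (1 / 2)" by (rule square_invariant_imp_const[OF _ _ q])
  thus ?thesis using q by (simp add: field_simps)
qed

lemma ell_elliptic_modulus:
  assumes q: "0 < q" "q < 1"
  shows "ell 1 (elliptic_modulus q) = (theta q)\<^sup>2 * (- ln q / 2)"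
proof -
  have pos: "theta q > 0" "theta2_4 q > 0" using q by (auto intro: theta_pos theta2_4_pos)
  have "- ln q / 2 = ell ((theta q)\<^sup>2 * 1) ((theta q)\<^sup>2 * elliptic_modulus q)"
    using ell_theta2[OF q] pos by (simp add: elliptic_modulus_def)
  also have "\<dots> = ell 1 (elliptic_modulus q) / (theta q)\<^sup>2"
    using pos elliptic_modulus_pos[OF q] by (intro ell_scale) auto
  finally show ?thesis using pos by (simp add: field_simps)
qed

lemma dual_nome:
  assumes q: "0 < q" "q < 1"
  shows "0 < exp (pi\<^sup>2 / ln q)" "exp (pi\<^sup>2 / ln q) < 1"
  using assms by (auto simp: divide_pos_neg)

text \<open>The quotient \<open>ell 1 k / ell 1 k'\<close> equals \<open>- ln q / \<pi>\<close> and is strictly decreasing in \<open>k\<close>,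
  so passing to the dual nome interchanges \<open>k\<close> and \<open>k'\<close>.\<close>
lemma elliptic_comodulus_dual:
  assumes q: "0 < q" "q < 1"
  shows "elliptic_comodulus (exp (pi\<^sup>2 / ln q)) = elliptic_modulus q"
proof -
  define p where "p = exp (pi\<^sup>2 / ln q)"
  have p: "0 < p" "p < 1" using dual_nome[OF q] by (auto simp: p_def)
  let ?k = elliptic_modulus and ?k' = elliptic_comodulus
  note pos = elliptic_modulus_pos[OF p] elliptic_modulus_pos[OF q]
  note sq = elliptic_modulus_square[OF p] elliptic_modulus_square[OF q]
  \<comment> \<open>Since \<open>ln p * ln q = pi\<^sup>2\<close>, the quotients of the two
    integrals at \<open>p\<close> and at \<open>q\<close> are reciprocal.\<close>
  have prod: "ell 1 (?k p) * ell 1 (?k q) = ell 1 (?k' p) * ell 1 (?k' q)"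
    using q unfolding ell_elliptic_modulus[OF p] ell_elliptic_modulus[OF q] ell_elliptic_comodulus[OF p] ell_elliptic_comodulus[OF q]
    by (simp add: p_def power2_eq_square field_simps)
  have epos: "ell 1 (?k p) > 0" "ell 1 (?k q) > 0" "ell 1 (?k' p) > 0" "ell 1 (?k' q) > 0"
    using pos by (auto intro: ell_pos)
  have "\<not> ?k' p < ?k q"
  proof
    assume less: "?k' p < ?k q"
    hence "(?k' p)\<^sup>2 < (?k q)\<^sup>2" using less_imp_le[OF pos(2)] by (rule power_strict_mono) simp
    hence "(?k' q)\<^sup>2 < (?k p)\<^sup>2" using sq by linarith
    hence less': "?k' q < ?k p" by (rule power2_less_imp_less[OF _ less_imp_le[OF pos(1)]])
    have "ell 1 (?k p) < ell 1 (?k' q)" "ell 1 (?k q) < ell 1 (?k' p)"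
      by (rule ell_strict_antimono[OF pos(4) less'], simp) (rule ell_strict_antimono[OF pos(2) less], simp)
    hence "ell 1 (?k p) * ell 1 (?k q) < ell 1 (?k' q) * ell 1 (?k' p)"
      using epos by (intro mult_strict_mono) (simp_all only: less_imp_le)
    thus False using prod by simp
  qed
  moreover have "\<not> ?k q < ?k' p"
  proof
    assume less: "?k q < ?k' p"
    hence "(?k q)\<^sup>2 < (?k' p)\<^sup>2" using less_imp_le[OF pos(3)] by (rule power_strict_mono) simp
    hence "(?k p)\<^sup>2 < (?k' q)\<^sup>2" using sq by linarith
    hence less': "?k p < ?k' q" by (rule power2_less_imp_less[OF _ less_imp_le[OF pos(4)]])
    have "ell 1 (?k' q) < ell 1 (?k p)" "ell 1 (?k' p) < ell 1 (?k q)"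
      by (rule ell_strict_antimono[OF pos(1) less'], simp) (rule ell_strict_antimono[OF pos(3) less], simp)
    hence "ell 1 (?k' q) * ell 1 (?k' p) < ell 1 (?k p) * ell 1 (?k q)"
      using epos by (intro mult_strict_mono) (simp_all only: less_imp_le)
    thus False using prod by simp
  qed
  ultimately show ?thesis by (simp add: p_def)
qed

text \<open>Once the moduli are interchanged, K at the dual nome equals K' at \<open>q\<close>, and
  both are known multiples of the squared theta values.\<close>

lemma theta_inversion:
  assumes q: "0 < q" "q < 1"
  shows "(theta (exp (pi\<^sup>2 / ln q)))\<^sup>2 = (theta q)\<^sup>2 * (- ln q / pi)"
proof -
  have "(theta (exp (pi\<^sup>2 / ln q)))\<^sup>2 * (pi / 2) = (theta q)\<^sup>2 * (- ln q / 2)"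
    using ell_elliptic_comodulus[OF dual_nome[OF q]] ell_elliptic_modulus[OF q] elliptic_comodulus_dual[OF q] by simp
  thus ?thesis by (simp add: field_simps)
qed

section \<open>Values at the fixed point of the inversion\<close>

definition nome_i :: real where "nome_i = exp (- pi)"

lemma nome_i: "0 < nome_i" "nome_i < 1" "\<bar>nome_i\<bar> < 1" "ln nome_i = - pi" "exp (pi\<^sup>2 / ln nome_i) = nome_i"
  by (auto simp: nome_i_def power2_eq_square)

lemma theta2_4_nome_i: "theta2_4 nome_i = theta (- nome_i) ^ 4"
proof -
  have "elliptic_comodulus nome_i = elliptic_modulus nome_i"
    using elliptic_comodulus_dual[OF nome_i(1,2)] nome_i(5) by simp
  hence "(theta (- nome_i))\<^sup>2 = sqrt (theta2_4 nome_i)"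
    using theta_pos[of nome_i] nome_i by (simp add: elliptic_modulus_def elliptic_comodulus_def)
  hence "((theta (- nome_i))\<^sup>2)\<^sup>2 = theta2_4 nome_i"
    using theta2_4_pos[OF nome_i(1,2)] by simp
  thus ?thesis by simp
qed

text \<open>Differentiate \<open>theta_inversion\<close> at its fixed point, where the dual nome has
  derivative -1. The derivative of the factor \<open>- ln q / pi\<close> supplies the inhomogeneous
  term that determines the value.\<close>

lemma theta_log_nome_i: "theta_log nome_i = 1 / (4 * pi)"
proof -
  let ?q = nome_i
  have "2 * theta ?q * (theta' ?q * (- 1)) = 2 * theta ?q * theta' ?q - (theta ?q)\<^sup>2 / (pi * ?q)" (is "?A = ?B")
  proof (rule DERIV_unique)
    have "((\<lambda>q. (theta (exp (pi\<^sup>2 / ln q)))\<^sup>2) has_real_derivative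
       2 * theta (exp (pi\<^sup>2 / ln ?q)) * (theta' (exp (pi\<^sup>2 / ln ?q)) * (exp (pi\<^sup>2 / ln ?q) * (- (pi\<^sup>2 * inverse ?q) / (ln ?q)\<^sup>2)))) (at ?q)"
      using nome_i dual_nome[of ?q] by (auto intro!: derivative_eq_intros simp: power2_eq_square divide_simps)
    thus "((\<lambda>q. (theta (exp (pi\<^sup>2 / ln q)))\<^sup>2) has_real_derivative ?A) (at ?q)"
    proof (rule DERIV_cong)
      have "nome_i * (- (pi\<^sup>2 * inverse nome_i) / (- pi)\<^sup>2) = - 1" using nome_i(1) by simp
      thus "2 * theta (exp (pi\<^sup>2 / ln ?q)) * (theta' (exp (pi\<^sup>2 / ln ?q)) * (exp (pi\<^sup>2 / ln ?q) * (- (pi\<^sup>2 * inverse ?q) / (ln ?q)\<^sup>2))) = ?A"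
        unfolding nome_i(5) unfolding nome_i(4) by (simp only:)
    qed
    have "((\<lambda>q. (theta q)\<^sup>2 * (- ln q / pi)) has_real_derivative ?B) (at ?q)"
      using nome_i by (auto intro!: derivative_eq_intros theta_has_derivative simp: field_simps power2_eq_square)
    thus "((\<lambda>q. (theta (exp (pi\<^sup>2 / ln q)))\<^sup>2) has_real_derivative ?B) (at ?q)"
      by (rule has_field_derivative_transform_within_open[of _ _ _ "{0<..<1}"])
         (use nome_i theta_inversion in auto)
  qed
  hence "4 * theta ?q * theta' ?q = (theta ?q)\<^sup>2 / (pi * ?q)" by simp
  thus ?thesis using theta_pos[OF nome_i(3)] nome_i(1)
    by (simp add: theta_log_def field_simps power2_eq_square)
qed

text \<open>At the fixed point modulus and comodulus agree, so both are \<open>1 / sqrt 2\<close>;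
  scaling by \<open>sqrt 2\<close> then gives the lemniscatic integral.\<close>

lemma theta_nome_i_power4: "theta nome_i ^ 4 = Gamma (1 / 4) ^ 4 / (4 * pi ^ 3)"
proof -
  have k: "elliptic_comodulus nome_i = 1 / sqrt 2"
  proof -
    have "elliptic_comodulus nome_i = elliptic_modulus nome_i"
      using elliptic_comodulus_dual[OF nome_i(1,2)] nome_i(5) by simp
    hence "(elliptic_comodulus nome_i)\<^sup>2 = (1 / sqrt 2)\<^sup>2"
      using elliptic_modulus_square[OF nome_i(1,2)] by (simp add: power_divide)
    thus ?thesis
      by (rule power2_eq_imp_eq[OF _ less_imp_le[OF elliptic_modulus_pos(2)[OF nome_i(1,2)]]]) simp
  qed
  have "(theta nome_i)\<^sup>2 * (pi / 2) = ell ((1 / sqrt 2) * sqrt 2) ((1 / sqrt 2) * 1)"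
    using ell_elliptic_comodulus[OF nome_i(1,2)] k by simp
  also have "\<dots> = ell (sqrt 2) 1 / (1 / sqrt 2)" by (intro ell_scale) auto
  also have "\<dots> = Gamma (1 / 4) ^ 2 / (4 * sqrt (2 * pi)) * sqrt 2"
    using ell_lemniscate by (simp add: ell_commute)
  also have "\<dots> = Gamma (1 / 4) ^ 2 / (4 * sqrt pi)" by (simp add: real_sqrt_mult)
  finally have "(theta nome_i)\<^sup>2 = Gamma (1 / 4) ^ 2 / (2 * pi * sqrt pi)" by (simp add: field_simps)
  hence "((theta nome_i)\<^sup>2)\<^sup>2 = (Gamma (1 / 4) ^ 2 / (2 * pi * sqrt pi))\<^sup>2" by simp
  thus ?thesis by (simp add: power_divide power_mult_distrib power2_eq_square[of pi] power3_eq_cube flip: power_mult)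
qed

subsection \<open>Iterated derivatives along the imaginary axis\<close>

definition serre_eval :: "nat \<Rightarrow> real \<Rightarrow> real" where
  "serre_eval n = poly (map_poly of_int (serre_seq 12 0 1 n))"

lemma serre_eval_0: "serre_eval 0 x = 1"
  by (simp add: serre_eval_def)

lemma serre_eval_at_0: "serre_eval n 0 = of_int (dseq n)"
  by (simp add: serre_eval_def dseq_def poly_0_coeff_0 coeff_map_poly)

definition serre_eval' :: "nat \<Rightarrow> real \<Rightarrow> real" where
  "serre_eval' n = poly (pderiv (map_poly of_int (serre_seq 12 0 1 n)))"

lemma serre_eval_has_derivative: "(serre_eval n has_real_derivative serre_eval' n x) (at x)"
  unfolding serre_eval_def serre_eval'_def by (rule poly_DERIV)

lemma serre_eval_Suc:
  "serre_eval (Suc n) x = 6 * (x\<^sup>2 - 1) * serre_eval' n x - 2 * real n * x * serre_eval n x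
     - real (n * (n + 11)) * serre_eval (n - 1) x"
proof -
  let ?p = "\<lambda>n. map_poly real_of_int (serre_seq 12 0 1 n)"
  have eq: "?p (Suc n) = [:-6, 0, 6:] * pderiv (?p n) - [:0, 2 * real n:] * ?p n - smult (real (n * (n + 11))) (?p (n - 1))"
  proof (rule poly_eqI)
    fix j
    have c: "coeff (?p m) i = of_int (coeff (serre_seq 12 0 1 m) i)" for m i by (simp add: coeff_map_poly)
    consider "j = 0" | "j = 1" | i where "j = Suc (Suc i)" by (metis One_nat_def not0_implies_Suc)
    thus "coeff (?p (Suc n)) j = coeff ([:-6, 0, 6:] * pderiv (?p n) - [:0, 2 * real n:] * ?p n - smult (real (n * (n + 11))) (?p (n - 1))) j"
      by cases (auto simp: c coeff_serre_seq_Suc coeff_pderiv algebra_simps)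
  qed
  show ?thesis unfolding serre_eval_def serre_eval'_def eq by (simp add: power2_eq_square algebra_simps)
qed

text \<open>The coefficients that express the n-th plain derivative of a form of weight 12 through
  iterated Serre derivatives and powers of E_2. The factorials leave the product (k + 12) ... (n +
  11).\<close>

definition bol_coeff :: "nat \<Rightarrow> nat \<Rightarrow> real" where
  "bol_coeff n k = real (n choose k) * fact (n + 11) / fact (k + 11)"

lemma fact_add_12: "(fact (n + 12) :: real) = (real n + 12) * fact (n + 11)"
proof -
  have e: "n + 12 = Suc (n + 11)" by simp
  show ?thesis unfolding e fact_Suc by simp
qed

lemma bol_coeff_self [simp]: "bol_coeff n n = 1"
  by (simp add: bol_coeff_def)

text \<open>This relation cancels the terms with \<open>(V s)\<^sup>2\<close> in
  \<open>iterated_derivative\<close>: those from differentiating a power of \<open>P\<close> against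
  those from the back reference in the recursion.\<close>

lemma bol_coeff_shift:
  assumes "k < n"
  shows "bol_coeff n (Suc k) * (real (Suc k) * real (Suc k + 11)) = real (n - k) * bol_coeff n k"
proof -
  have "real (n choose Suc k) * real (Suc k) = real (n choose k) * real (n - k)"
  proof -
    have "(n choose Suc k) * Suc k = (n choose k) * (n - k)"
      using binomial_absorption[of k n] binomial_absorb_comp[of n k] assms
      by (metis Suc_times_binomial_eq binomial_absorb_comp mult.commute Suc_pred less_imp_Suc_add zero_less_diff diff_Suc_1 gr_implies_not0 not0_implies_Suc)
    thus ?thesis unfolding of_nat_mult[symmetric] by simp
  qed
  moreover have "(fact (Suc k + 11) :: real) = real (Suc k + 11) * fact (k + 11)"
    using fact_add_12[of k] by (simp add: add_ac)
  ultimately show ?thesis unfolding bol_coeff_def by (simp add: field_simps del: fact_Suc of_nat_Suc of_nat_add)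
qed

lemma bol_coeff_Suc_0: "bol_coeff (Suc n) 0 = bol_coeff n 0 * (12 + real n)"
  using fact_add_12[of n] by (simp add: bol_coeff_def add_ac mult_ac)

lemma bol_coeff_Suc_Suc:
  assumes "k < n"
  shows "bol_coeff (Suc n) (Suc k) = bol_coeff n (Suc k) * (12 + real n + real (Suc k)) + bol_coeff n k"
proof -
  have nk: "real (n - k) > 0" using assms by simp
  have 1: "bol_coeff n k = bol_coeff n (Suc k) * (real (Suc k) * real (Suc k + 11)) / real (n - k)"
    using bol_coeff_shift[OF assms] nk by (simp add: field_simps)
  have "real (Suc n choose Suc k) * real (n - k) = real (n choose Suc k) * real (Suc n)"
  proof -
    have "(Suc n choose Suc k) * (Suc n - Suc k) = Suc n * (n choose Suc k)"
      using binomial_absorb_comp[of "Suc n" "Suc k"] by (simp add: mult.commute)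
    thus ?thesis unfolding of_nat_mult[symmetric] by (simp add: mult.commute)
  qed
  hence "bol_coeff (Suc n) (Suc k) * real (n - k) = bol_coeff n (Suc k) * (real (Suc n) * real (Suc n + 11))"
  proof -
    have f: "(fact (Suc n + 11) :: real) = real (Suc n + 11) * fact (n + 11)"
      using fact_add_12[of n] by (simp add: add_ac)
    have "bol_coeff (Suc n) (Suc k) * real (n - k) =
        (real (Suc n choose Suc k) * real (n - k)) * fact (Suc n + 11) / fact (Suc k + 11)"
      by (simp only: bol_coeff_def times_divide_eq_left times_divide_eq_right mult_ac)
    also have "\<dots> = bol_coeff n (Suc k) * (real (Suc n) * real (Suc n + 11))"
      unfolding f \<open>real (Suc n choose Suc k) * real (n - k) = real (n choose Suc k) * real (Suc n)\<close>
      by (simp only: bol_coeff_def times_divide_eq_left times_divide_eq_right mult_ac)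
    finally show ?thesis .
  qed
  hence 2: "bol_coeff (Suc n) (Suc k) = bol_coeff n (Suc k) * (real (Suc n) * real (Suc n + 11)) / real (n - k)"
    using nk by (simp add: field_simps)
  have nk': "real (n - k) = real n - real k" using assms by simp
  have "real (Suc n) * real (Suc n + 11) = (12 + real n + real (Suc k)) * real (n - k) + real (Suc k) * real (Suc k + 11)"
    unfolding nk' by (simp add: algebra_simps)
  thus ?thesis unfolding 1 2 using nk by (simp add: field_simps)
qed

text \<open>In modular terms \<open>P\<close>, \<open>V\<^sup>2\<close> and \<open>V\<^sup>3 t\<close> are the Eisenstein series of weight 2, 4 and 6,
  and the powers of \<open>P\<close> measure the difference between iterated plain and iterated Serre derivatives.\<close>
lemma iterated_derivative:
  fixes \<phi> P V t :: "real \<Rightarrow> real"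
  assumes \<phi>: "(\<phi> has_real_derivative \<kappa> * (12 * P s * \<phi> s)) (at s)"
    and P: "(P has_real_derivative \<kappa> * ((P s)\<^sup>2 - (V s)\<^sup>2)) (at s)"
    and V: "(V has_real_derivative \<kappa> * (2 * (P s * V s - (V s)\<^sup>2 * t s))) (at s)"
    and t: "(t has_real_derivative \<kappa> * (6 * V s * ((t s)\<^sup>2 - 1))) (at s)"
  defines "\<Phi> \<equiv> \<lambda>n s. \<phi> s * (\<Sum>k\<le>n. bol_coeff n k * P s ^ (n - k) * (V s ^ k * serre_eval k (t s)))"
  shows "(\<Phi> n has_real_derivative \<kappa> * \<Phi> (Suc n) s) (at s)"
proof -
  define g where "g = (\<lambda>k s. V s ^ k * serre_eval k (t s))"
  have g: "(g k has_real_derivative \<kappa> * (2 * real k * P s * g k s + g (Suc k) s + real (k * (k + 11)) * (V s)\<^sup>2 * g (k - 1) s)) (at s)" for k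
  proof -
    have "(g k has_real_derivative real k * V s ^ (k - 1) * (\<kappa> * (2 * (P s * V s - (V s)\<^sup>2 * t s))) * serre_eval k (t s)
        + serre_eval' k (t s) * (\<kappa> * (6 * V s * ((t s)\<^sup>2 - 1))) * V s ^ k) (at s)"
      unfolding g_def
      by (rule DERIV_cong, rule DERIV_mult[OF DERIV_power[OF V, of k] DERIV_chain2[OF serre_eval_has_derivative t, of k]])
         (simp add: algebra_simps)
    moreover have "real k * V s ^ (k - 1) * (\<kappa> * (2 * (P s * V s - (V s)\<^sup>2 * t s))) * serre_eval k (t s)
        + serre_eval' k (t s) * (\<kappa> * (6 * V s * ((t s)\<^sup>2 - 1))) * V s ^ k =
        \<kappa> * (2 * real k * P s * g k s + g (Suc k) s + real (k * (k + 11)) * (V s)\<^sup>2 * g (k - 1) s)"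
      unfolding g_def serre_eval_Suc
      by (cases k) (simp_all add: power2_eq_square algebra_simps)
    ultimately show ?thesis by simp
  qed
  \<comment> \<open>The terms \<open>A k\<close> carry the powers of \<open>P\<close> wanted at
    stage \<open>Suc n\<close>; the terms \<open>B k\<close> carry the extra factor
    \<open>(V s)\<^sup>2\<close> and must cancel.\<close>
  define A where "A = (\<lambda>k. P s ^ (Suc n - k) * g k s)"
  define B where "B = (\<lambda>k. P s ^ (n - 1 - k) * (V s)\<^sup>2 * g k s)"
  let ?c = "bol_coeff n"
  have D: "((\<lambda>s. bol_coeff n k * P s ^ (n - k) * g k s) has_real_derivative
      \<kappa> * (?c k * (real n + real k) * A k + ?c k * A (Suc k) - ?c k * real (n - k) * B k
        + ?c k * (real k * real (k + 11)) * B (k - 1))) (at s)" if "k \<le> n" for k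
  proof -
    have "((\<lambda>s. bol_coeff n k * P s ^ (n - k) * g k s) has_real_derivative
       (?c k * (real (n - k) * P s ^ (n - k - 1) * (\<kappa> * ((P s)\<^sup>2 - (V s)\<^sup>2)))) * g k s +
       (\<kappa> * (2 * real k * P s * g k s + g (Suc k) s + real (k * (k + 11)) * (V s)\<^sup>2 * g (k - 1) s)) * (?c k * P s ^ (n - k))) (at s)"
      by (rule DERIV_cong, rule DERIV_mult[OF DERIV_cmult[OF DERIV_power[OF P, of "n - k"], of "?c k"] g[of k]])
         (simp add: algebra_simps)
    moreover have "(?c k * (real (n - k) * P s ^ (n - k - 1) * (\<kappa> * ((P s)\<^sup>2 - (V s)\<^sup>2)))) * g k s +
       (\<kappa> * (2 * real k * P s * g k s + g (Suc k) s + real (k * (k + 11)) * (V s)\<^sup>2 * g (k - 1) s)) * (?c k * P s ^ (n - k)) =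
       \<kappa> * (?c k * (real n + real k) * A k + ?c k * A (Suc k) - ?c k * real (n - k) * B k
        + ?c k * (real k * real (k + 11)) * B (k - 1))"
    proof -
      have p1: "real (n - k) * P s ^ (n - k - 1) * (P s)\<^sup>2 = real (n - k) * P s ^ (Suc n - k)"
      proof (cases "n - k")
        case (Suc r)
        hence "Suc n - k = Suc (Suc r)" by simp
        thus ?thesis using Suc by (simp add: power2_eq_square)
      qed simp
      have p2: "P s * P s ^ (n - k) = P s ^ (Suc n - k)" using that by (simp add: Suc_diff_le)
      have p3: "real k * P s ^ (n - k) = real k * P s ^ (n - 1 - (k - 1))" by (cases k) auto
      have p4: "n - 1 - k = n - k - 1" "Suc n - Suc k = n - k" by auto
      have nk: "real n = real (n - k) + real k" using that by simp
      have "(?c k * (real (n - k) * P s ^ (n - k - 1) * (\<kappa> * ((P s)\<^sup>2 - (V s)\<^sup>2)))) * g k s =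
        \<kappa> * (?c k * (real (n - k) * P s ^ (n - k - 1) * (P s)\<^sup>2) * g k s - ?c k * real (n - k) * B k)"
        unfolding B_def p4 by (simp add: algebra_simps)
      also have "\<dots> = \<kappa> * (?c k * real (n - k) * A k - ?c k * real (n - k) * B k)"
        unfolding p1 A_def by (simp add: algebra_simps)
      finally have e1: "(?c k * (real (n - k) * P s ^ (n - k - 1) * (\<kappa> * ((P s)\<^sup>2 - (V s)\<^sup>2)))) * g k s = \<dots>" .
      have "(\<kappa> * (2 * real k * P s * g k s + g (Suc k) s + real (k * (k + 11)) * (V s)\<^sup>2 * g (k - 1) s)) * (?c k * P s ^ (n - k))
        = \<kappa> * (?c k * (2 * real k) * (P s * P s ^ (n - k)) * g k s + ?c k * (P s ^ (n - k) * g (Suc k) s)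
            + ?c k * real (k + 11) * (real k * P s ^ (n - k)) * (V s)\<^sup>2 * g (k - 1) s)"
        by (simp add: algebra_simps)
      also have "\<dots> = \<kappa> * (?c k * (2 * real k) * A k + ?c k * A (Suc k) + ?c k * (real k * real (k + 11)) * B (k - 1))"
        unfolding p2 p3 A_def B_def p4(2) by (simp add: algebra_simps)
      finally have e2: "(\<kappa> * (2 * real k * P s * g k s + g (Suc k) s + real (k * (k + 11)) * (V s)\<^sup>2 * g (k - 1) s)) * (?c k * P s ^ (n - k)) = \<dots>" .
      show ?thesis unfolding e1 e2 nk by (simp add: algebra_simps)
    qed
    ultimately show ?thesis by simp
  qed
  have key: "12 * P s * (\<Sum>k\<le>n. ?c k * P s ^ (n - k) * g k s) +
     (\<Sum>k\<le>n. ?c k * (real n + real k) * A k + ?c k * A (Suc k) - ?c k * real (n - k) * B k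
        + ?c k * (real k * real (k + 11)) * B (k - 1)) = (\<Sum>k\<le>Suc n. bol_coeff (Suc n) k * A k)"
  proof -
    have "12 * P s * (\<Sum>k\<le>n. ?c k * P s ^ (n - k) * g k s) = (\<Sum>k\<le>n. ?c k * 12 * A k)"
      unfolding sum_distrib_left A_def by (intro sum.cong refl) (simp add: Suc_diff_le)
    moreover have "(\<Sum>k\<le>n. ?c k * (real k * real (k + 11)) * B (k - 1)) = (\<Sum>k\<le>n. ?c k * real (n - k) * B k)"
    proof (cases n)
      case 0
      thus ?thesis by simp
    next
      case (Suc m)
      have "(\<Sum>k\<le>n. ?c k * (real k * real (k + 11)) * B (k - 1)) = (\<Sum>k\<le>m. ?c (Suc k) * (real (Suc k) * real (Suc k + 11)) * B k)"
        unfolding Suc by (subst sum.atMost_Suc_shift) simp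
      also have "\<dots> = (\<Sum>k\<le>m. real (n - k) * ?c k * B k)"
        by (intro sum.cong refl, subst bol_coeff_shift) (auto simp: Suc)
      also have "\<dots> = (\<Sum>k\<le>n. ?c k * real (n - k) * B k)"
        unfolding Suc by (simp add: mult_ac)
      finally show ?thesis .
    qed
    moreover have "(\<Sum>k\<le>n. ?c k * 12 * A k) + (\<Sum>k\<le>n. ?c k * (real n + real k) * A k) + (\<Sum>k\<le>n. ?c k * A (Suc k))
       = (\<Sum>k\<le>Suc n. bol_coeff (Suc n) k * A k)"
    proof (cases n)
      case 0
      thus ?thesis by (simp add: bol_coeff_Suc_0)
    next
      case (Suc m)
      have "(\<Sum>k\<le>n. ?c k * 12 * A k) + (\<Sum>k\<le>n. ?c k * (real n + real k) * A k) = (\<Sum>k\<le>n. ?c k * (12 + real n + real k) * A k)"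
        by (simp add: sum.distrib[symmetric] algebra_simps)
      also have "\<dots> = ?c 0 * (12 + real n) * A 0 + (\<Sum>k\<le>m. ?c (Suc k) * (12 + real n + real (Suc k)) * A (Suc k))"
        unfolding Suc by (subst sum.atMost_Suc_shift) simp
      finally have "(\<Sum>k\<le>n. ?c k * 12 * A k) + (\<Sum>k\<le>n. ?c k * (real n + real k) * A k) + (\<Sum>k\<le>n. ?c k * A (Suc k)) =
         ?c 0 * (12 + real n) * A 0 + (\<Sum>k\<le>m. ?c (Suc k) * (12 + real n + real (Suc k)) * A (Suc k))
         + ((\<Sum>k\<le>m. ?c k * A (Suc k)) + A (Suc n))" by (simp add: Suc)
      also have "\<dots> = bol_coeff (Suc n) 0 * A 0 + ((\<Sum>k\<le>m. bol_coeff (Suc n) (Suc k) * A (Suc k)) + bol_coeff (Suc n) (Suc n) * A (Suc n))"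
      proof -
        have "bol_coeff (Suc n) (Suc k) * A (Suc k) = ?c (Suc k) * (12 + real n + real (Suc k)) * A (Suc k) + ?c k * A (Suc k)"
          if "k \<le> m" for k
          using bol_coeff_Suc_Suc[of k n] that Suc by (simp add: algebra_simps)
        hence "(\<Sum>k\<le>m. bol_coeff (Suc n) (Suc k) * A (Suc k)) =
           (\<Sum>k\<le>m. ?c (Suc k) * (12 + real n + real (Suc k)) * A (Suc k)) + (\<Sum>k\<le>m. ?c k * A (Suc k))"
          by (simp add: sum.distrib[symmetric])
        thus ?thesis by (simp add: bol_coeff_Suc_0)
      qed
      also have "\<dots> = (\<Sum>k\<le>Suc n. bol_coeff (Suc n) k * A k)"
        by (subst sum.atMost_Suc_shift) (simp add: Suc)
      finally show ?thesis .
    qed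
    ultimately show ?thesis by (simp add: sum.distrib sum_subtractf)
  qed
  have "(\<Phi> n has_real_derivative \<kappa> * (12 * P s * \<phi> s) * (\<Sum>k\<le>n. ?c k * P s ^ (n - k) * g k s) +
     (\<Sum>k\<le>n. \<kappa> * (?c k * (real n + real k) * A k + ?c k * A (Suc k) - ?c k * real (n - k) * B k
        + ?c k * (real k * real (k + 11)) * B (k - 1))) * \<phi> s) (at s)"
  proof -
    have e: "\<Phi> n = (\<lambda>s. \<phi> s * (\<Sum>k\<le>n. ?c k * P s ^ (n - k) * g k s))" by (simp add: \<Phi>_def g_def)
    have d: "((\<lambda>s. \<Sum>k\<le>n. ?c k * P s ^ (n - k) * g k s) has_real_derivative
       (\<Sum>k\<le>n. \<kappa> * (?c k * (real n + real k) * A k + ?c k * A (Suc k) - ?c k * real (n - k) * B k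
        + ?c k * (real k * real (k + 11)) * B (k - 1)))) (at s)"
      by (rule DERIV_sum, rule D) simp
    show ?thesis unfolding e by (rule DERIV_mult[OF \<phi> d])
  qed
  also have "\<kappa> * (12 * P s * \<phi> s) * (\<Sum>k\<le>n. ?c k * P s ^ (n - k) * g k s) +
     (\<Sum>k\<le>n. \<kappa> * (?c k * (real n + real k) * A k + ?c k * A (Suc k) - ?c k * real (n - k) * B k
        + ?c k * (real k * real (k + 11)) * B (k - 1))) * \<phi> s =
     \<kappa> * \<phi> s * (12 * P s * (\<Sum>k\<le>n. ?c k * P s ^ (n - k) * g k s) +
     (\<Sum>k\<le>n. ?c k * (real n + real k) * A k + ?c k * A (Suc k) - ?c k * real (n - k) * B k
        + ?c k * (real k * real (k + 11)) * B (k - 1)))"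
    unfolding sum_distrib_left[symmetric] by (simp only: distrib_left mult_ac)
  also have "\<dots> = \<kappa> * \<Phi> (Suc n) s"
    unfolding key by (simp add: \<Phi>_def A_def g_def mult_ac)
  finally show ?thesis .
qed

section \<open>The expansion at \<open>\<i>\<close>\<close>

subsection \<open>Ramanujan's equations in the disc coordinate\<close>

text \<open>For B = theta_4^4, C = theta_2^4, B + C = theta_3^4 and \<open>\<Omega>\<close> the
  logarithmic derivative of theta_3, the functions P, V^2 and R are the classical expressions for
  E_2, E_4 and E_6, and ((B + C) B C)^2 is 256 Delta. The abstract form with \<open>\<kappa>\<close>
  allows the same equations to be used after the passage to the disc.\<close>

lemma serre_ode:
  fixes \<Omega> B C :: "real \<Rightarrow> real"
  assumes \<Omega>: "(\<Omega> has_real_derivative \<kappa> * (12 * (\<Omega> s)\<^sup>2 + 3 / 4 * B s * C s)) (at s)"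
    and B: "(B has_real_derivative \<kappa> * (24 * B s * \<Omega> s - 6 * B s * C s)) (at s)"
    and C: "(C has_real_derivative \<kappa> * (24 * C s * \<Omega> s + 6 * B s * C s)) (at s)"
    and pos: "B s > 0" "C s > 0"
  defines "P \<equiv> \<lambda>s. 12 * \<Omega> s + B s - C s"
  defines "V \<equiv> \<lambda>s. sqrt ((B s)\<^sup>2 + B s * C s + (C s)\<^sup>2)"
  defines "R \<equiv> \<lambda>s. (B s - C s) * (2 * B s + C s) * (B s + 2 * C s) / 2"
  defines "t \<equiv> \<lambda>s. R s / V s ^ 3"
  shows "(P has_real_derivative \<kappa> * ((P s)\<^sup>2 - (V s)\<^sup>2)) (at s)"
    "(V has_real_derivative \<kappa> * (2 * (P s * V s - (V s)\<^sup>2 * t s))) (at s)"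
    "(t has_real_derivative \<kappa> * (6 * V s * ((t s)\<^sup>2 - 1))) (at s)"
    "((\<lambda>s. c * ((B s + C s) * B s * C s)\<^sup>2) has_real_derivative \<kappa> * (12 * P s * (c * ((B s + C s) * B s * C s)\<^sup>2))) (at s)"
proof -
  have Qpos: "(B s)\<^sup>2 + B s * C s + (C s)\<^sup>2 > 0" using pos by (intro add_pos_pos) auto
  have V2: "(V s)\<^sup>2 = (B s)\<^sup>2 + B s * C s + (C s)\<^sup>2" unfolding V_def using Qpos by simp
  have Vpos: "V s > 0" unfolding V_def using Qpos by simp
  have V4: "V s ^ 4 = ((B s)\<^sup>2 + B s * C s + (C s)\<^sup>2)\<^sup>2" unfolding V2[symmetric] by simp
  show "(P has_real_derivative \<kappa> * ((P s)\<^sup>2 - (V s)\<^sup>2)) (at s)"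
    unfolding V2 unfolding P_def
    by (auto intro!: derivative_eq_intros \<Omega> B C simp: power2_eq_square algebra_simps)
  have Q: "((\<lambda>s. (B s)\<^sup>2 + B s * C s + (C s)\<^sup>2) has_real_derivative \<kappa> * (4 * (P s * (V s)\<^sup>2 - R s))) (at s)"
    unfolding V2 unfolding P_def R_def
    by (auto intro!: derivative_eq_intros \<Omega> B C simp: power2_eq_square field_simps)
  have R: "(R has_real_derivative \<kappa> * (6 * (P s * R s - V s ^ 4))) (at s)"
    unfolding V4 unfolding P_def R_def
    by (auto intro!: derivative_eq_intros \<Omega> B C simp: power2_eq_square field_simps)
  have dV: "(V has_real_derivative inverse (V s) / 2 * (\<kappa> * (4 * (P s * (V s)\<^sup>2 - R s)))) (at s)"
    unfolding V_def by (rule DERIV_chain2[OF DERIV_real_sqrt Q[unfolded V_def]]) (use Qpos in simp)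
  have Rt: "R s = t s * V s ^ 3" using Vpos by (simp add: t_def)
  have eq: "inverse (V s) / 2 * (\<kappa> * (4 * (P s * (V s)\<^sup>2 - t s * V s ^ 3))) = \<kappa> * (2 * (P s * V s - (V s)\<^sup>2 * t s))"
    using Vpos by (simp add: field_simps power2_eq_square power3_eq_cube)
  show V: "(V has_real_derivative \<kappa> * (2 * (P s * V s - (V s)\<^sup>2 * t s))) (at s)"
    using dV unfolding Rt eq .
  have "(t has_real_derivative (\<kappa> * (6 * (P s * R s - V s ^ 4)) * V s ^ 3 -
      R s * (real 3 * V s ^ (3 - 1) * (\<kappa> * (2 * (P s * V s - (V s)\<^sup>2 * t s))))) / (V s ^ 3 * V s ^ 3)) (at s)"
    unfolding t_def[abs_def] by (rule DERIV_divide[OF R DERIV_cong[OF DERIV_power[OF V, of 3]]]) (use Vpos in \<open>simp_all add: t_def\<close>)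
  moreover have "(\<kappa> * (6 * (p * (u * v ^ 3) - v ^ 4)) * v ^ 3 -
      (u * v ^ 3) * (real 3 * v ^ (3 - 1) * (\<kappa> * (2 * (p * v - v\<^sup>2 * u))))) / (v ^ 3 * v ^ 3) = \<kappa> * (6 * v * (u\<^sup>2 - 1))"
    if "v > 0" for p u v :: real
    using that by (simp add: divide_simps) (simp add: algebra_simps power2_eq_square eval_nat_numeral)
  note this[OF Vpos, of "P s" "t s", folded Rt]
  ultimately show "(t has_real_derivative \<kappa> * (6 * V s * ((t s)\<^sup>2 - 1))) (at s)" by simp
  show "((\<lambda>s. c * ((B s + C s) * B s * C s)\<^sup>2) has_real_derivative \<kappa> * (12 * P s * (c * ((B s + C s) * B s * C s)\<^sup>2))) (at s)"
    unfolding P_def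
    by (auto intro!: derivative_eq_intros \<Omega> B C simp: power2_eq_square algebra_simps)
qed

text \<open>This is exp(-pi y) at y = (1 + s) / (1 - s), the height on the imaginary axis to which
  \<open>sigma_i\<close> sends the real point \<open>s\<close> of the disc.\<close>

definition nome :: "real \<Rightarrow> real" where
  "nome s = exp (- pi * (1 + s) / (1 - s))"

lemma nome_bounds: "s \<in> {-1<..<1} \<Longrightarrow> 0 < nome s" "s \<in> {-1<..<1} \<Longrightarrow> nome s < 1"
  by (auto simp: nome_def divide_neg_pos mult_neg_pos)

lemma nome_0: "nome 0 = nome_i" by (simp add: nome_def nome_i_def)

lemma nome_has_derivative:
  "s \<in> {-1<..<1} \<Longrightarrow> (nome has_real_derivative nome s * (- (2 * pi) / (1 - s)\<^sup>2)) (at s)"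
  unfolding nome_def[abs_def]
  by (auto intro!: derivative_eq_intros) (simp add: field_simps power2_eq_square)

definition disc_B :: "real \<Rightarrow> real" where "disc_B s = theta (- nome s) ^ 4 / (1 - s)\<^sup>2"
definition disc_C :: "real \<Rightarrow> real" where "disc_C s = theta2_4 (nome s) / (1 - s)\<^sup>2"
text \<open>The division by \<open>(1 - s)\<^sup>2\<close> is the automorphy factor of weight 2, and
  the subtracted term is the quasimodular correction. With it the differential equations keep their
  form, and \<open>theta_log_nome_i\<close> makes the value at 0 vanish.\<close>

definition disc_Omega :: "real \<Rightarrow> real" where
  "disc_Omega s = theta_log (nome s) / (1 - s)\<^sup>2 - 1 / (4 * pi * (1 - s))"

lemma disc_pos:
  assumes "s \<in> {-1<..<1}" shows "disc_B s > 0" "disc_C s > 0"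
  using nome_bounds[OF assms] theta_pos[of "- nome s"] theta2_4_pos[of "nome s"] assms
  by (auto simp: disc_B_def disc_C_def intro!: divide_pos_pos)

text \<open>The derivative of \<open>nome\<close> contributes
  \<open>- (2 * pi) / (1 - s)\<^sup>2\<close>, whose denominator goes into the weights. The
  equations of \<open>serre_ode\<close> are six times those for \<open>q\<close> d/dq, so
  \<open>6 * \<kappa> = - 2 * pi\<close>.\<close>

lemma disc_ode:
  assumes s: "s \<in> {-1<..<1}"
  defines "\<kappa> \<equiv> - pi / 3"
  shows "(disc_Omega has_real_derivative \<kappa> * (12 * (disc_Omega s)\<^sup>2 + 3 / 4 * disc_B s * disc_C s)) (at s)"
    "(disc_B has_real_derivative \<kappa> * (24 * disc_B s * disc_Omega s - 6 * disc_B s * disc_C s)) (at s)"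
    "(disc_C has_real_derivative \<kappa> * (24 * disc_C s * disc_Omega s + 6 * disc_B s * disc_C s)) (at s)"
proof -
  define q where "q = nome s"
  define u where "u = 1 - s"
  define b c w where "b = theta (- q) ^ 4" and "c = theta2_4 q" and "w = theta_log q"
  have q: "0 < q" "q < 1" using nome_bounds[OF s] by (auto simp: q_def)
  have u: "u > 0" using s by (simp add: u_def)
  let ?d = "- (2 * pi) / u\<^sup>2"
  have dn: "(nome has_real_derivative q * ?d) (at s)" using nome_has_derivative[OF s] by (simp add: q_def u_def)
  have w1: "((\<lambda>s. theta_log (nome s)) has_real_derivative theta_log' q * (q * ?d)) (at s)"
    using q unfolding q_def by (intro theta_log_comp_has_derivative dn[unfolded q_def]) auto
  have w2: "theta_log' q * (q * ?d) = (2 * w\<^sup>2 + b * c / 8) * ?d"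
  proof -
    have "theta_log' q * (q * ?d) = (q * theta_log' q) * ?d" by (simp only: mult_ac)
    thus ?thesis unfolding theta_log_ode[OF q] b_def c_def w_def .
  qed
  have dw: "((\<lambda>s. theta_log (nome s)) has_real_derivative (2 * w\<^sup>2 + b * c / 8) * ?d) (at s)" using w1 unfolding w2 .
  have b1: "((\<lambda>s. theta (- nome s) ^ 4) has_real_derivative real 4 * theta (- q) ^ (4 - 1) * (theta' (- q) * - (q * ?d))) (at s)"
    by (rule DERIV_cong[OF DERIV_power[OF theta_comp_has_derivative[OF DERIV_minus[OF dn]]]]) (use q in \<open>auto simp: q_def\<close>)
  have b2: "real 4 * theta (- q) ^ (4 - 1) * (theta' (- q) * - (q * ?d)) = (4 * b * w - b * c) * ?d"
  proof -
    have "- q * theta' (- q) = theta (- q) * (w - c / 4)"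
      using theta'_eq[of "- q"] theta_log_diff[OF q] q by (simp add: w_def c_def)
    moreover have "real 4 * theta (- q) ^ (4 - 1) * (theta' (- q) * - (q * ?d)) = 4 * theta (- q) ^ 3 * (- q * theta' (- q)) * ?d"
      by simp
    ultimately have "real 4 * theta (- q) ^ (4 - 1) * (theta' (- q) * - (q * ?d)) = 4 * theta (- q) ^ 3 * (theta (- q) * (w - c / 4)) * ?d"
      by (simp only:)
    thus ?thesis by (simp add: b_def power3_eq_cube eval_nat_numeral algebra_simps)
  qed
  have db: "((\<lambda>s. theta (- nome s) ^ 4) has_real_derivative (4 * b * w - b * c) * ?d) (at s)" using b1 unfolding b2 .
  have a1: "((\<lambda>s. theta (nome s) ^ 4) has_real_derivative real 4 * theta q ^ (4 - 1) * (theta' q * (q * ?d))) (at s)"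
    by (rule DERIV_cong[OF DERIV_power[OF theta_comp_has_derivative[OF dn]]]) (use q in \<open>auto simp: q_def\<close>)
  have a2: "real 4 * theta q ^ (4 - 1) * (theta' q * (q * ?d)) = 4 * (b + c) * w * ?d"
  proof -
    have "real 4 * theta q ^ (4 - 1) * (theta' q * (q * ?d)) = 4 * theta q ^ 3 * (q * theta' q) * ?d" by simp
    also have "q * theta' q = theta q * w" using theta'_eq[of q] q by (simp add: w_def)
    finally show ?thesis by (simp add: b_def c_def theta2_4_def power3_eq_cube eval_nat_numeral algebra_simps)
  qed
  have da: "((\<lambda>s. theta (nome s) ^ 4) has_real_derivative 4 * (b + c) * w * ?d) (at s)" using a1 unfolding a2 .
  have dc: "((\<lambda>s. theta2_4 (nome s)) has_real_derivative (4 * c * w + b * c) * ?d) (at s)"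
    unfolding theta2_4_def by (rule DERIV_cong[OF DERIV_diff[OF da db]]) (simp add: algebra_simps)
  have du: "((\<lambda>s. (1 - s)\<^sup>2) has_real_derivative - 2 * u) (at s)"
    by (auto intro!: derivative_eq_intros simp: u_def)
  have v: "disc_B s = b / u\<^sup>2" "disc_C s = c / u\<^sup>2" "disc_Omega s = w / u\<^sup>2 - 1 / (4 * pi * u)"
    by (simp_all add: disc_B_def disc_C_def disc_Omega_def b_def c_def w_def u_def q_def)
  have n: "theta (- nome s) ^ 4 = b" "theta2_4 (nome s) = c" "theta_log (nome s) = w" "(1 - s)\<^sup>2 = u\<^sup>2"
    by (simp_all add: b_def c_def w_def u_def q_def)
  have pi: "pi > 0" by simp
  have pi0: "pi \<noteq> 0" by simp
  show "(disc_B has_real_derivative \<kappa> * (24 * disc_B s * disc_Omega s - 6 * disc_B s * disc_C s)) (at s)"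
    unfolding disc_B_def[abs_def] v[unfolded disc_B_def]
    by (rule DERIV_cong[OF DERIV_divide[OF db du]])
       (use u pi0 in \<open>simp_all add: n \<kappa>_def divide_simps v[unfolded disc_B_def] u_def[symmetric]\<close>, simp_all add: algebra_simps power2_eq_square eval_nat_numeral)
  show "(disc_C has_real_derivative \<kappa> * (24 * disc_C s * disc_Omega s + 6 * disc_B s * disc_C s)) (at s)"
    unfolding disc_C_def[abs_def] v[unfolded disc_C_def]
    by (rule DERIV_cong[OF DERIV_divide[OF dc du]])
       (use u pi0 in \<open>simp_all add: n \<kappa>_def divide_simps v[unfolded disc_C_def] u_def[symmetric]\<close>, simp_all add: algebra_simps power2_eq_square eval_nat_numeral)
  have dv: "((\<lambda>s. 1 / (4 * pi * (1 - s))) has_real_derivative 1 / (4 * pi * u\<^sup>2)) (at s)"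
    using u by (auto intro!: derivative_eq_intros simp: u_def power2_eq_square divide_simps)
  show "(disc_Omega has_real_derivative \<kappa> * (12 * (disc_Omega s)\<^sup>2 + 3 / 4 * disc_B s * disc_C s)) (at s)"
    unfolding v unfolding disc_Omega_def[abs_def]
    by (rule DERIV_cong[OF DERIV_diff[OF DERIV_divide[OF dw du] dv]])
       (use u pi0 in \<open>simp_all add: n \<kappa>_def divide_simps u_def[symmetric]\<close>, simp_all add: algebra_simps power2_eq_square eval_nat_numeral)
qed

definition disc_P :: "real \<Rightarrow> real" where "disc_P s = 12 * disc_Omega s + disc_B s - disc_C s"
definition disc_V :: "real \<Rightarrow> real" where "disc_V s = sqrt ((disc_B s)\<^sup>2 + disc_B s * disc_C s + (disc_C s)\<^sup>2)"
definition disc_R :: "real \<Rightarrow> real" where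
  "disc_R s = (disc_B s - disc_C s) * (2 * disc_B s + disc_C s) * (disc_B s + 2 * disc_C s) / 2"
definition disc_t :: "real \<Rightarrow> real" where "disc_t s = disc_R s / disc_V s ^ 3"

definition disc_Delta :: "real \<Rightarrow> real" where
  "disc_Delta s = 1 / ((disc_B 0 + disc_C 0) * disc_B 0 * disc_C 0)\<^sup>2 * ((disc_B s + disc_C s) * disc_B s * disc_C s)\<^sup>2"

definition disc_deriv :: "nat \<Rightarrow> real \<Rightarrow> real" where
  "disc_deriv n s = (- pi / 3) ^ n * (disc_Delta s * (\<Sum>k\<le>n. bol_coeff n k * disc_P s ^ (n - k) * (disc_V s ^ k * serre_eval k (disc_t s))))"

lemma disc_deriv_has_derivative:
  assumes s: "s \<in> {-1<..<1}"
  shows "(disc_deriv n has_real_derivative disc_deriv (Suc n) s) (at s)"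
proof -
  note ode = serre_ode(1-3)[OF disc_ode[OF s] disc_pos[OF s]]
  have 1: "(disc_Delta has_real_derivative - pi / 3 * (12 * disc_P s * disc_Delta s)) (at s)"
    using serre_ode(4)[OF disc_ode[OF s] disc_pos[OF s], of "1 / ((disc_B 0 + disc_C 0) * disc_B 0 * disc_C 0)\<^sup>2"]
    unfolding disc_Delta_def disc_P_def by simp
  have 2: "(disc_P has_real_derivative - pi / 3 * ((disc_P s)\<^sup>2 - (disc_V s)\<^sup>2)) (at s)"
    using ode(1) unfolding disc_V_def disc_P_def by simp
  have 3: "(disc_V has_real_derivative - pi / 3 * (2 * (disc_P s * disc_V s - (disc_V s)\<^sup>2 * disc_t s))) (at s)"
    using ode(2) unfolding disc_V_def disc_P_def disc_t_def disc_R_def by simp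
  have 4: "(disc_t has_real_derivative - pi / 3 * (6 * disc_V s * ((disc_t s)\<^sup>2 - 1))) (at s)"
    using ode(3) unfolding disc_V_def disc_P_def disc_t_def disc_R_def by simp
  show ?thesis
    unfolding disc_deriv_def
    by (rule DERIV_cong[OF DERIV_cmult[OF iterated_derivative[OF 1 2 3 4, of n]]]) simp
qed

lemma disc_0:
  "disc_B 0 = Gamma (1 / 4) ^ 4 / (8 * pi ^ 3)" "disc_C 0 = disc_B 0" "disc_Omega 0 = 0"
proof -
  show C: "disc_C 0 = disc_B 0" by (simp add: disc_C_def disc_B_def nome_0 theta2_4_nome_i)
  have "theta nome_i ^ 4 = 2 * disc_B 0"
    using theta2_4_nome_i by (simp add: disc_B_def nome_0 theta2_4_def)
  thus "disc_B 0 = Gamma (1 / 4) ^ 4 / (8 * pi ^ 3)" unfolding theta_nome_i_power4 by simp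
  show "disc_Omega 0 = 0" by (simp add: disc_Omega_def nome_0 theta_log_nome_i)
qed

text \<open>At the centre \<open>disc_P\<close> vanishes, leaving only the summand
  \<open>k = n\<close>, and \<open>disc_t\<close> vanishes, leaving the constant term of the
  polynomial. The remaining factor is the n-th power of \<open>- pi / 3 * disc_V 0\<close>, which is
  \<open>r_i\<close>.\<close>

lemma disc_deriv_0: "disc_deriv n 0 = r_i ^ n * of_int (dseq n)"
proof -
  have B: "disc_B 0 > 0" using disc_pos[of 0] by simp
  have P: "disc_P 0 = 0" and t: "disc_t 0 = 0" and D: "disc_Delta 0 = 1"
    using disc_0(2,3) B by (simp_all add: disc_P_def disc_t_def disc_R_def disc_Delta_def)
  have "disc_V 0 = sqrt (3 * (disc_B 0)\<^sup>2)" by (simp add: disc_V_def disc_0(2) power2_eq_square)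
  also have "\<dots> = sqrt 3 * disc_B 0" using B by (simp add: real_sqrt_mult)
  finally have V: "- pi / 3 * disc_V 0 = r_i"
  proof -
    assume "disc_V 0 = sqrt 3 * disc_B 0"
    hence "- pi / 3 * disc_V 0 = - (sqrt 3 / 3) * (Gamma (1 / 4) ^ 4 / (8 * pi\<^sup>2))"
      unfolding disc_0(1) by (simp add: power2_eq_square power3_eq_cube)
    also have "sqrt 3 / 3 = 1 / sqrt 3" by (simp add: field_simps)
    finally show ?thesis by (simp add: r_i_def)
  qed
  have "(\<Sum>k\<le>n. bol_coeff n k * disc_P 0 ^ (n - k) * (disc_V 0 ^ k * serre_eval k (disc_t 0))) =
     (\<Sum>k\<in>{n}. bol_coeff n k * disc_P 0 ^ (n - k) * (disc_V 0 ^ k * serre_eval k (disc_t 0)))"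
    by (intro sum.mono_neutral_right) (auto simp: P)
  also have "\<dots> = disc_V 0 ^ n * of_int (dseq n)" by (simp add: t serre_eval_at_0)
  finally show ?thesis
    unfolding disc_deriv_def D V[symmetric] power_mult_distrib by simp
qed

subsection \<open>The discriminant\<close>

text \<open>Jacobi's identity (theta_2 theta_3 theta_4)^8 = 256 Delta, with \<open>q\<^sup>2\<close>
  in place of exp(2 pi i z) because \<open>q\<close> is the nome exp(pi i z).\<close>

lemma euler_prod_theta:
  assumes q: "0 < q" "q < 1"
  shows "q\<^sup>2 * euler_prod (q\<^sup>2) ^ 24 = (theta q ^ 4 * theta (- q) ^ 4 * theta2_4 q)\<^sup>2 / 256"
proof -
  have q2: "0 < q\<^sup>2" "q\<^sup>2 < 1" using q by (auto simp: power_less_one_iff)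
  have pos: "euler_prod (q\<^sup>2) > 0" "euler_prod (q ^ 4) > 0"
    using q by (auto intro!: euler_prod_pos simp: power_less_one_iff)
  have "theta q ^ 4 * theta (- q) ^ 4 = ((theta (- (q\<^sup>2)))\<^sup>2) ^ 4"
    using theta_duplication_mult[of q] q by (simp flip: power_mult_distrib)
  also have "theta (- (q\<^sup>2)) = (euler_prod (q\<^sup>2))\<^sup>2 / euler_prod (q ^ 4)"
    using theta_neg_product[OF q2] by (simp flip: power_mult)
  finally have 1: "theta q ^ 4 * theta (- q) ^ 4 = euler_prod (q\<^sup>2) ^ 16 / euler_prod (q ^ 4) ^ 8"
    by (simp add: power_divide flip: power_mult)
  show ?thesis unfolding 1 theta2_4_product[OF q] using pos
    by (simp add: power_divide power_mult_distrib flip: power_mult) (simp add: field_simps flip: power_add)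
qed

section \<open>Holomorphy of Delta and its values on the imaginary axis\<close>

definition cprod :: "complex \<Rightarrow> complex" where
  "cprod q = (\<Prod>n. 1 - q ^ Suc n)"

lemma cprod_convergent:
  assumes "norm q < 1" shows "convergent_prod (\<lambda>n. 1 - q ^ Suc n :: complex)"
proof (rule abs_convergent_prod_imp_convergent_prod, subst abs_convergent_prod_conv_summable)
  have "summable (\<lambda>n. norm q ^ Suc n)" using assms by (subst summable_Suc_iff) (auto intro: summable_geometric)
  thus "summable (\<lambda>n. norm (1 - q ^ Suc n - 1))" by (simp add: norm_power norm_mult)
qed

lemma cprod_of_real:
  assumes "\<bar>x\<bar> < 1" shows "cprod (of_real x) = of_real (euler_prod x)"
proof -
  have "(\<lambda>n. 1 - x ^ Suc n) has_prod euler_prod x"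
    unfolding euler_prod_def by (intro convergent_prod_has_prod euler_prod_convergent assms)
  hence "(\<lambda>n. of_real (1 - x ^ Suc n) :: complex) has_prod of_real (euler_prod x)" by (subst has_prod_of_real_iff)
  hence "(\<lambda>n. 1 - of_real x ^ Suc n :: complex) has_prod of_real (euler_prod x)" by simp
  thus ?thesis unfolding cprod_def by (rule has_prod_unique[symmetric])
qed

lemma cprod_holomorphic: "cprod holomorphic_on ball 0 1"
proof (rule holomorphic_uniform_sequence[where f = "\<lambda>N q. \<Prod>n<N. 1 - q ^ Suc n"])
  fix x :: complex assume "x \<in> ball 0 1"
  then obtain d where d: "d > 0" "cball x d \<subseteq> ball 0 1"
    using open_contains_cball[of "ball 0 (1 :: real)"] open_contains_cball by (metis open_ball)
  obtain r where r: "r < 1" "0 \<le> r" "\<And>q. q \<in> cball x d \<Longrightarrow> norm q \<le> r"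
  proof -
    obtain y where "y \<in> cball x d" "\<forall>q\<in>cball x d. norm q \<le> norm y"
      using continuous_attains_sup[OF compact_cball _ continuous_on_norm_id, of x d] d(1) by auto
    thus ?thesis using d(2) that[of "norm y"] by auto
  qed
  have "uniformly_convergent_on (cball x d) (\<lambda>N q. \<Prod>n<N. 1 - q ^ Suc n)"
  proof (rule uniformly_convergent_on_prod')
    show "uniformly_convergent_on (cball x d) (\<lambda>N q. \<Sum>n<N. norm (1 - q ^ Suc n - 1))"
    proof (rule Weierstrass_m_test')
      fix n q assume "q \<in> cball x d"
      thus "norm (norm (1 - q ^ Suc n - 1)) \<le> r ^ Suc n"
        using r(3)[of q] power_mono[of "norm q" r "Suc n"] by (simp add: norm_power norm_mult)
    next
      show "summable (\<lambda>n. r ^ Suc n)" using r by (subst summable_Suc_iff) (auto intro: summable_geometric)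
    qed
  qed (auto intro!: continuous_intros)
  then obtain l where l: "uniform_limit (cball x d) (\<lambda>N q. \<Prod>n<N. 1 - q ^ Suc n) l sequentially"
    by (auto simp: uniformly_convergent_on_def)
  have "l q = cprod q" if "q \<in> cball x d" for q
  proof (rule LIMSEQ_unique)
    show "(\<lambda>N. \<Prod>n<N. 1 - q ^ Suc n) \<longlonglongrightarrow> l q" using tendsto_uniform_limitI[OF l that] .
    have "norm q < 1" using that d by auto
    thus "(\<lambda>N. \<Prod>n<N. 1 - q ^ Suc n) \<longlonglongrightarrow> cprod q"
      unfolding cprod_def LIMSEQ_lessThan_iff_atMost by (intro convergent_prod_LIMSEQ cprod_convergent)
  qed
  hence "uniform_limit (cball x d) (\<lambda>N q. \<Prod>n<N. 1 - q ^ Suc n) cprod sequentially"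
    using l by (subst uniform_limit_cong'[where g = "\<lambda>N q. \<Prod>n<N. 1 - q ^ Suc n" and i = l]) auto
  thus "\<exists>d>0. cball x d \<subseteq> ball 0 1 \<and> uniform_limit (cball x d) (\<lambda>N q. \<Prod>n<N. 1 - q ^ Suc n) cprod sequentially"
    using d by blast
qed (auto intro!: holomorphic_intros)

lemma norm_nome: "Im z > 0 \<Longrightarrow> norm (exp (2 * of_real pi * \<i> * z)) < 1"
  by (simp add: norm_exp_eq_Re)

lemma Delta_eq:
  assumes "Im z > 0"
  shows "Delta z = exp (2 * of_real pi * \<i> * z) * cprod (exp (2 * of_real pi * \<i> * z)) ^ 24"
  unfolding Delta_def Let_def cprod_def
  by (subst prodinf_power) (use cprod_convergent[OF norm_nome[OF assms]] in auto)

lemma Delta_holomorphic: "Delta holomorphic_on {z. Im z > 0}"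
proof -
  have "(\<lambda>z. exp (2 * of_real pi * \<i> * z) * cprod (exp (2 * of_real pi * \<i> * z)) ^ 24) holomorphic_on {z. Im z > 0}"
    by (intro holomorphic_intros holomorphic_on_compose_gen[OF _ cprod_holomorphic, unfolded o_def])
       (use norm_nome in auto)
  thus ?thesis by (rule holomorphic_transform) (simp add: Delta_eq)
qed

lemma Delta_imaginary:
  assumes "y > 0"
  shows "Delta (\<i> * of_real y) = of_real ((theta (exp (- pi * y)) ^ 4 * theta (- exp (- pi * y)) ^ 4 * theta2_4 (exp (- pi * y)))\<^sup>2 / 256)"
proof -
  define q where "q = exp (- pi * y)"
  have q: "0 < q" "q < 1" using assms by (auto simp: q_def)
  have q2: "\<bar>q\<^sup>2\<bar> < 1" using q by (simp add: power_less_one_iff)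
  have "2 * of_real pi * \<i> * (\<i> * of_real y) = complex_of_real (2 * (- pi * y))" by (simp add: algebra_simps)
  hence e: "exp (2 * of_real pi * \<i> * (\<i> * of_real y)) = complex_of_real (q\<^sup>2)"
    by (simp only: exp_of_real q_def exp_double)
  have "Delta (\<i> * of_real y) = of_real (q\<^sup>2) * cprod (of_real (q\<^sup>2)) ^ 24"
    using assms by (subst Delta_eq) (simp_all only: e Im_i_times Re_complex_of_real)
  also have "\<dots> = of_real (q\<^sup>2 * euler_prod (q\<^sup>2) ^ 24)"
    unfolding cprod_of_real[OF q2] by simp
  finally have "Delta (\<i> * of_real y) = of_real (q\<^sup>2 * euler_prod (q\<^sup>2) ^ 24)" .
  thus ?thesis unfolding euler_prod_theta[OF q] unfolding q_def .
qed

section \<open>The slash action of the Cayley matrix\<close>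

lemma sigma_i_entries:
  "sigma_i $ 1 $ 1 = 1 / 2" "sigma_i $ 1 $ 2 = 1 / 2" "sigma_i $ 2 $ 1 = \<i> / 2" "sigma_i $ 2 $ 2 = - (\<i> / 2)"
  by (simp_all add: sigma_i_def matrix_matrix_mult_def mat_def sum_2 field_simps)

text \<open>The constant is the sixth power of the determinant, -1/64, times 4096 from the twelfth
  power of the factor \<open>- (\<i> / 2)\<close> in the denominator; it explains the -64 in the
  normalisation of the expansion.\<close>

lemma slash12_sigma_i:
  assumes "norm z < 1"
  shows "slash12 f sigma_i z = - 64 * f (\<i> * (1 + z) / (1 - z)) / (1 - z) ^ 12"
proof -
  have z: "1 - z \<noteq> 0" using assms by auto
  have "det sigma_i = - (\<i> / 2)" by (simp add: det_2 sigma_i_entries)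
  hence d: "det sigma_i ^ 6 = - (1 / 64)" by (simp add: power_divide eval_nat_numeral)
  have den: "\<i> / 2 * z + - (\<i> / 2) = - (\<i> / 2) * (1 - z)" by (simp only: right_diff_distrib) simp
  have m: "moebius (1 / 2) (1 / 2) (\<i> / 2) (- (\<i> / 2)) z = \<i> * (1 + z) / (1 - z)"
  proof -
    have num: "1 / 2 * z + 1 / 2 = - (\<i> / 2) * (\<i> * (1 + z))" by (simp add: algebra_simps add_divide_distrib diff_divide_distrib)
    show ?thesis unfolding moebius_def den num by (rule mult_divide_mult_cancel_left) simp
  qed
  have p: "(- (\<i> / 2) * (1 - z)) powi (- 12) = 4096 / (1 - z) ^ 12"
  proof -
    have i12: "(- (\<i> / 2)) ^ 12 = 1 / 4096" by (simp add: power_divide eval_nat_numeral)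
    have "(- (\<i> / 2) * (1 - z)) powi (- 12) = inverse ((- (\<i> / 2) * (1 - z)) ^ 12)"
      by (simp only: power_int_minus power_int_numeral)
    thus ?thesis unfolding power_mult_distrib i12 by (simp add: inverse_eq_divide)
  qed
  show ?thesis unfolding slash12_def sigma_i_entries d m den p by simp
qed

lemma Im_cayley:
  assumes "norm z < 1" shows "Im (\<i> * (1 + z) / (1 - z)) > 0"
proof -
  have "Re ((1 + z) * cnj (1 - z)) = 1 - (norm z)\<^sup>2"
    using cmod_power2[of z] by (simp add: power2_eq_square algebra_simps)
  also have "\<dots> > 0" using assms by (simp add: abs_square_less_1)
  finally have "Re ((1 + z) / (1 - z)) > 0" by (simp add: Re_complex_div_gt_0)
  moreover have "\<i> * (1 + z) / (1 - z) = \<i> * ((1 + z) / (1 - z))" by simp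
  ultimately show ?thesis by (simp only: Im_i_times)
qed

definition disc_F :: "complex \<Rightarrow> complex" where
  "disc_F z = slash12 Delta sigma_i z / (- 64 * Delta \<i>)"

lemma disc_F_holomorphic: "disc_F holomorphic_on ball 0 1"
proof -
  have "(\<lambda>z. - 64 * Delta (\<i> * (1 + z) / (1 - z)) / (1 - z) ^ 12 / (- 64 * Delta \<i>)) holomorphic_on ball 0 1"
  proof (cases "Delta \<i> = 0")
    case False
    thus ?thesis
      by (intro holomorphic_intros holomorphic_on_compose_gen[OF _ Delta_holomorphic, unfolded o_def])
         (use Im_cayley in auto)
  qed auto
  thus ?thesis by (rule holomorphic_transform) (simp add: disc_F_def slash12_sigma_i)
qed

text \<open>The theta expression for Delta contributes \<open>(1 - s) ^ 12\<close> when written in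
  the scaled functions, exactly cancelling the automorphy factor.\<close>

lemma disc_F_of_real:
  assumes s: "s \<in> {-1<..<1}"
  shows "disc_F (of_real s) = of_real (disc_deriv 0 s)"
proof -
  let ?D = "\<lambda>s. (theta (nome s) ^ 4 * theta (- nome s) ^ 4 * theta2_4 (nome s))\<^sup>2 / 256"
  have D: "Delta (\<i> * of_real ((1 + s) / (1 - s))) = of_real (?D s)" if "s \<in> {-1<..<1}" for s
    using Delta_imaginary[of "(1 + s) / (1 - s)"] that by (simp add: nome_def)
  have BC: "?D s = (1 - s) ^ 12 * ((disc_B s + disc_C s) * disc_B s * disc_C s)\<^sup>2 / 256" if "s \<in> {-1<..<1}" for s
  proof -
    have "1 - s \<noteq> 0" using that by auto
    thus ?thesis
      by (simp add: disc_B_def disc_C_def theta2_4_def add_divide_distrib[symmetric] power_mult_distrib power_divide flip: power_mult power_add)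
  qed
  have "disc_F (of_real s) = Delta (\<i> * of_real ((1 + s) / (1 - s))) / (1 - of_real s) ^ 12 / Delta (\<i> * of_real ((1 + 0) / (1 - 0)))"
  proof -
    have n: "norm (complex_of_real s) < 1" using s by auto
    show ?thesis unfolding disc_F_def slash12_sigma_i[OF n] by simp
  qed
  also have "\<dots> = of_real (?D s / (1 - s) ^ 12 / ?D 0)"
  proof -
    have 0: "(0 :: real) \<in> {-1<..<1}" by simp
    show ?thesis unfolding D[OF s] D[OF 0] by simp
  qed
  also have "?D s / (1 - s) ^ 12 / ?D 0 = disc_Delta s"
    unfolding BC[OF s] using BC[of 0] s by (simp add: disc_Delta_def)
  also have "\<dots> = disc_deriv 0 s"
    by (simp add: disc_deriv_def serre_eval_0)
  finally show ?thesis .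
qed

text \<open>A complex derivative can be computed along the real direction alone, so the chain of
  real derivatives on the interval yields the Taylor coefficients of the holomorphic
  function.\<close>

lemma higher_deriv_of_real:
  fixes \<psi> :: "nat \<Rightarrow> real \<Rightarrow> real"
  assumes F: "F holomorphic_on S" "open S" and T: "open T" "of_real ` T \<subseteq> S"
    and F\<psi>: "\<And>s. s \<in> T \<Longrightarrow> F (of_real s) = of_real (\<psi> 0 s)"
    and \<psi>: "\<And>n s. s \<in> T \<Longrightarrow> (\<psi> n has_real_derivative \<psi> (Suc n) s) (at s)"
  shows "s \<in> T \<Longrightarrow> (deriv ^^ n) F (of_real s) = of_real (\<psi> n s)"
proof (induction n arbitrary: s)
  case 0
  thus ?case using F\<psi> by simp
next
  case (Suc n)
  let ?G = "(deriv ^^ n) F"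
  have "?G holomorphic_on S" using F by (intro holomorphic_higher_deriv)
  hence "(?G has_field_derivative deriv ?G (of_real s)) (at (of_real s))"
    using F(2) T(2) Suc.prems by (intro holomorphic_derivI[of _ S]) auto
  moreover have "(of_real has_vector_derivative (1 :: complex)) (at s)"
    using bounded_linear.has_vector_derivative[OF bounded_linear_of_real has_vector_derivative_id] by simp
  ultimately have "((?G \<circ> of_real) has_vector_derivative 1 * deriv ?G (of_real s)) (at s)"
    by (intro field_vector_diff_chain_at)
  moreover have "((?G \<circ> of_real) has_vector_derivative of_real (\<psi> (Suc n) s)) (at s)"
  proof (rule has_vector_derivative_transform_within_open[OF _ T(1) Suc.prems])
    show "((\<lambda>s. of_real (\<psi> n s)) has_vector_derivative complex_of_real (\<psi> (Suc n) s)) (at s)"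
      using \<psi>[OF Suc.prems, of n] unfolding has_real_derivative_iff_has_vector_derivative
      by (rule bounded_linear.has_vector_derivative[OF bounded_linear_of_real])
    show "\<And>x. x \<in> T \<Longrightarrow> complex_of_real (\<psi> n x) = (?G \<circ> of_real) x" using Suc.IH by simp
  qed
  ultimately show ?case by (simp add: vector_derivative_unique_at)
qed

lemma is_Delta_expansion_dseq: "is_Delta_expansion_at_i (\<lambda>n. of_int (dseq n))"
  unfolding is_Delta_expansion_at_i_def
proof (intro allI impI)
  fix z :: complex assume z: "norm z < 1"
  have sub: "complex_of_real ` {-1<..<1} \<subseteq> ball 0 1" by (auto simp: abs_less_iff)
  have d: "(deriv ^^ n) disc_F 0 = of_real (r_i ^ n * of_int (dseq n))" for n
    using higher_deriv_of_real[OF disc_F_holomorphic open_ball, of "{-1<..<1}" disc_deriv 0 n] sub disc_F_of_real disc_deriv_has_derivative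
    by (auto simp: disc_deriv_0)
  have "(\<lambda>n. (deriv ^^ n) disc_F 0 / fact n * (z - 0) ^ n) sums disc_F z"
    by (rule holomorphic_power_series[OF disc_F_holomorphic]) (use z in auto)
  thus "(\<lambda>n. of_int (dseq n) * (complex_of_real r_i * z) ^ n / fact n) sums (slash12 Delta sigma_i z / (- 64 * Delta \<i>))"
    unfolding d disc_F_def by (simp add: power_mult_distrib mult_ac)
qed

text \<open>Uniqueness of power series coefficients, together with \<open>r_i\<close> being nonzero
  because Gamma is positive at 1/4.\<close>

lemma is_Delta_expansion_unique:
  assumes "is_Delta_expansion_at_i p" "is_Delta_expansion_at_i q"
  shows "p = q"
proof -
  let ?f = "\<lambda>q. Abs_fps (\<lambda>n. q n * of_real r_i ^ n / fact n) :: complex fps"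
  have s: "(\<lambda>n. fps_nth (?f q) n * z ^ n) sums (slash12 Delta sigma_i z / (- 64 * Delta \<i>))"
    if "is_Delta_expansion_at_i q" "norm z < 1" for q z
    using that by (simp add: is_Delta_expansion_at_i_def power_mult_distrib mult_ac)
  have r: "fps_conv_radius (?f q) \<ge> 1" if "is_Delta_expansion_at_i q" for q
    unfolding fps_conv_radius_def
  proof (rule conv_radius_geI_ex')
    fix r :: real assume "0 < r" "ereal r < 1"
    thus "summable (\<lambda>n. fps_nth (?f q) n * complex_of_real r ^ n)"
      using s[OF that, of "of_real r"] by (auto dest: sums_summable)
  qed
  have eq: "?f p = ?f q"
  proof (rule eval_fps_eqD)
    show "fps_conv_radius (?f p) > 0" "fps_conv_radius (?f q) > 0"
      using r[OF assms(1)] r[OF assms(2)] by (auto intro: less_le_trans[of _ 1])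
    have "eval_fps (?f p) z = eval_fps (?f q) z" if "z \<in> ball 0 1" for z
      using sums_unique[OF s[OF assms(1), of z]] sums_unique[OF s[OF assms(2), of z]] that
      unfolding eval_fps_def by simp
    thus "\<forall>\<^sub>F z in nhds 0. eval_fps (?f p) z = eval_fps (?f q) z"
      using eventually_nhds_in_open[of "ball 0 1" "0 :: complex"] by (auto elim: eventually_mono)
  qed
  have g: "Gamma (1 / 4 :: real) > 0" by (rule Gamma_real_pos) simp
  have r0: "r_i \<noteq> 0" unfolding r_i_def using less_imp_neq[OF g, symmetric] by simp
  have "p n = q n" for n
    using arg_cong[OF eq, of "\<lambda>f. fps_nth f n"] r0 by simp
  thus ?thesis by (rule ext)
qed

theorem theorem1p4:
  shows "(\<exists>!q. is_Delta_expansion_at_i q) \<and>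
    (\<forall>q. is_Delta_expansion_at_i q \<longrightarrow>
      (\<exists>a :: nat \<Rightarrow> int. (\<forall>n. q n = of_int (a n)) \<and>
        (\<forall>l :: nat. prime l \<and> 2 < l \<and> l < 100 \<longrightarrow>
          ((\<forall>\<^sub>F n in sequentially. [a n = 0] (mod int l)) \<longleftrightarrow> [l = 3] (mod 4)))))"
proof (intro conjI allI impI)
  show "\<exists>!q. is_Delta_expansion_at_i q"
    using is_Delta_expansion_dseq is_Delta_expansion_unique by blast
next
  fix q assume "is_Delta_expansion_at_i q"
  hence q: "q = (\<lambda>n. of_int (dseq n))" by (intro is_Delta_expansion_unique is_Delta_expansion_dseq)
  show "\<exists>a :: nat \<Rightarrow> int. (\<forall>n. q n = of_int (a n)) \<and>
        (\<forall>l :: nat. prime l \<and> 2 < l \<and> l < 100 \<longrightarrow>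
          ((\<forall>\<^sub>F n in sequentially. [a n = 0] (mod int l)) \<longleftrightarrow> [l = 3] (mod 4)))"
  proof (intro exI[of _ dseq] conjI allI impI)
    fix l :: nat assume "prime l \<and> 2 < l \<and> l < 100"
    thus "(\<forall>\<^sub>F n in sequentially. [dseq n = 0] (mod int l)) \<longleftrightarrow> [l = 3] (mod 4)"
      unfolding cong_0_iff by (intro eventually_dvd_dseq_iff) auto
  qed (simp add: q)
qed

end
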